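(* Let $G$ be a finite connected simple graph with at most one cycle, with rooted trees $T_1,\dots,T_m$ and levels as in the context. Let $z_0\in T_i$ be a leaf of $G$ of the highest level among all leaves of $G$ in $T_i$, and assume $\operatorname{level}(z_0)\ge 2$. Let $y_0$ be the unique neighbor of $z_0$, and write $N(y_0)=\{z_0,z_1,\dots,z_s\}\cup\{x_0\}$, where $z_1,\dots,z_s$ ($s\ge 0$) are leaves of $G$ having the same level as $z_0$ and $x_0$ is the unique neighbor of $y_0$ of smaller level. Put $G_{z_0,1}=G\setminus\{z_0,\dots,z_s\}$, $G_{z_0,2}=G\setminus N[y_0]$, $G_{z_0,3}=G\setminus N[\{y_0,x_0\}]$, and $p_j=\operatorname{pd}(I_3(G_{z_0,j}))$ for $j=1,2,3$. Then $$\operatorname{pd}(I_3(G))=\begin{cases}\max\{p_1,\ p_2+s+1,\ p_3+|N(x_0)|+s\}, & \text{if } s>0,\\ \max\{p_1,\ p_3+|N(x_0)|\}, & \text{if } s=0.\end{cases}$$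
   Context: $S=\mathrm{k}[x\mid x\in V(G)]$ is a standard graded polynomial ring over an arbitrary field $\mathrm{k}$. A $3$-path of a graph $H$ is a sequence $x,y,z$ of distinct vertices with $\{x,y\},\{y,z\}\in E(H)$; $I_3(H)$ is the ideal generated by the monomials $xyz$ over all $3$-paths $x,y,z$ of $H$. All $3$-path ideals of induced subgraphs of $G$ are viewed as ideals of $S$. For a finitely generated graded $S$-module $M$, $\operatorname{pd}(M)=\sup\{i\mid \beta_i(M)\ne 0\}$, where $\beta_i(M)=\dim_{\mathrm{k}}\operatorname{Tor}_i^S(\mathrm{k},M)$. $N(x)$ is the set of neighbors of $x$ in $G$, $N[x]=N(x)\cup\{x\}$, $N[U]=\bigcup_{x\in U}N[x]$; $G\setminus U$ is the induced subgraph on $V(G)\setminus U$. A leaf is a vertex with exactly one neighbor. If $G$ has a cycle, let it be on vertices $v_1,\dots,v_m$, and let $T_i$ be the tree attached to $v_i$, i.e. the connected component containing $v_i$ of the graph obtained from $G$ by deleting the edges of the cycle, rooted at $v_i$. If $G$ is a tree, $m=1$, $v_1$ is a chosen vertex, and $T_1=G$ rooted at $v_1$. The level of $y\in T_i$ is the length of the unique path in $T_i$ from $v_i$ to $y$.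
   Formalization: The projective dimension of the zero ideal, where the supremum in the definition is over the empty set, is taken to be -1; with 0 or minus infinity instead the formula fails for the 3-vertex path or for the star with three leaves. *)

theory Defs
  imports
    "HOL-Library.Poly_Mapping"
    "Jordan_Normal_Form.Matrix_Kernel"
    "Jordan_Normal_Form.DL_Rank"
begin

section \<open>Graphs\<close>

record 'v graph =
  verts :: "'v set"
  edges :: "'v set set"

definition simple_graph :: "'v graph \<Rightarrow> bool" where
  "simple_graph G \<longleftrightarrow> finite (verts G) \<and> (\<forall>e\<in>edges G. e \<subseteq> verts G \<and> card e = 2)"

definition nbrs :: "'v graph \<Rightarrow> 'v \<Rightarrow> 'v set" where
  "nbrs G x = {y. {x, y} \<in> edges G}"

definition closed_nbrs :: "'v graph \<Rightarrow> 'v set \<Rightarrow> 'v set" where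
  "closed_nbrs G U = (\<Union>x\<in>U. insert x (nbrs G x))"

definition is_leaf :: "'v graph \<Rightarrow> 'v \<Rightarrow> bool" where
  "is_leaf G x \<longleftrightarrow> x \<in> verts G \<and> card (nbrs G x) = 1"

definition induced :: "'v graph \<Rightarrow> 'v set \<Rightarrow> 'v graph" where
  "induced G U = \<lparr>verts = U, edges = {e \<in> edges G. e \<subseteq> U}\<rparr>"

definition delete_verts :: "'v graph \<Rightarrow> 'v set \<Rightarrow> 'v graph" where
  "delete_verts G U = induced G (verts G - U)"

definition delete_edges :: "'v graph \<Rightarrow> 'v set set \<Rightarrow> 'v graph" where
  "delete_edges G F = \<lparr>verts = verts G, edges = edges G - F\<rparr>"

definition is_path :: "'v graph \<Rightarrow> 'v list \<Rightarrow> bool" where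
  "is_path G p \<longleftrightarrow> p \<noteq> [] \<and> distinct p \<and> set p \<subseteq> verts G \<and>
     successively (\<lambda>x y. {x, y} \<in> edges G) p"

definition is_path_between :: "'v graph \<Rightarrow> 'v \<Rightarrow> 'v list \<Rightarrow> 'v \<Rightarrow> bool" where
  "is_path_between G x p y \<longleftrightarrow> is_path G p \<and> hd p = x \<and> last p = y"

definition connected_graph :: "'v graph \<Rightarrow> bool" where
  "connected_graph G \<longleftrightarrow> verts G \<noteq> {} \<and>
     (\<forall>x\<in>verts G. \<forall>y\<in>verts G. \<exists>p. is_path_between G x p y)"

definition component_of :: "'v graph \<Rightarrow> 'v \<Rightarrow> 'v graph" where
  "component_of G x = induced G {y. \<exists>p. is_path_between G x p y}"

text \<open>A cycle is presented by the list of its vertices in cyclic order. Different lists (rotations,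
  reversals) may present the same cycle; they do so exactly if the edge sets agree.\<close>

definition is_cycle :: "'v graph \<Rightarrow> 'v list \<Rightarrow> bool" where
  "is_cycle G c \<longleftrightarrow> length c \<ge> 3 \<and> is_path G c \<and> {last c, hd c} \<in> edges G"

definition cycle_edges :: "'v list \<Rightarrow> 'v set set" where
  "cycle_edges c = {{c ! i, c ! (Suc i mod length c)} | i. i < length c}"

definition at_most_one_cycle :: "'v graph \<Rightarrow> bool" where
  "at_most_one_cycle G \<longleftrightarrow>
     (\<forall>c c'. is_cycle G c \<longrightarrow> is_cycle G c' \<longrightarrow> cycle_edges c = cycle_edges c')"

text \<open>The list of roots \<open>v\<^sub>1, \<dots>, v\<^sub>m\<close>: the vertices of the cycle if there is one, and a single
  vertex (arbitrarily chosen) if there is none.\<close>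

definition is_root_list :: "'v graph \<Rightarrow> 'v list \<Rightarrow> bool" where
  "is_root_list G vs \<longleftrightarrow>
     (if \<exists>c. is_cycle G c then is_cycle G vs else (\<exists>r\<in>verts G. vs = [r]))"

text \<open>The tree attached to the root \<open>r\<close>. For \<open>vs = [r]\<close> the set \<open>cycle_edges vs\<close> is \<open>{{r}}\<close>,
  which contains no edge of a simple graph, so nothing is deleted.\<close>

definition attached_tree :: "'v graph \<Rightarrow> 'v list \<Rightarrow> 'v \<Rightarrow> 'v graph" where
  "attached_tree G vs r = component_of (delete_edges G (cycle_edges vs)) r"

definition level :: "'v graph \<Rightarrow> 'v \<Rightarrow> 'v \<Rightarrow> nat" where
  "level T r y = length (THE p. is_path_between T r p y) - 1"

section \<open>Polynomials and path ideals\<close>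

text \<open>For finite \<open>'v\<close> this is the polynomial ring over \<open>'k\<close> with one variable for each element of
  \<open>'v\<close>: exponent vectors are maps \<open>'v \<Rightarrow>\<^sub>0 nat\<close>.\<close>

type_synonym ('v, 'k) mpoly = "('v \<Rightarrow>\<^sub>0 nat) \<Rightarrow>\<^sub>0 'k"

definition indet :: "'v \<Rightarrow> ('v, 'k::field) mpoly" where
  "indet v = Poly_Mapping.single (Poly_Mapping.single v 1) 1"

definition ideal_generated :: "('v, 'k::field) mpoly set \<Rightarrow> ('v, 'k) mpoly set" where
  "ideal_generated B = module.span times B"

definition is_3path :: "'v graph \<Rightarrow> 'v \<Rightarrow> 'v \<Rightarrow> 'v \<Rightarrow> bool" where
  "is_3path H x y z \<longleftrightarrow> distinct [x, y, z] \<and> {x, y} \<in> edges H \<and> {y, z} \<in> edges H"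

definition path_ideal3 :: "'v graph \<Rightarrow> ('v, 'k::field) mpoly set" where
  "path_ideal3 H = ideal_generated {indet x * indet y * indet z | x y z. is_3path H x y z}"

section \<open>Betti numbers and projective dimension\<close>

text \<open>A resolution of an ideal \<open>I\<close> by free modules of finite rank,
  \<open>\<dots> \<rightarrow> S\<^bsup>b\<^sub>1\<^esup> \<rightarrow> S\<^bsup>b\<^sub>0\<^esup> \<rightarrow> I \<rightarrow> 0\<close>, is given by matrices over \<open>S\<close>: \<open>D 0\<close> is the
  \<open>1 \<times> b\<^sub>0\<close> matrix of the augmentation \<open>S\<^bsup>b\<^sub>0\<^esup> \<rightarrow> I \<subseteq> S\<close>, and for \<open>i > 0\<close> the \<open>i\<close>-th differential is
  the \<open>b\<^bsub>i-1\<^esub> \<times> b\<^sub>i\<close> matrix \<open>D i\<close>. Thus \<open>dim_col (D i)\<close> is \<open>b\<^sub>i\<close>.\<close>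

definition mat_image :: "'a::comm_ring_1 mat \<Rightarrow> 'a vec set" where
  "mat_image A = {A *\<^sub>v v | v. v \<in> carrier_vec (dim_col A)}"

definition free_resolution :: "(nat \<Rightarrow> ('v, 'k::field) mpoly mat) \<Rightarrow> ('v, 'k) mpoly set \<Rightarrow> bool" where
  "free_resolution D I \<longleftrightarrow>
     dim_row (D 0) = 1 \<and> (\<forall>i. dim_row (D (Suc i)) = dim_col (D i)) \<and>
     (\<lambda>w. w $ 0) ` mat_image (D 0) = I \<and>
     (\<forall>i. mat_kernel (D i) = mat_image (D (Suc i)))"

text \<open>The complex \<open>k \<otimes>\<^sub>S F\<close> for \<open>F = (\<dots> \<rightarrow> S\<^bsup>b\<^sub>1\<^esup> \<rightarrow> S\<^bsup>b\<^sub>0\<^esup> \<rightarrow> 0)\<close>. Since \<open>k\<close> is the residue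
  field of \<open>S\<close> modulo the variables, tensoring with \<open>k\<close> replaces matrix entries by their constant
  terms. The augmentation is dropped, so the differential in degree \<open>0\<close> is \<open>k\<^bsup>b\<^sub>0\<^esup> \<rightarrow> 0\<close>.\<close>

definition const_coeff :: "('v, 'k::field) mpoly \<Rightarrow> 'k" where
  "const_coeff f = Poly_Mapping.lookup f 0"

definition residue_differential :: "(nat \<Rightarrow> ('v, 'k::field) mpoly mat) \<Rightarrow> nat \<Rightarrow> 'k mat" where
  "residue_differential D i =
     (if i = 0 then 0\<^sub>m 0 (dim_col (D 0)) else map_mat const_coeff (D i))"

definition mat_rank :: "'k::field mat \<Rightarrow> nat" where
  "mat_rank A = vec_space.rank (dim_row A) A"

text \<open>\<open>Tor\<^sub>i(k, I) = H\<^sub>i(k \<otimes>\<^sub>S F)\<close> does not depend on the resolution \<open>F\<close> of \<open>I\<close>, so an arbitrary one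
  is chosen. The dimension of homology is that of the cycles minus that of the boundaries.\<close>

definition betti :: "('v, 'k::field) mpoly set \<Rightarrow> nat \<Rightarrow> nat" where
  "betti I i =
     (let D = (SOME D. free_resolution D I) in
      kernel_dim (residue_differential D i) - mat_rank (residue_differential D (Suc i)))"

text \<open>The zero ideal has no nonzero Betti number; the supremum of the empty set is taken to be
  \<open>-1\<close> here, so that \<open>pd I = pd (S / I) - 1\<close> for every proper ideal \<open>I\<close>, including \<open>I = 0\<close>.\<close>

definition pd :: "('v, 'k::field) mpoly set \<Rightarrow> int" where
  "pd I = (if I = {0} then - 1 else int (Sup {i. betti I i \<noteq> 0}))"

end

theory Submission
  imports Defs
begin

text \<open>By the long exact sequences along a free resolution, \<open>Tor\<^sub>i(k, I)\<close> is the homology of the Koszul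
  complex with coefficients in \<open>I\<close>. For a squarefree monomial ideal this homology is multigraded, it
  lives in squarefree degrees \<open>W\<close>, and there \<open>Tor\<^sub>j(k, S/I)\<close> is the homology of the complex spanned by
  the sets \<open>\<tau> \<subseteq> W\<close> such that \<open>W - \<tau>\<close> contains no generator. A vertex \<open>v \<in> W\<close> gives a long exact
  sequence relating \<open>I\<close> in degree \<open>W\<close> to \<open>I\<close> and to \<open>I : v\<close> in degree \<open>W - {v}\<close>.

  If \<open>W\<close> contains some of the leaves \<open>z\<^sub>j\<close>, the homology vanishes unless \<open>y\<^sub>0 \<in> W\<close>, and then \<open>I\<close> may be
  replaced by \<open>I : y\<^sub>0\<close>. On the vertices other than \<open>x\<^sub>0, y\<^sub>0\<close> this ideal is generated by the products of
  two leaves and by \<open>I\<^sub>3(G\<^sub>2)\<close>, whereas \<open>I : x\<^sub>0 y\<^sub>0\<close> is generated by the leaves, the other neighbours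
  of \<open>x\<^sub>0\<close>, and \<open>I\<^sub>3(G\<^sub>3)\<close>. The connecting maps vanish because a leaf contracts them, so no
  cancellation occurs and the degrees add up to the three terms of the formula.\<close>

section \<open>Signed set complexes\<close>

text \<open>The constants count vertices in the top multidegree. A variable of a colon ideal raises
  the homological degree by one, so the s + 1 leaves and the |N(x0)| - 1 further neighbours of x0
  give |N(x0)| + s. The ideal of all products of two among n leaves contributes n - 1 in the degree
  of all n leaves, and nothing if n = 1; the vertex x0 adds one more. This gives s + 1 for s > 0 and
  removes the middle term for s = 0. The vertex y0 adds nothing, since it is only divided out.
  \<open>betti\<close> is defined by an unspecified resolution, possibly far from minimal. Dimension
  shifting along it expresses its homology by Koszul homology, and a resolution by finite free
  modules has to be constructed for the choice to be meaningful. Only nonvanishing is transported,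
  never a dimension, since the supremum sees nothing else. Counting degrees by Tor of S/I makes the
  zero ideal a regular case: degree 0 always occurs, and the largest degree minus one is then
  -1.\<close>

definition vidx :: "'v::finite \<Rightarrow> nat" where
  "vidx = (SOME e. inj e)"

lemma inj_vidx: "inj (vidx :: 'v::finite \<Rightarrow> nat)"
proof -
  have "\<exists>e :: 'v \<Rightarrow> nat. inj e"
    using finite_imp_inj_to_nat_seg[OF finite, of "UNIV :: 'v set"] by blast
  then show ?thesis unfolding vidx_def by (rule someI_ex)
qed

text \<open>The usual orientation sign for an arbitrary but fixed enumeration of the vertices;
  \<open>\<tau>\<close> is the set before \<open>v\<close> is added.\<close>

definition ksgn :: "'v::finite \<Rightarrow> 'v set \<Rightarrow> 'a::comm_ring_1" where
  "ksgn v \<tau> = (- 1) ^ card {u \<in> \<tau>. vidx u < vidx v}"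

lemma ksgn_square [simp]: "ksgn v \<tau> * ksgn v \<tau> = (1 :: 'a::comm_ring_1)"
  by (simp add: ksgn_def power_mult_distrib [symmetric])

lemma ksgn_square' [simp]: "ksgn v \<tau> * (ksgn v \<tau> * x) = (x :: 'a::comm_ring_1)"
  by (metis ksgn_square mult.assoc mult_1)

lemma ksgn_insert:
  assumes "z \<notin> \<tau>"
  shows "ksgn v (insert z \<tau>) = (if vidx z < vidx v then - ksgn v \<tau> else ksgn v \<tau> :: 'a::comm_ring_1)"
proof (cases "vidx z < vidx v")
  case True
  then have "{u \<in> insert z \<tau>. vidx u < vidx v} = insert z {u \<in> \<tau>. vidx u < vidx v}" by auto
  then show ?thesis using assms True by (simp add: ksgn_def)
next
  case False
  then have "{u \<in> insert z \<tau>. vidx u < vidx v} = {u \<in> \<tau>. vidx u < vidx v}" by auto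
  then show ?thesis using False by (simp add: ksgn_def)
qed

text \<open>Exactly one of the two vertices comes first in the enumeration, and only the sign of the
  later one changes when the other is present. This rule is behind the cancellations in
  \<open>bd_bd\<close> and \<open>bd_hop\<close>.\<close>

lemma ksgn_anti:
  assumes "v \<noteq> z" "v \<notin> \<tau>" "z \<notin> \<tau>"
  shows "ksgn z \<tau> * ksgn v (insert z \<tau>) = - (ksgn v \<tau> * ksgn z (insert v \<tau>) :: 'a::comm_ring_1)"
proof -
  have "vidx v \<noteq> vidx z" using assms(1) inj_vidx by (metis injD)
  then show ?thesis using assms by (auto simp: ksgn_insert)
qed

text \<open>A function on sets is the coefficient vector of a chain, so the boundary at
  \<open>\<tau>\<close> collects the coefficients of the sets that have \<open>\<tau>\<close> as a
  facet. It is taken among all sets of vertices; smaller complexes arise by restricting where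
  functions may be nonzero and where equations are required.\<close>

definition bd :: "('v::finite set \<Rightarrow> 'a::comm_ring_1) \<Rightarrow> 'v set \<Rightarrow> 'a" where
  "bd f \<tau> = (\<Sum>v\<in>- \<tau>. ksgn v \<tau> * f (insert v \<tau>))"

text \<open>Coning with \<open>v\<close>, i.e. exterior multiplication by the basis vector of
  \<open>v\<close>.\<close>

definition hop :: "'v::finite \<Rightarrow> ('v set \<Rightarrow> 'a::comm_ring_1) \<Rightarrow> 'v set \<Rightarrow> 'a" where
  "hop v f \<tau> = (if v \<in> \<tau> then ksgn v (\<tau> - {v}) * f (\<tau> - {v}) else 0)"

lemma bd_add: "bd (\<lambda>\<tau>. f \<tau> + g \<tau>) \<tau> = bd f \<tau> + bd g \<tau>"
  by (simp add: bd_def distrib_left sum.distrib)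

lemma bd_diff: "bd (\<lambda>\<tau>. f \<tau> - g \<tau>) \<tau> = bd f \<tau> - bd g \<tau>"
  by (simp add: bd_def right_diff_distrib sum_subtractf)

lemma bd_minus: "bd (\<lambda>\<tau>. - f \<tau>) \<tau> = - bd f \<tau>"
  by (simp add: bd_def sum_negf)

lemma bd_zero [simp]: "bd (\<lambda>\<tau>. 0) \<tau> = 0"
  by (simp add: bd_def)

lemma bd_cong:
  assumes "\<And>v. v \<notin> \<tau> \<Longrightarrow> f (insert v \<tau>) = g (insert v \<tau>)"
  shows "bd f \<tau> = bd g \<tau>"
  unfolding bd_def by (rule sum.cong) (auto simp: assms)

lemma bd_nonzeroE:
  assumes "bd f \<tau> \<noteq> 0"
  obtains v where "v \<notin> \<tau>" "f (insert v \<tau>) \<noteq> 0"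
proof -
  have "\<exists>v\<in>- \<tau>. f (insert v \<tau>) \<noteq> 0"
  proof (rule ccontr)
    assume "\<not> ?thesis"
    then have "bd f \<tau> = 0" unfolding bd_def by (intro sum.neutral) simp
    then show False using assms by contradiction
  qed
  then show ?thesis using that by blast
qed

lemma bd_bd [simp]:
  fixes f :: "'v::finite set \<Rightarrow> 'a::comm_ring_1"
  shows "bd (bd f) \<tau> = 0"
proof -
  let ?g = "\<lambda>(v, u). ksgn v \<tau> * ksgn u (insert v \<tau>) * f (insert u (insert v \<tau>))"
  let ?P = "{(v, u). v \<notin> \<tau> \<and> u \<notin> \<tau> \<and> vidx v < vidx u}"
  let ?Q = "{(v, u). v \<notin> \<tau> \<and> u \<notin> \<tau> \<and> vidx u < vidx v}"
  have neq: "vidx v < vidx u \<or> vidx u < vidx v" if "v \<noteq> u" for v u :: 'v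
    using that inj_vidx by (metis injD linorder_neqE_nat)
  have "bd (bd f) \<tau> = (\<Sum>v\<in>- \<tau>. \<Sum>u\<in>- insert v \<tau>. ?g (v, u))"
    by (simp add: bd_def sum_distrib_left mult.assoc)
  also have "\<dots> = sum ?g (Sigma (- \<tau>) (\<lambda>v. - insert v \<tau>))"
    by (subst sum.Sigma) (auto simp: finite)
  also have "Sigma (- \<tau>) (\<lambda>v. - insert v \<tau>) = ?P \<union> ?Q"
    using neq by auto
  also have "sum ?g (?P \<union> ?Q) = sum ?g ?P + sum ?g ?Q"
    by (rule sum.union_disjoint) auto
  also have "sum ?g ?Q = (\<Sum>p\<in>?P. - ?g p)"
  proof (rule sum.reindex_bij_witness[of _ prod.swap prod.swap], goal_cases)
    case (5 p)
    then obtain v u where p: "p = (v, u)" "v \<notin> \<tau>" "u \<notin> \<tau>" "u \<noteq> v" by auto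
    then show ?case
      using ksgn_anti[OF \<open>u \<noteq> v\<close> \<open>u \<notin> \<tau>\<close> \<open>v \<notin> \<tau>\<close>, where ?'a = 'a]
      by (simp add: insert_commute[of u v \<tau>])
  qed auto
  finally show ?thesis by (simp add: sum_negf)
qed

text \<open>The homotopy formula: coning with \<open>z\<close> contracts the full simplex, and any
  family that the cone does not leave. For \<open>z\<close> in \<open>\<tau>\<close> the term of the
  boundary that puts \<open>z\<close> back reproduces \<open>f\<close>, and the others cancel by
  \<open>ksgn_anti\<close>.\<close>

lemma bd_hop: "bd (hop z f) \<tau> + hop z (bd f) \<tau> = f \<tau>"
proof (cases "z \<in> \<tau>")
  case False
  have "bd (hop z f) \<tau> = (\<Sum>v\<in>- \<tau>. if v = z then f \<tau> else 0)"
    unfolding bd_def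
  proof (rule sum.cong)
    fix v assume "v \<in> - \<tau>"
    then show "ksgn v \<tau> * hop z f (insert v \<tau>) = (if v = z then f \<tau> else 0)"
      using False by (auto simp: hop_def)
  qed simp
  also have "\<dots> = f \<tau>" using False by (simp add: sum.delta)
  finally show ?thesis using False by (simp add: hop_def)
next
  case True
  define \<sigma> where "\<sigma> = \<tau> - {z}"
  have \<tau>: "\<tau> = insert z \<sigma>" "z \<notin> \<sigma>" using True by (auto simp: \<sigma>_def)
  have "- \<sigma> = insert z (- \<tau>)" using \<tau> by auto
  then have "hop z (bd f) \<tau> = ksgn z \<sigma> * (ksgn z \<sigma> * f \<tau> + (\<Sum>v\<in>- \<tau>. ksgn v \<sigma> * f (insert v \<sigma>)))"
    using True \<tau> by (simp add: hop_def bd_def)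
  also have "\<dots> = f \<tau> + (\<Sum>v\<in>- \<tau>. ksgn z \<sigma> * ksgn v \<sigma> * f (insert v \<sigma>))"
    by (simp add: distrib_left sum_distrib_left mult.assoc)
  finally have 1: "hop z (bd f) \<tau> = f \<tau> + (\<Sum>v\<in>- \<tau>. ksgn z \<sigma> * ksgn v \<sigma> * f (insert v \<sigma>))" .
  have "bd (hop z f) \<tau> = (\<Sum>v\<in>- \<tau>. - (ksgn z \<sigma> * ksgn v \<sigma> * f (insert v \<sigma>)))"
    unfolding bd_def
  proof (rule sum.cong)
    fix v assume "v \<in> - \<tau>"
    then have v: "v \<noteq> z" "v \<notin> \<sigma>" using \<tau> by auto
    have "insert v \<tau> - {z} = insert v \<sigma>" using v \<tau> by auto
    then have "ksgn v \<tau> * hop z f (insert v \<tau>)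
        = ksgn v (insert z \<sigma>) * (ksgn z (insert v \<sigma>) * f (insert v \<sigma>))"
      using \<tau> by (simp add: hop_def)
    also have "\<dots> = ksgn z \<sigma> * (ksgn z \<sigma> * ksgn v (insert z \<sigma>)) * (ksgn z (insert v \<sigma>) * f (insert v \<sigma>))"
      by (simp add: mult.assoc)
    also have "\<dots> = - (ksgn z \<sigma> * ksgn v \<sigma> * f (insert v \<sigma>))"
      by (subst ksgn_anti[OF v(1) v(2) \<tau>(2)]) (simp add: mult.assoc)
    finally show "ksgn v \<tau> * hop z f (insert v \<tau>) = - (ksgn z \<sigma> * ksgn v \<sigma> * f (insert v \<sigma>))" .
  qed simp
  then show ?thesis using 1 by (simp add: sum_negf)
qed

section \<open>Homology of set families, graded by cardinality\<close>

definition chain_on :: "'v set set \<Rightarrow> nat \<Rightarrow> ('v::finite set \<Rightarrow> 'a::comm_ring_1) \<Rightarrow> bool" where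
  "chain_on \<F> i f \<longleftrightarrow> (\<forall>\<tau>. f \<tau> \<noteq> 0 \<longrightarrow> \<tau> \<in> \<F> \<and> card \<tau> = i)"

text \<open>The equation is required only on members of the family, so boundary terms outside it are
  discarded. For a family closed under subsets this is the ordinary complex of a simplicial complex;
  for one closed under supersets it is a relative complex. Both kinds are used.\<close>

definition cycle_on :: "'v set set \<Rightarrow> nat \<Rightarrow> ('v::finite set \<Rightarrow> 'a::comm_ring_1) \<Rightarrow> bool" where
  "cycle_on \<F> i f \<longleftrightarrow> chain_on \<F> i f \<and> (\<forall>\<tau>\<in>\<F>. bd f \<tau> = 0)"

definition boundary_on :: "'v set set \<Rightarrow> nat \<Rightarrow> ('v::finite set \<Rightarrow> 'a::comm_ring_1) \<Rightarrow> bool" where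
  "boundary_on \<F> i f \<longleftrightarrow> (\<exists>g. chain_on \<F> (Suc i) g \<and> (\<forall>\<tau>\<in>\<F>. f \<tau> = bd g \<tau>))"

text \<open>The type argument fixes the coefficient ring, which occurs in no other argument. The
  degree is the cardinality, one more than the simplicial dimension.\<close>

definition hnz :: "'a::comm_ring_1 itself \<Rightarrow> 'v::finite set set \<Rightarrow> nat \<Rightarrow> bool" where
  "hnz (_ :: 'a itself) \<F> i \<longleftrightarrow>
     (\<exists>f :: 'v set \<Rightarrow> 'a. cycle_on \<F> i f \<and> \<not> boundary_on \<F> i f)"

definition restr :: "'v set set \<Rightarrow> ('v set \<Rightarrow> 'a) \<Rightarrow> 'v set \<Rightarrow> 'a::zero" where
  "restr \<F> f \<tau> = (if \<tau> \<in> \<F> then f \<tau> else 0)"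

lemma chain_onD: "chain_on \<F> i f \<Longrightarrow> f \<tau> \<noteq> 0 \<Longrightarrow> \<tau> \<in> \<F> \<and> card \<tau> = i"
  by (simp add: chain_on_def)

lemma chain_on_add:
  assumes "chain_on \<F> i f" "chain_on \<F> i g"
  shows "chain_on \<F> i (\<lambda>\<tau>. f \<tau> + g \<tau>)"
  unfolding chain_on_def
proof (intro allI impI)
  fix \<tau> assume "f \<tau> + g \<tau> \<noteq> 0"
  then have "f \<tau> \<noteq> 0 \<or> g \<tau> \<noteq> 0" by auto
  then show "\<tau> \<in> \<F> \<and> card \<tau> = i" using assms chain_onD by blast
qed

lemma chain_on_diff:
  assumes "chain_on \<F> i f" "chain_on \<F> i g"
  shows "chain_on \<F> i (\<lambda>\<tau>. f \<tau> - g \<tau>)"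
  unfolding chain_on_def
proof (intro allI impI)
  fix \<tau> assume "f \<tau> - g \<tau> \<noteq> 0"
  then have "f \<tau> \<noteq> 0 \<or> g \<tau> \<noteq> 0" by auto
  then show "\<tau> \<in> \<F> \<and> card \<tau> = i" using assms chain_onD by blast
qed

lemma chain_on_minus: "chain_on \<F> i f \<Longrightarrow> chain_on \<F> i (\<lambda>\<tau>. - f \<tau>)"
  by (auto simp: chain_on_def)

lemma chain_on_bd:
  assumes "chain_on \<F> (Suc i) f" "bd f \<tau> \<noteq> 0"
  shows "card \<tau> = i"
proof -
  obtain v where v: "v \<notin> \<tau>" "f (insert v \<tau>) \<noteq> 0" using bd_nonzeroE assms(2) by blast
  then show ?thesis using chain_onD[OF assms(1) v(2)] by simp
qed

lemma bd_outside:
  assumes "chain_on \<F> i f" "\<And>v \<tau>. insert v \<tau> \<in> \<F> \<Longrightarrow> \<tau> \<in> \<F>" "\<tau> \<notin> \<F>"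
  shows "bd f \<tau> = 0"
proof (rule ccontr)
  assume "bd f \<tau> \<noteq> 0"
  then obtain v where "f (insert v \<tau>) \<noteq> 0" by (rule bd_nonzeroE)
  then show False using assms chain_onD by blast
qed

lemma hop_nonzeroD:
  assumes "hop z f \<tau> \<noteq> 0"
  shows "z \<in> \<tau>" "f (\<tau> - {z}) \<noteq> 0"
  using assms by (auto simp: hop_def split: if_splits)

lemma chain_on_hop_card:
  assumes "chain_on \<F> i f" "hop z f \<tau> \<noteq> 0"
  shows "card \<tau> = Suc i"
proof -
  have "card (\<tau> - {z}) = i" "z \<in> \<tau>"
    using chain_onD[OF assms(1)] hop_nonzeroD[OF assms(2)] by auto
  then show ?thesis using card_Suc_Diff1[of \<tau> z] by simp
qed

lemma not_hnz_zero_chain: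
  assumes "\<And>\<tau>. \<tau> \<in> \<F> \<Longrightarrow> card \<tau> \<noteq> i"
  shows "\<not> hnz TYPE('a::comm_ring_1) \<F> i"
proof -
  have "boundary_on \<F> i f" if "cycle_on \<F> i f" for f :: "'b set \<Rightarrow> 'a"
  proof -
    have "f \<tau> = 0" for \<tau> using that assms by (auto simp: cycle_on_def chain_on_def)
    then show ?thesis unfolding boundary_on_def by (intro exI[of _ "\<lambda>_. 0"]) (simp add: chain_on_def)
  qed
  then show ?thesis unfolding hnz_def by blast
qed

text \<open>Neither adding nor removing \<open>v\<close> leaves the family, so the homotopy of
  \<open>bd_hop\<close> fills every cycle.\<close>

lemma not_hnz_cone:
  assumes cone: "\<And>\<tau>. v \<notin> \<tau> \<Longrightarrow> \<tau> \<in> \<F> \<longleftrightarrow> insert v \<tau> \<in> \<F>"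
  shows "\<not> hnz TYPE('a::comm_ring_1) \<F> i"
proof -
  have "boundary_on \<F> i f" if f: "cycle_on \<F> i f" for f :: "'b set \<Rightarrow> 'a"
    unfolding boundary_on_def
  proof (intro exI conjI ballI)
    have ch: "chain_on \<F> i f" using f by (simp add: cycle_on_def)
    show "chain_on \<F> (Suc i) (hop v f)"
      unfolding chain_on_def
    proof (intro allI impI conjI)
      fix \<tau> assume h: "hop v f \<tau> \<noteq> 0"
      then show "card \<tau> = Suc i" using chain_on_hop_card[OF ch] by blast
      have "\<tau> - {v} \<in> \<F>" "v \<in> \<tau>"
        using hop_nonzeroD[OF h] chain_onD[OF ch] by blast+
      then show "\<tau> \<in> \<F>" using cone[of "\<tau> - {v}"] by (simp add: insert_absorb)
    qed
    fix \<tau> assume \<tau>: "\<tau> \<in> \<F>"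
    have "hop v (bd f) \<tau> = 0"
    proof (cases "v \<in> \<tau>")
      case True
      then have "\<tau> - {v} \<in> \<F>" using cone[of "\<tau> - {v}"] \<tau> by (simp add: insert_absorb)
      then have "bd f (\<tau> - {v}) = 0" using f by (simp add: cycle_on_def)
      then show ?thesis by (simp add: hop_def)
    qed (simp add: hop_def)
    then show "f \<tau> = bd (hop v f) \<tau>" using bd_hop[of v f \<tau>] by simp
  qed
  then show ?thesis unfolding hnz_def by blast
qed

text \<open>The full simplex on the nonempty set \<open>W\<close> is acyclic, so the connecting map
  from the relative homology of \<open>Pow W\<close> modulo \<open>\<D>\<close> to the homology of
  \<open>\<D>\<close> is an isomorphism. The relative complex is carried by the complement of
  \<open>\<D>\<close>, one degree higher.\<close>

lemma hnz_complement:
  assumes vW: "v \<in> W" and sub: "\<D> \<subseteq> Pow W" and down: "\<And>\<sigma> \<tau>. \<tau> \<in> \<D> \<Longrightarrow> \<sigma> \<subseteq> \<tau> \<Longrightarrow> \<sigma> \<in> \<D>"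
  shows "hnz TYPE('a::comm_ring_1) \<D> i \<longleftrightarrow> hnz TYPE('a) (Pow W - \<D>) (Suc i)"
proof -
  let ?U = "Pow W - \<D>"
  have W0: "bd f \<tau> = 0" if "chain_on (Pow W) j f" "\<tau> \<notin> Pow W" for f :: "'b set \<Rightarrow> 'a" and j \<tau>
    by (rule bd_outside[OF that(1) _ that(2)]) auto
  have D0: "bd f \<tau> = 0" if "chain_on \<D> j f" "\<tau> \<notin> \<D>" for f :: "'b set \<Rightarrow> 'a" and j \<tau>
    by (rule bd_outside[OF that(1) _ that(2)]) (use down in blast)
  have hopW: "chain_on (Pow W) (Suc j) (hop v f)" if "chain_on (Pow W) j f" for f :: "'b set \<Rightarrow> 'a" and j
    unfolding chain_on_def
  proof (intro allI impI)
    fix \<tau> assume h: "hop v f \<tau> \<noteq> 0"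
    then have "v \<in> \<tau>" "\<tau> - {v} \<in> Pow W"
      using hop_nonzeroD[OF h] chain_onD[OF that] by auto
    then show "\<tau> \<in> Pow W \<and> card \<tau> = Suc j"
      using vW chain_on_hop_card[OF that h] by auto
  qed
  have exW: "f \<tau> = bd (hop v f) \<tau>" if "\<And>\<sigma>. bd f \<sigma> = 0" for f :: "'b set \<Rightarrow> 'a" and \<tau>
  proof -
    have "bd f = (\<lambda>\<sigma>. 0)" using that by blast
    then have "hop v (bd f) \<tau> = 0" by (simp add: hop_def)
    then show ?thesis using bd_hop[of v f \<tau>] by simp
  qed
  have restrU: "chain_on ?U j (restr ?U f)" if "chain_on (Pow W) j f" for f :: "'b set \<Rightarrow> 'a" and j
    using that by (auto simp: chain_on_def restr_def)
  have bdU: "bd (restr ?U f) \<tau> = bd f \<tau>" if "chain_on (Pow W) j f" "\<tau> \<in> ?U" for f :: "'b set \<Rightarrow> 'a" and j \<tau>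
  proof (rule bd_cong)
    fix u show "restr ?U f (insert u \<tau>) = f (insert u \<tau>)"
      using that down[of "insert u \<tau>" \<tau>] by (auto simp: restr_def chain_on_def)
  qed
  have mono: "chain_on (Pow W) j f" if "chain_on \<F> j f" "\<F> \<subseteq> Pow W" for f :: "'b set \<Rightarrow> 'a" and j \<F>
    using that by (auto simp: chain_on_def)
  show ?thesis
  proof
    assume "hnz TYPE('a) \<D> i"
    then obtain f :: "'b set \<Rightarrow> 'a" where f: "chain_on \<D> i f" "\<And>\<tau>. bd f \<tau> = 0" and nb: "\<not> boundary_on \<D> i f"
      unfolding hnz_def cycle_on_def using D0 by blast
    \<comment> \<open>A filling of \<open>f\<close> in the full simplex; its part outside
      \<open>\<D>\<close> is the corresponding relative cycle.\<close>
    define w where "w = hop v f"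
    have w: "chain_on (Pow W) (Suc i) w" unfolding w_def using f sub mono hopW by blast
    have bw: "bd w \<tau> = f \<tau>" for \<tau> using exW[OF f(2)] by (simp add: w_def)
    have "cycle_on ?U (Suc i) (restr ?U w)"
      unfolding cycle_on_def
    proof (intro conjI ballI)
      show "chain_on ?U (Suc i) (restr ?U w)" by (rule restrU[OF w])
      fix \<tau> assume "\<tau> \<in> ?U"
      then show "bd (restr ?U w) \<tau> = 0" using bdU[OF w] bw f(1) by (auto simp: chain_on_def)
    qed
    moreover have "\<not> boundary_on ?U (Suc i) (restr ?U w)"
    proof
      assume "boundary_on ?U (Suc i) (restr ?U w)"
      then obtain g where g: "chain_on ?U (Suc (Suc i)) g" "\<And>\<tau>. \<tau> \<in> ?U \<Longrightarrow> restr ?U w \<tau> = bd g \<tau>"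
        unfolding boundary_on_def by blast
      have gW: "chain_on (Pow W) (Suc (Suc i)) g" using mono[OF g(1)] by blast
      \<comment> \<open>The boundary of \<open>g\<close> removes the part of the filling outside
        \<open>\<D>\<close>, so what remains fills \<open>f\<close> inside
        \<open>\<D>\<close>.\<close>
      define e where "e \<tau> = w \<tau> - bd g \<tau>" for \<tau>
      have "chain_on \<D> (Suc i) e"
        unfolding chain_on_def
      proof (intro allI impI)
        fix \<tau> assume e: "e \<tau> \<noteq> 0"
        then have "w \<tau> \<noteq> 0 \<or> bd g \<tau> \<noteq> 0" by (auto simp: e_def)
        then have "\<tau> \<in> Pow W \<and> card \<tau> = Suc i" using w W0[OF gW, of \<tau>] chain_on_bd[OF gW, of \<tau>]
          by (auto simp: chain_on_def)
        moreover have "\<tau> \<notin> ?U" using e g(2)[of \<tau>] by (auto simp: e_def restr_def)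
        ultimately show "\<tau> \<in> \<D> \<and> card \<tau> = Suc i" by blast
      qed
      moreover have "bd e \<tau> = f \<tau>" for \<tau>
        using bd_diff[of w "bd g" \<tau>] bw by (simp add: e_def[abs_def])
      ultimately show False using nb unfolding boundary_on_def by metis
    qed
    ultimately show "hnz TYPE('a) ?U (Suc i)" unfolding hnz_def by blast
  next
    assume "hnz TYPE('a) ?U (Suc i)"
    then obtain g :: "'b set \<Rightarrow> 'a" where g: "chain_on ?U (Suc i) g" "\<And>\<tau>. \<tau> \<in> ?U \<Longrightarrow> bd g \<tau> = 0"
      and nb: "\<not> boundary_on ?U (Suc i) g"
      unfolding hnz_def cycle_on_def by blast
    have gW: "chain_on (Pow W) (Suc i) g" using mono[OF g(1)] by blast
    have ch: "chain_on \<D> i (bd g)"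
      unfolding chain_on_def
    proof (intro allI impI conjI)
      fix \<tau> assume b: "bd g \<tau> \<noteq> 0"
      then show "card \<tau> = i" using chain_on_bd[OF g(1)] by blast
      show "\<tau> \<in> \<D>" using b g(2)[of \<tau>] W0[OF gW, of \<tau>] by blast
    qed
    have "\<not> boundary_on \<D> i (bd g)"
    proof
      assume "boundary_on \<D> i (bd g)"
      then obtain e where e: "chain_on \<D> (Suc i) e" "\<And>\<tau>. \<tau> \<in> \<D> \<Longrightarrow> bd g \<tau> = bd e \<tau>"
        unfolding boundary_on_def by blast
      have eq: "bd g \<tau> = bd e \<tau>" for \<tau>
        using e(2)[of \<tau>] D0[OF e(1), of \<tau>] ch by (cases "\<tau> \<in> \<D>") (auto simp: chain_on_def)
      \<comment> \<open>\<open>g\<close> and \<open>e\<close> have the same boundary, so their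
        difference can be filled in the full simplex; outside \<open>\<D>\<close> the term
        \<open>e\<close> is invisible.\<close>
      define h where "h = hop v (\<lambda>\<tau>. g \<tau> - e \<tau>)"
      have hW: "chain_on (Pow W) (Suc (Suc i)) h" unfolding h_def
        by (intro hopW chain_on_diff gW mono[OF e(1) sub])
      have bh: "bd h \<tau> = g \<tau> - e \<tau>" for \<tau>
        unfolding h_def by (rule exW[symmetric]) (simp add: bd_diff eq)
      have "g \<tau> = bd (restr ?U h) \<tau>" if "\<tau> \<in> ?U" for \<tau>
      proof -
        have "e \<tau> = 0" using e(1) that by (auto simp: chain_on_def)
        then show ?thesis using bdU[OF hW that] bh by simp
      qed
      then show False using nb restrU[OF hW] unfolding boundary_on_def by blast
    qed
    moreover have "cycle_on \<D> i (bd g)" using ch by (simp add: cycle_on_def)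
    ultimately show "hnz TYPE('a) \<D> i" unfolding hnz_def by blast
  qed
qed

section \<open>Link and deletion: a family as a mapping cone\<close>

definition vlink :: "'v \<Rightarrow> 'v set set \<Rightarrow> 'v set set" where
  "vlink v \<F> = {\<tau>. v \<notin> \<tau> \<and> insert v \<tau> \<in> \<F>}"

definition vdel :: "'v \<Rightarrow> 'v set set \<Rightarrow> 'v set set" where
  "vdel v \<F> = {\<tau> \<in> \<F>. v \<notin> \<tau>}"

text \<open>The sum of \<open>f0\<close> and the cone over \<open>f1\<close>. With this sign the
  boundary is that of a mapping cone: \<open>f1\<close> enters the part without \<open>v\<close>
  unchanged, and its own boundary appears with a minus sign.\<close>

definition vjoin :: "'v::finite \<Rightarrow> ('v set \<Rightarrow> 'a) \<Rightarrow> ('v set \<Rightarrow> 'a) \<Rightarrow> 'v set \<Rightarrow> 'a::comm_ring_1" where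
  "vjoin v f0 f1 \<tau> = (if v \<in> \<tau> then ksgn v (\<tau> - {v}) * f1 (\<tau> - {v}) else f0 \<tau>)"

lemma bd_vjoin_out:
  fixes a b :: "'v::finite set \<Rightarrow> 'a::comm_ring_1"
  assumes "v \<notin> \<tau>" "\<And>\<sigma>. v \<in> \<sigma> \<Longrightarrow> a \<sigma> = 0"
  shows "bd (vjoin v a b) \<tau> = bd a \<tau> + b \<tau>"
proof -
  have "bd (vjoin v a b) \<tau> = (\<Sum>u\<in>- \<tau>. ksgn u \<tau> * a (insert u \<tau>) + (if u = v then b \<tau> else 0))"
    unfolding bd_def
  proof (rule sum.cong)
    fix u assume "u \<in> - \<tau>"
    then show "ksgn u \<tau> * vjoin v a b (insert u \<tau>)
        = ksgn u \<tau> * a (insert u \<tau>) + (if u = v then b \<tau> else 0)"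
      using assms by (auto simp: vjoin_def)
  qed simp
  then show ?thesis using assms(1) by (simp add: sum.distrib bd_def)
qed

lemma bd_vjoin_in:
  fixes a b :: "'v::finite set \<Rightarrow> 'a::comm_ring_1"
  assumes "v \<notin> \<tau>" "\<And>\<sigma>. v \<in> \<sigma> \<Longrightarrow> b \<sigma> = 0"
  shows "bd (vjoin v a b) (insert v \<tau>) = - (ksgn v \<tau> * bd b \<tau>)"
proof -
  have 1: "- \<tau> = insert v (- insert v \<tau>)" using assms(1) by auto
  have "bd b \<tau> = (\<Sum>u\<in>- insert v \<tau>. ksgn u \<tau> * b (insert u \<tau>))"
    unfolding bd_def by (subst 1, subst sum.insert) (auto simp: assms(2))
  moreover have "bd (vjoin v a b) (insert v \<tau>)
      = (\<Sum>u\<in>- insert v \<tau>. - (ksgn v \<tau> * (ksgn u \<tau> * b (insert u \<tau>))))"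
    unfolding bd_def
  proof (rule sum.cong)
    fix u assume "u \<in> - insert v \<tau>"
    then have u: "u \<noteq> v" "u \<notin> \<tau>" by auto
    have "insert u (insert v \<tau>) - {v} = insert u \<tau>" using u assms(1) by auto
    then have "ksgn u (insert v \<tau>) * vjoin v a b (insert u (insert v \<tau>))
        = ksgn u (insert v \<tau>) * (ksgn v (insert u \<tau>) * b (insert u \<tau>))"
      by (simp add: vjoin_def)
    also have "\<dots> = ksgn v \<tau> * (ksgn v \<tau> * ksgn u (insert v \<tau>)) * (ksgn v (insert u \<tau>) * b (insert u \<tau>))"
      by (simp add: mult.assoc)
    also have "\<dots> = - (ksgn v \<tau> * (ksgn u \<tau> * b (insert u \<tau>)))"
      by (subst ksgn_anti[OF u(1) u(2) assms(1)]) (simp add: mult.assoc)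
    finally show "ksgn u (insert v \<tau>) * vjoin v a b (insert u (insert v \<tau>))
        = - (ksgn v \<tau> * (ksgn u \<tau> * b (insert u \<tau>)))" .
  qed simp
  ultimately show ?thesis by (simp add: sum_negf sum_distrib_left)
qed

definition vout :: "'v::finite \<Rightarrow> ('v set \<Rightarrow> 'a) \<Rightarrow> 'v set \<Rightarrow> 'a::comm_ring_1" where
  "vout v f \<tau> = (if v \<in> \<tau> then 0 else f \<tau>)"

definition vin :: "'v::finite \<Rightarrow> ('v set \<Rightarrow> 'a) \<Rightarrow> 'v set \<Rightarrow> 'a::comm_ring_1" where
  "vin v f \<tau> = (if v \<in> \<tau> then 0 else ksgn v \<tau> * f (insert v \<tau>))"

lemma vjoin_vout_vin: "vjoin v (vout v f) (vin v f) = f"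
  by (rule ext) (simp add: vjoin_def vout_def vin_def insert_absorb)

lemma bd_vout_vin: "v \<notin> \<tau> \<Longrightarrow> bd f \<tau> = bd (vout v f) \<tau> + vin v f \<tau>"
  using bd_vjoin_out[of v \<tau> "vout v f" "vin v f"] by (simp add: vjoin_vout_vin) (simp add: vout_def)

lemma bd_vin:
  assumes "v \<notin> \<tau>"
  shows "bd (vin v f) \<tau> = - (ksgn v \<tau> * bd f (insert v \<tau>))"
proof -
  have "bd f (insert v \<tau>) = - (ksgn v \<tau> * bd (vin v f) \<tau>)"
    using bd_vjoin_in[where a = "vout v f" and b = "vin v f", OF assms]
    by (simp add: vjoin_vout_vin) (simp add: vin_def)
  then show ?thesis by simp
qed

lemma chain_on_vout: "chain_on \<F> i f \<Longrightarrow> chain_on (vdel v \<F>) i (vout v f)"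
  by (auto simp: chain_on_def vout_def vdel_def)

lemma vin_nonzeroD:
  assumes "chain_on \<F> i f" "vin v f \<tau> \<noteq> 0"
  shows "\<tau> \<in> vlink v \<F> \<and> Suc (card \<tau>) = i"
proof -
  have "v \<notin> \<tau>" "f (insert v \<tau>) \<noteq> 0" using assms(2) by (auto simp: vin_def split: if_splits)
  then show ?thesis using chain_onD[OF assms(1), of "insert v \<tau>"] by (simp add: vlink_def)
qed

lemma chain_on_vin: "chain_on \<F> (Suc i) f \<Longrightarrow> chain_on (vlink v \<F>) i (vin v f)"
  using vin_nonzeroD[of \<F> "Suc i" f v] by (auto simp: chain_on_def)

lemma vlinkD: "\<tau> \<in> vlink v \<F> \<Longrightarrow> v \<notin> \<tau> \<and> insert v \<tau> \<in> \<F>"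
  by (simp add: vlink_def)

lemma vdelD: "\<tau> \<in> vdel v \<F> \<Longrightarrow> v \<notin> \<tau> \<and> \<tau> \<in> \<F>"
  by (simp add: vdel_def)

text \<open>For a family closed under supersets in \<open>W\<close> the deletion is contained in the
  link, and the family is the mapping cone of the restriction from link to deletion. By
  \<open>zm\<close> this restriction is zero on homology, so the long exact sequence falls into
  short ones, and the nonvanishing degrees are those of the deletion and those of the link raised by
  one.\<close>

lemma hnz_split:
  fixes \<F> :: "'v::finite set set"
  assumes sub: "\<F> \<subseteq> Pow W" and up: "\<And>\<tau> u. \<tau> \<in> \<F> \<Longrightarrow> u \<in> W \<Longrightarrow> insert u \<tau> \<in> \<F>" and vW: "v \<in> W"
    and zm: "\<And>i (f :: 'v set \<Rightarrow> 'a). cycle_on (vlink v \<F>) i f \<Longrightarrow> boundary_on (vdel v \<F>) i f"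
  shows "hnz TYPE('a::comm_ring_1) \<F> j \<longleftrightarrow>
    hnz TYPE('a) (vdel v \<F>) j \<or> (\<exists>i. j = Suc i \<and> hnz TYPE('a) (vlink v \<F>) i)"
proof -
  let ?L = "vlink v \<F>" and ?D = "vdel v \<F>"
  have DL: "\<tau> \<in> ?L" if "\<tau> \<in> ?D" for \<tau> using that up vW by (auto simp: vlink_def vdel_def)
  have LD: "insert u \<tau> \<in> ?D" if "\<tau> \<in> ?D" "insert u \<tau> \<in> ?L" for \<tau> u
    using that up[of \<tau> u] sub by (auto simp: vlink_def vdel_def)
  have L0: "f \<sigma> = 0" if "chain_on ?L i f" "v \<in> \<sigma>" for f :: "'v set \<Rightarrow> 'a" and i \<sigma>
    using that by (auto simp: chain_on_def vlink_def)
  have D0: "f \<sigma> = 0" if "chain_on ?D i f" "v \<in> \<sigma>" for f :: "'v set \<Rightarrow> 'a" and i \<sigma>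
    using that by (auto simp: chain_on_def vdel_def)
  have cases: "\<tau> \<in> ?D \<or> (\<exists>\<sigma>. \<tau> = insert v \<sigma> \<and> v \<notin> \<sigma> \<and> \<sigma> \<in> ?L)" if "\<tau> \<in> \<F>" for \<tau>
  proof (cases "v \<in> \<tau>")
    case True
    then have "\<tau> = insert v (\<tau> - {v})" by auto
    then show ?thesis using that by (intro disjI2 exI[of _ "\<tau> - {v}"]) (simp add: vlink_def insert_absorb)
  qed (use that in \<open>simp add: vdel_def\<close>)
  have join: "chain_on \<F> (Suc i) (vjoin v f0 f1)" if "chain_on ?D (Suc i) f0" "chain_on ?L i f1"
    for f0 f1 :: "'v set \<Rightarrow> 'a" and i
    unfolding chain_on_def
  proof (intro allI impI)
    fix \<tau> assume nz: "vjoin v f0 f1 \<tau> \<noteq> 0"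
    show "\<tau> \<in> \<F> \<and> card \<tau> = Suc i"
    proof (cases "v \<in> \<tau>")
      case True
      then have "f1 (\<tau> - {v}) \<noteq> 0" using nz by (auto simp: vjoin_def)
      then have "\<tau> - {v} \<in> ?L" "card (\<tau> - {v}) = i" using chain_onD[OF that(2)] by blast+
      then show ?thesis using True card_Suc_Diff1[of \<tau> v] by (simp add: vlink_def insert_absorb)
    next
      case False
      then have "f0 \<tau> \<noteq> 0" using nz by (auto simp: vjoin_def)
      then show ?thesis using chain_onD[OF that(1)] by (auto simp: vdel_def)
    qed
  qed
  have bdD: "bd (restr ?D g) \<tau> = bd g \<tau>" if "chain_on ?L i g" "\<tau> \<in> ?D" for g :: "'v set \<Rightarrow> 'a" and i \<tau>
  proof (rule bd_cong)
    fix u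
    show "restr ?D g (insert u \<tau>) = g (insert u \<tau>)"
      using LD[OF that(2), of u] chain_onD[OF that(1), of "insert u \<tau>"] by (auto simp: restr_def)
  qed
  have chD: "chain_on ?D i (restr ?D g)" if "chain_on ?L i g" for g :: "'v set \<Rightarrow> 'a" and i
    using that by (auto simp: chain_on_def restr_def)
  show ?thesis
  proof
    assume "hnz TYPE('a) \<F> j"
    then obtain f :: "'v set \<Rightarrow> 'a" where f: "chain_on \<F> j f" "\<And>\<tau>. \<tau> \<in> \<F> \<Longrightarrow> bd f \<tau> = 0"
      and nb: "\<not> boundary_on \<F> j f"
      unfolding hnz_def cycle_on_def by blast
    define f0 where "f0 = vout v f"
    define f1 where "f1 = vin v f"
    have f0D: "chain_on ?D j f0" unfolding f0_def by (rule chain_on_vout[OF f(1)])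
    have f1L: "\<tau> \<in> ?L \<and> Suc (card \<tau>) = j" if "f1 \<tau> \<noteq> 0" for \<tau>
      using vin_nonzeroD[OF f(1)] that unfolding f1_def .
    have bf1: "bd f1 \<tau> = 0" if "\<tau> \<in> ?L" for \<tau>
      using vlinkD[OF that] f(2) by (simp add: f1_def bd_vin)
    show "hnz TYPE('a) ?D j \<or> (\<exists>i. j = Suc i \<and> hnz TYPE('a) ?L i)"
    proof (rule ccontr)
      assume neg: "\<not> ?thesis"
      have "\<exists>g1 :: 'v set \<Rightarrow> 'a. chain_on ?L j g1 \<and> (\<forall>\<tau>\<in>?L. f1 \<tau> = bd g1 \<tau>)"
      proof (cases j)
        case 0
        then have "f1 \<tau> = 0" for \<tau> using f1L by blast
        then show ?thesis by (intro exI[of _ "\<lambda>_. 0"]) (simp add: chain_on_def)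
      next
        case (Suc i)
        have "cycle_on ?L i f1" using f1L Suc bf1 by (auto simp: cycle_on_def chain_on_def)
        then have "boundary_on ?L i f1" using neg Suc unfolding hnz_def by blast
        then show ?thesis using Suc unfolding boundary_on_def by simp
      qed
      then obtain g1 :: "'v set \<Rightarrow> 'a" where g1: "chain_on ?L j g1" "\<And>\<tau>. \<tau> \<in> ?L \<Longrightarrow> f1 \<tau> = bd g1 \<tau>" by blast
      \<comment> \<open>Since \<open>f1\<close> is the boundary of \<open>g1\<close> on the link,
        adding the restriction of \<open>g1\<close> turns \<open>f0\<close> into a cycle of the
        deletion.\<close>
      define e where "e \<tau> = f0 \<tau> + restr ?D g1 \<tau>" for \<tau>
      have "cycle_on ?D j e"
        unfolding cycle_on_def
      proof (intro conjI ballI)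
        show "chain_on ?D j e" unfolding e_def[abs_def] by (intro chain_on_add f0D chD g1(1))
        fix \<tau> assume \<tau>: "\<tau> \<in> ?D"
        then have "bd f0 \<tau> + f1 \<tau> = 0"
          using bd_vout_vin[of v \<tau> f] f(2)[of \<tau>] vdelD[OF \<tau>] by (simp add: f0_def f1_def)
        then show "bd e \<tau> = 0"
          using bdD[OF g1(1) \<tau>] g1(2)[OF DL[OF \<tau>]] by (simp add: e_def[abs_def] bd_add)
      qed
      then have "boundary_on ?D j e" using neg unfolding hnz_def by blast
      then obtain g0 where g0: "chain_on ?D (Suc j) g0" "\<And>\<tau>. \<tau> \<in> ?D \<Longrightarrow> e \<tau> = bd g0 \<tau>"
        unfolding boundary_on_def by blast
      let ?g = "vjoin v g0 (\<lambda>\<tau>. - g1 \<tau>)"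
      have "f \<tau> = bd ?g \<tau>" if \<tau>: "\<tau> \<in> \<F>" for \<tau>
        using cases[OF \<tau>]
      proof (elim disjE exE conjE)
        assume D: "\<tau> \<in> ?D"
        then have v: "v \<notin> \<tau>" by (simp add: vdel_def)
        have "bd ?g \<tau> = bd g0 \<tau> - g1 \<tau>" using bd_vjoin_out[where a = g0, OF v D0[OF g0(1)]] by simp
        also have "\<dots> = f0 \<tau>" using g0(2)[OF D, symmetric] D by (simp add: e_def restr_def)
        finally show ?thesis using v by (simp add: f0_def vout_def)
      next
        fix \<sigma> assume \<sigma>: "\<tau> = insert v \<sigma>" "v \<notin> \<sigma>" "\<sigma> \<in> ?L"
        have "bd ?g \<tau> = ksgn v \<sigma> * bd g1 \<sigma>"
          using bd_vjoin_in[OF \<sigma>(2), of "\<lambda>\<tau>. - g1 \<tau>" g0] L0[OF g1(1)] \<sigma>(1) by (simp add: bd_minus)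
        also have "\<dots> = ksgn v \<sigma> * f1 \<sigma>" using g1(2)[OF \<sigma>(3)] by simp
        finally show ?thesis using \<sigma> by (simp add: f1_def vin_def)
      qed
      moreover have "chain_on \<F> (Suc j) ?g" by (intro join g0(1) chain_on_minus g1(1))
      ultimately show False using nb unfolding boundary_on_def by blast
    qed
  next
    assume "hnz TYPE('a) ?D j \<or> (\<exists>i. j = Suc i \<and> hnz TYPE('a) ?L i)"
    then show "hnz TYPE('a) \<F> j"
    proof (elim disjE exE conjE)
      assume "hnz TYPE('a) ?D j"
      then obtain f0 :: "'v set \<Rightarrow> 'a" where f0: "chain_on ?D j f0" "\<And>\<tau>. \<tau> \<in> ?D \<Longrightarrow> bd f0 \<tau> = 0"
        and nb: "\<not> boundary_on ?D j f0"
        unfolding hnz_def cycle_on_def by blast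
      let ?f = "vjoin v f0 (\<lambda>_. 0)"
      have f_eq: "?f = f0" by (rule ext) (simp add: vjoin_def D0[OF f0(1)])
      have "cycle_on \<F> j f0"
        unfolding cycle_on_def
      proof (intro conjI ballI)
        show "chain_on \<F> j f0" using f0(1) by (auto simp: chain_on_def vdel_def)
        fix \<tau> assume \<tau>: "\<tau> \<in> \<F>"
        show "bd f0 \<tau> = 0" using cases[OF \<tau>]
        proof (elim disjE exE conjE)
          fix \<sigma> assume \<sigma>: "\<tau> = insert v \<sigma>" "v \<notin> \<sigma>"
          then show ?thesis using bd_vjoin_in[OF \<sigma>(2), of "\<lambda>_. 0" f0] by (simp add: f_eq)
        qed (rule f0(2))
      qed
      moreover have "\<not> boundary_on \<F> j f0"
      proof
        assume "boundary_on \<F> j f0"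
        then obtain g where g: "chain_on \<F> (Suc j) g" "\<And>\<tau>. \<tau> \<in> \<F> \<Longrightarrow> f0 \<tau> = bd g \<tau>"
          unfolding boundary_on_def by blast
        define g0 where "g0 = vout v g"
        define g1 where "g1 = vin v g"
        have g0D: "chain_on ?D (Suc j) g0" unfolding g0_def by (rule chain_on_vout[OF g(1)])
        have g1L: "chain_on ?L j g1" unfolding g1_def by (rule chain_on_vin[OF g(1)])
        have "bd g1 \<tau> = 0" if "\<tau> \<in> ?L" for \<tau>
          using vlinkD[OF that] g(2)[of "insert v \<tau>"] D0[OF f0(1), of "insert v \<tau>"]
          by (simp add: g1_def bd_vin)
        \<comment> \<open>The part \<open>g1\<close> of the filling that involves \<open>v\<close>
          is all that prevents filling \<open>f0\<close> in the deletion. It is a cycle of the link,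
          hence bounds there and can be replaced.\<close>
        then have "boundary_on ?D j g1" using zm[of j g1] g1L by (simp add: cycle_on_def)
        then obtain g' where g': "chain_on ?D (Suc j) g'" "\<And>\<tau>. \<tau> \<in> ?D \<Longrightarrow> g1 \<tau> = bd g' \<tau>"
          unfolding boundary_on_def by blast
        have "f0 \<tau> = bd (\<lambda>\<tau>. g0 \<tau> + g' \<tau>) \<tau>" if \<tau>: "\<tau> \<in> ?D" for \<tau>
        proof -
          have v: "v \<notin> \<tau>" "\<tau> \<in> \<F>" using vdelD[OF \<tau>] by blast+
          show ?thesis using bd_vout_vin[OF v(1), of g] g(2)[OF v(2)] g'(2)[OF \<tau>]
            by (simp add: g0_def g1_def bd_add)
        qed
        then show False using nb chain_on_add[OF g0D g'(1)] unfolding boundary_on_def by blast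
      qed
      ultimately show ?thesis unfolding hnz_def by blast
    next
      fix i assume j: "j = Suc i" and "hnz TYPE('a) ?L i"
      then obtain f1 :: "'v set \<Rightarrow> 'a" where f1: "cycle_on ?L i f1" and nb: "\<not> boundary_on ?L i f1"
        unfolding hnz_def by blast
      have f1L: "chain_on ?L i f1" "\<And>\<tau>. \<tau> \<in> ?L \<Longrightarrow> bd f1 \<tau> = 0" using f1 by (auto simp: cycle_on_def)
      \<comment> \<open>A cycle of the link extends to the whole family once its image in the
        deletion is filled; the filling enters with a minus sign to cancel that image.\<close>
      obtain g' where g': "chain_on ?D (Suc i) g'" "\<And>\<tau>. \<tau> \<in> ?D \<Longrightarrow> f1 \<tau> = bd g' \<tau>"
        using zm[OF f1] unfolding boundary_on_def by blast
      let ?f = "vjoin v (\<lambda>\<tau>. - g' \<tau>) f1"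
      have "cycle_on \<F> j ?f"
        unfolding cycle_on_def j
      proof (intro conjI ballI)
        show "chain_on \<F> (Suc i) ?f" by (intro join chain_on_minus g'(1) f1L(1))
        fix \<tau> assume \<tau>: "\<tau> \<in> \<F>"
        show "bd ?f \<tau> = 0" using cases[OF \<tau>]
        proof (elim disjE exE conjE)
          assume D: "\<tau> \<in> ?D"
          then have "v \<notin> \<tau>" by (simp add: vdel_def)
          then show ?thesis using bd_vjoin_out[of v \<tau> "\<lambda>\<tau>. - g' \<tau>" f1] D0[OF g'(1)] g'(2)[OF D]
            by (simp add: bd_minus)
        next
          fix \<sigma> assume \<sigma>: "\<tau> = insert v \<sigma>" "v \<notin> \<sigma>" "\<sigma> \<in> ?L"
          then show ?thesis using bd_vjoin_in[where b = f1, OF \<sigma>(2) L0[OF f1L(1)]] f1L(2)[OF \<sigma>(3)] by simp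
        qed
      qed
      moreover have "\<not> boundary_on \<F> j ?f"
      proof
        assume "boundary_on \<F> j ?f"
        then obtain g where g: "chain_on \<F> (Suc (Suc i)) g" "\<And>\<tau>. \<tau> \<in> \<F> \<Longrightarrow> ?f \<tau> = bd g \<tau>"
          unfolding boundary_on_def j by blast
        define g1 where "g1 = vin v g"
        have g1L: "chain_on ?L (Suc i) g1" unfolding g1_def by (rule chain_on_vin[OF g(1)])
        have "f1 \<tau> = bd (\<lambda>\<tau>. - g1 \<tau>) \<tau>" if "\<tau> \<in> ?L" for \<tau>
        proof -
          have \<tau>: "v \<notin> \<tau>" "insert v \<tau> \<in> \<F>" using vlinkD[OF that] by blast+
          then have "bd g (insert v \<tau>) = ksgn v \<tau> * f1 \<tau>"
            using g(2)[OF \<tau>(2)] by (simp add: vjoin_def)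
          then show ?thesis using \<tau>(1) by (simp add: g1_def bd_minus bd_vin)
        qed
        then show False using nb chain_on_minus[OF g1L] unfolding boundary_on_def by blast
      qed
      ultimately show ?thesis unfolding hnz_def by blast
    qed
  qed
qed

text \<open>The connecting map at a vertex vanishes if some other vertex contracts it.\<close>

lemma boundary_on_contract:
  fixes f :: "'v::finite set \<Rightarrow> 'a::comm_ring_1"
  assumes f: "cycle_on \<H> i f" and sub: "\<H> \<subseteq> Pow W"
    and up: "\<And>\<tau> u. \<tau> \<in> \<G> \<Longrightarrow> u \<in> W \<Longrightarrow> insert u \<tau> \<in> \<G>"
    and z: "\<And>\<tau>. \<tau> \<in> \<G> \<Longrightarrow> z \<in> \<tau> \<and> \<tau> - {z} \<in> \<H>"
  shows "boundary_on \<G> i f"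
  unfolding boundary_on_def
proof (intro exI conjI ballI)
  have ch: "chain_on \<H> i f" using f by (simp add: cycle_on_def)
  show "chain_on \<G> (Suc i) (restr \<G> (hop z f))"
    using chain_on_hop_card[OF ch] by (auto simp: chain_on_def restr_def)
  fix \<tau> assume \<tau>: "\<tau> \<in> \<G>"
  then have "hop z (bd f) \<tau> = 0" using z[OF \<tau>] f by (simp add: hop_def cycle_on_def)
  \<comment> \<open>Cutting the cone off outside the family changes no boundary at its members,
    since adding a vertex of \<open>W\<close> to a member gives a member.\<close>
  moreover have "bd (restr \<G> (hop z f)) \<tau> = bd (hop z f) \<tau>"
  proof (rule bd_cong)
    fix u assume u: "u \<notin> \<tau>"
    show "restr \<G> (hop z f) (insert u \<tau>) = hop z f (insert u \<tau>)"
    proof (cases "hop z f (insert u \<tau>) = 0")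
      case False
      then have "insert u \<tau> - {z} \<in> \<H>" using hop_nonzeroD(2) chain_onD[OF ch] by blast
      moreover have "u \<noteq> z" using u z[OF \<tau>] by auto
      ultimately have "u \<in> W" using sub by auto
      then show ?thesis using up[OF \<tau>] by (simp add: restr_def)
    qed (simp add: restr_def)
  qed
  ultimately show "f \<tau> = bd (restr \<G> (hop z f)) \<tau>" using bd_hop[of z f \<tau>] by simp
qed

section \<open>Multigraded Tor of squarefree monomial quotients\<close>

definition nfam :: "('v set \<Rightarrow> bool) \<Rightarrow> 'v set \<Rightarrow> 'v set set" where
  "nfam P W = {\<tau>. \<tau> \<subseteq> W \<and> \<not> P (W - \<tau>)}"

text \<open>If the monotone predicate \<open>P\<close> describes the supports of the monomials in a squarefree
  monomial ideal \<open>I\<close>, this says that \<open>Tor\<^sub>j(k, S/I)\<close> is nonzero in the multidegree \<open>W\<close>.\<close>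

definition tor_nz :: "'a::comm_ring_1 itself \<Rightarrow> ('v::finite set \<Rightarrow> bool) \<Rightarrow> 'v set \<Rightarrow> nat \<Rightarrow> bool" where
  "tor_nz T P W j \<longleftrightarrow> hnz T (nfam P W) j"

lemma tor_nz_cong:
  assumes "\<And>U. U \<subseteq> W \<Longrightarrow> P U = Q U"
  shows "tor_nz T P W j = tor_nz T Q W j"
proof -
  have "nfam P W = nfam Q W" using assms by (auto simp: nfam_def)
  then show ?thesis by (simp add: tor_nz_def)
qed

lemma vlink_nfam: "v \<in> W \<Longrightarrow> vlink v (nfam P W) = nfam P (W - {v})"
  by (auto simp: vlink_def nfam_def Diff_insert2 set_diff_eq insert_commute)

text \<open>If \<open>v\<close> is not in \<open>\<tau>\<close>, it stays in the support
  \<open>W - \<tau>\<close>, which amounts to the colon ideal by \<open>v\<close>. If it is in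
  \<open>\<tau>\<close>, as in \<open>vlink_nfam\<close>, it leaves the support and the ideal itself
  is seen on fewer vertices.\<close>

lemma vdel_nfam:
  assumes "v \<in> W"
  shows "vdel v (nfam P W) = nfam (\<lambda>U. P (insert v U)) (W - {v})"
proof -
  have "insert v (W - {v} - \<tau>) = W - \<tau>" if "v \<notin> \<tau>" for \<tau> using assms that by auto
  then have "P (insert v (W - {v} - \<tau>)) = P (W - \<tau>)" if "v \<notin> \<tau>" for \<tau> using that by simp
  then show ?thesis unfolding vdel_def nfam_def by blast
qed

lemma nfam_up: 
  assumes "mono P" "\<tau> \<in> nfam P W" "u \<in> W"
  shows "insert u \<tau> \<in> nfam P W"
proof -
  have "W - insert u \<tau> \<subseteq> W - \<tau>" by auto
  then have "P (W - insert u \<tau>) \<Longrightarrow> P (W - \<tau>)" using assms(1) by (meson monoD le_boolD)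
  then show ?thesis using assms by (auto simp: nfam_def)
qed

text \<open>A vertex that no generator inside \<open>W\<close> uses is a cone point.\<close>

lemma tor_nz_isolated:
  assumes "v \<in> W" "\<And>U. U \<subseteq> W \<Longrightarrow> v \<notin> U \<Longrightarrow> P (insert v U) = P U"
  shows "\<not> tor_nz TYPE('a::comm_ring_1) P W j"
  unfolding tor_nz_def
proof (rule not_hnz_cone)
  fix \<tau> assume v: "v \<notin> \<tau>"
  then have "W - \<tau> = insert v (W - insert v \<tau>)" using assms(1) by auto
  then show "\<tau> \<in> nfam P W \<longleftrightarrow> insert v \<tau> \<in> nfam P W"
    using assms(1) assms(2)[of "W - insert v \<tau>"] by (auto simp: nfam_def)
qed

lemma mono_insert: "mono P \<Longrightarrow> mono (\<lambda>U. P (insert v U))"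
  by (rule monoI) (meson insert_mono monoD)

lemma tor_nz_vertex:
  assumes P: "mono P" and v: "v \<in> W"
    and zm: "\<And>i (f :: 'v::finite set \<Rightarrow> 'a). cycle_on (nfam P (W - {v})) i f \<Longrightarrow>
      boundary_on (nfam (\<lambda>U. P (insert v U)) (W - {v})) i f"
  shows "tor_nz TYPE('a::comm_ring_1) P W j \<longleftrightarrow>
    tor_nz TYPE('a) (\<lambda>U. P (insert v U)) (W - {v}) j \<or> (\<exists>i. j = Suc i \<and> tor_nz TYPE('a) P (W - {v}) i)"
proof -
  have "hnz TYPE('a) (nfam P W) j \<longleftrightarrow> hnz TYPE('a) (vdel v (nfam P W)) j \<or>
      (\<exists>i. j = Suc i \<and> hnz TYPE('a) (vlink v (nfam P W)) i)"
  proof (rule hnz_split[OF _ nfam_up[OF P] v])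
    show "nfam P W \<subseteq> Pow W" by (auto simp: nfam_def)
  qed (use zm in \<open>simp_all add: vlink_nfam[OF v] vdel_nfam[OF v]\<close>)
  then show ?thesis unfolding tor_nz_def vlink_nfam[OF v] vdel_nfam[OF v] .
qed

text \<open>By \<open>zm\<close> the variable \<open>z\<close> lies in the colon ideal by
  \<open>v\<close>, and multiplication by \<open>z\<close> takes nothing outside that colon ideal
  into the ideal itself. Hence every set of the deletion contains \<open>z\<close>, and removing
  \<open>z\<close> leads to the link, so coning with \<open>z\<close> kills the connecting
  map.\<close>

lemma tor_nz_split:
  assumes P: "mono P" and v: "v \<in> W" and z: "z \<in> W" "z \<noteq> v"
    and zm: "\<And>U. U \<subseteq> W - {v} \<Longrightarrow> \<not> P (insert v U) \<Longrightarrow> z \<notin> U \<and> \<not> P (insert z U)"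
  shows "tor_nz TYPE('a::comm_ring_1) P W j \<longleftrightarrow>
    tor_nz TYPE('a) (\<lambda>U. P (insert v U)) (W - {v}) j \<or> (\<exists>i. j = Suc i \<and> tor_nz TYPE('a) P (W - {v}) i)"
proof (rule tor_nz_vertex[OF P v])
  fix i and f :: "'b set \<Rightarrow> 'a" assume f: "cycle_on (nfam P (W - {v})) i f"
  let ?D = "nfam (\<lambda>U. P (insert v U)) (W - {v})"
  show "boundary_on ?D i f"
  proof (rule boundary_on_contract[OF f, where W = "W - {v}" and z = z])
    show "nfam P (W - {v}) \<subseteq> Pow (W - {v})" by (auto simp: nfam_def)
    show "\<And>\<tau> u. \<tau> \<in> ?D \<Longrightarrow> u \<in> W - {v} \<Longrightarrow> insert u \<tau> \<in> ?D" by (rule nfam_up[OF mono_insert[OF P]])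
    fix \<tau> assume \<tau>: "\<tau> \<in> ?D"
    then have *: "z \<notin> W - {v} - \<tau>" "\<not> P (insert z (W - {v} - \<tau>))"
      using zm[of "W - {v} - \<tau>"] by (auto simp: nfam_def)
    then have "z \<in> \<tau>" using z by auto
    moreover have "W - {v} - (\<tau> - {z}) = insert z (W - {v} - \<tau>)" using z by auto
    ultimately show "z \<in> \<tau> \<and> \<tau> - {z} \<in> nfam P (W - {v})"
      using * \<tau> by (auto simp: nfam_def)
  qed
qed

text \<open>One term of the long exact sequence is zero, so only the colon ideal remains.\<close>

lemma tor_nz_link_acyclic:
  assumes P: "mono P" and v: "v \<in> W" and ac: "\<And>i. \<not> tor_nz TYPE('a::comm_ring_1) P (W - {v}) i"
  shows "tor_nz TYPE('a) P W j \<longleftrightarrow> tor_nz TYPE('a) (\<lambda>U. P (insert v U)) (W - {v}) j"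
proof -
  let ?L = "nfam P (W - {v})" and ?D = "nfam (\<lambda>U. P (insert v U)) (W - {v})"
  have "tor_nz TYPE('a) P W j \<longleftrightarrow>
    tor_nz TYPE('a) (\<lambda>U. P (insert v U)) (W - {v}) j \<or> (\<exists>i. j = Suc i \<and> tor_nz TYPE('a) P (W - {v}) i)"
  proof (rule tor_nz_vertex[OF P v])
    fix i and f :: "'b set \<Rightarrow> 'a" assume "cycle_on ?L i f"
    then have "boundary_on ?L i f" using ac[of i] unfolding tor_nz_def hnz_def by blast
    then obtain g where g: "chain_on ?L (Suc i) g" "\<And>\<tau>. \<tau> \<in> ?L \<Longrightarrow> f \<tau> = bd g \<tau>"
      unfolding boundary_on_def by blast
    show "boundary_on ?D i f"
      unfolding boundary_on_def
    proof (intro exI conjI ballI)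
      show "chain_on ?D (Suc i) (restr ?D g)" using g(1) by (auto simp: chain_on_def restr_def)
      fix \<tau> assume \<tau>: "\<tau> \<in> ?D"
      have "P (W - {v} - \<tau>) \<Longrightarrow> P (insert v (W - {v} - \<tau>))"
        using monoD[OF P, of "W - {v} - \<tau>" "insert v (W - {v} - \<tau>)"] by auto
      then have "\<tau> \<in> ?L" using \<tau> by (auto simp: nfam_def)
      then have "f \<tau> = bd g \<tau>" by (rule g(2))
      also have "\<dots> = bd (restr ?D g) \<tau>"
      proof (rule bd_cong)
        fix u
        show "g (insert u \<tau>) = restr ?D g (insert u \<tau>)"
        proof (cases "g (insert u \<tau>) = 0")
          case False
          then have "insert u \<tau> \<in> ?L" using chain_onD[OF g(1)] by blast
          then have "u \<in> W - {v}" by (auto simp: nfam_def)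
          then have "insert u \<tau> \<in> ?D" by (rule nfam_up[OF mono_insert[OF P] \<tau>])
          then show ?thesis by (simp add: restr_def)
        qed (simp add: restr_def)
      qed
      finally show "f \<tau> = bd (restr ?D g) \<tau>" .
    qed
  qed
  then show ?thesis using ac by blast
qed

text \<open>The colon ideal by a variable of the ideal is the unit ideal. Its family is empty, and
  only the shifted term survives.\<close>

lemma tor_nz_variable:
  assumes P: "mono P" and v: "v \<in> W" and full: "\<And>U. U \<subseteq> W \<Longrightarrow> P (insert v U)"
  shows "tor_nz TYPE('a::comm_ring_1) P W j \<longleftrightarrow> (\<exists>i. j = Suc i \<and> tor_nz TYPE('a) P (W - {v}) i)"
proof -
  have del: "nfam (\<lambda>U. P (insert v U)) (W - {v}) = {}"
    using full[of "W - {v} - _"] by (auto simp: nfam_def)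
  have "tor_nz TYPE('a) P W j \<longleftrightarrow>
    tor_nz TYPE('a) (\<lambda>U. P (insert v U)) (W - {v}) j \<or> (\<exists>i. j = Suc i \<and> tor_nz TYPE('a) P (W - {v}) i)"
    by (rule tor_nz_vertex[OF P v])
      (use del in \<open>auto simp: boundary_on_def chain_on_def intro: exI[of _ "\<lambda>_. 0"]\<close>)
  moreover have "\<not> hnz TYPE('a) ({} :: 'b set set) j" by (rule not_hnz_zero_chain) simp
  ultimately show ?thesis unfolding tor_nz_def del by blast
qed

lemma tor_nz_nonzero_chain:
  assumes "tor_nz TYPE('a::comm_ring_1) P W j"
  obtains \<tau> where "\<tau> \<in> nfam P W" "card \<tau> = j"
  using assms not_hnz_zero_chain[of "nfam P W" j, where ?'a = 'a] unfolding tor_nz_def by blast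

lemma tor_nz_le_card: "tor_nz TYPE('a::comm_ring_1) P W j \<Longrightarrow> j \<le> card W"
  by (erule tor_nz_nonzero_chain) (auto simp: nfam_def intro: card_mono)

text \<open>In multidegree zero the quotient is the coefficient ring, unless the ideal is
  everything. This keeps \<open>tor_support\<close> nonempty even for the zero ideal.\<close>

lemma tor_nz_empty: "tor_nz TYPE('a::comm_ring_1) P {} j \<longleftrightarrow> j = 0 \<and> \<not> P {}"
proof
  assume "tor_nz TYPE('a) P {} j"
  then show "j = 0 \<and> \<not> P {}" by (rule tor_nz_nonzero_chain) (auto simp: nfam_def)
next
  assume j: "j = 0 \<and> \<not> P {}"
  let ?f = "\<lambda>\<tau> :: 'b set. if \<tau> = {} then 1 else 0 :: 'a"
  have fam: "nfam P {} = {{}}" using j by (auto simp: nfam_def)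
  have "bd ?f \<tau> = 0" for \<tau> using bd_nonzeroE[of ?f \<tau>] by (metis insert_not_empty)
  then have "cycle_on (nfam P {}) j ?f" using j fam by (simp add: cycle_on_def chain_on_def)
  moreover have "\<not> boundary_on (nfam P {}) j ?f"
  proof
    assume "boundary_on (nfam P {}) j ?f"
    then obtain g :: "'b set \<Rightarrow> 'a" where g: "chain_on {{}} (Suc j) g" "bd g {} = 1"
      unfolding boundary_on_def fam by auto
    then have "bd g {} \<noteq> 0" by simp
    then show False by (rule bd_nonzeroE) (use g(1) in \<open>auto simp: chain_on_def\<close>)
  qed
  ultimately show "tor_nz TYPE('a) P {} j" unfolding tor_nz_def hnz_def by blast
qed

section \<open>Ideals generated by variables and by products of two variables\<close>

lemma tor_nz_variables:
  assumes Q: "mono Q" and "finite A" "A \<inter> U = {}"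
  shows "tor_nz TYPE('a::comm_ring_1) (\<lambda>V. V \<inter> A \<noteq> {} \<or> Q (V - A)) (A \<union> U) j \<longleftrightarrow>
    (\<exists>i. j = i + card A \<and> tor_nz TYPE('a) Q U i)"
  using assms(2,3)
proof (induction A arbitrary: j rule: finite_induct)
  case empty
  then show ?case by simp
next
  case (insert v A)
  let ?P = "\<lambda>V. V \<inter> insert v A \<noteq> {} \<or> Q (V - insert v A)"
  have P: "mono ?P"
  proof (rule monoI)
    fix X Y :: "'b set" assume XY: "X \<subseteq> Y"
    then have "X - insert v A \<subseteq> Y - insert v A" by blast
    then have "Q (X - insert v A) \<le> Q (Y - insert v A)" using Q by (rule monoD[rotated])
    then show "?P X \<le> ?P Y" using XY by (auto simp: le_bool_def)
  qed
  have W: "insert v A \<union> U - {v} = A \<union> U" using insert by auto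
  have "tor_nz TYPE('a) ?P (insert v A \<union> U) j \<longleftrightarrow> (\<exists>i. j = Suc i \<and> tor_nz TYPE('a) ?P (A \<union> U) i)"
    using tor_nz_variable[OF P, of v "insert v A \<union> U" j] W by simp
  moreover have "tor_nz TYPE('a) ?P (A \<union> U) i = tor_nz TYPE('a) (\<lambda>V. V \<inter> A \<noteq> {} \<or> Q (V - A)) (A \<union> U) i" for i
  proof (rule tor_nz_cong)
    fix V assume "V \<subseteq> A \<union> U"
    then have "v \<notin> V" using insert by auto
    then have "V - insert v A = V - A" "V \<inter> insert v A = V \<inter> A" by auto
    then show "?P V \<longleftrightarrow> V \<inter> A \<noteq> {} \<or> Q (V - A)" by simp
  qed
  ultimately show ?case using insert by auto
qed

text \<open>Dividing by a further element \<open>v\<close> turns those of \<open>A\<close> into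
  variables, which gives degree \<open>card A\<close>. Leaving \<open>v\<close> out gives one less
  by induction, and the shift makes up for it, so both parts land in the same degree; any
  \<open>z\<close> in \<open>A\<close> kills the connecting map. The equation with
  \<open>Suc j\<close> expresses the degree \<open>card A - 1\<close> without subtraction.\<close>

lemma tor_nz_pairs:
  assumes Q: "mono Q" and "finite A" "A \<noteq> {}" "A \<inter> U = {}"
  shows "tor_nz TYPE('a::comm_ring_1) (\<lambda>V. 2 \<le> card (V \<inter> A) \<or> Q (V - A)) (A \<union> U) j \<longleftrightarrow>
    2 \<le> card A \<and> (\<exists>i. Suc j = i + card A \<and> tor_nz TYPE('a) Q U i)"
  using assms(2,3,4)
proof (induction A arbitrary: j rule: finite_ne_induct)
  case (singleton v)
  have c: "card (V \<inter> {v}) \<le> 1" for V :: "'b set" using card_mono[of "{v}" "V \<inter> {v}"] by auto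
  \<comment> \<open>One element forms no pair, so no generator involves it.\<close>
  have "\<not> tor_nz TYPE('a) (\<lambda>V. 2 \<le> card (V \<inter> {v}) \<or> Q (V - {v})) ({v} \<union> U) j"
  proof (rule tor_nz_isolated)
    fix V :: "'b set" assume "v \<notin> V"
    have "insert v V - {v} = V - {v}" by auto
    then show "(2 \<le> card (insert v V \<inter> {v}) \<or> Q (insert v V - {v})) =
        (2 \<le> card (V \<inter> {v}) \<or> Q (V - {v}))"
      using c[of V] c[of "insert v V"] by auto
  qed simp
  then show ?case by simp
next
  case (insert v A)
  let ?P = "\<lambda>V. 2 \<le> card (V \<inter> insert v A) \<or> Q (V - insert v A)"
  have P: "mono ?P"
  proof (rule monoI)
    fix X Y :: "'b set" assume XY: "X \<subseteq> Y"
    then have "X - insert v A \<subseteq> Y - insert v A" by blast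
    then have 1: "Q (X - insert v A) \<le> Q (Y - insert v A)" using Q by (rule monoD[rotated])
    have "card (X \<inter> insert v A) \<le> card (Y \<inter> insert v A)" using XY by (intro card_mono) auto
    then show "?P X \<le> ?P Y" using 1 by (auto simp: le_bool_def)
  qed
  obtain z where z: "z \<in> A" using insert by auto
  have W: "insert v A \<union> U - {v} = A \<union> U" using insert by auto
  have ins: "?P (insert v V) \<longleftrightarrow> V \<inter> A \<noteq> {} \<or> Q (V - A)" if "V \<subseteq> A \<union> U" for V
  proof -
    have vV: "v \<notin> V" using insert that by auto
    then have "insert v V - insert v A = V - A" "insert v V \<inter> insert v A = insert v (V \<inter> A)" by auto
    moreover have "card (insert v (V \<inter> A)) = Suc (card (V \<inter> A))" using vV by simp
    moreover have "1 \<le> card (V \<inter> A) \<longleftrightarrow> V \<inter> A \<noteq> {}"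
      by (simp add: Suc_le_eq card_gt_0_iff)
    ultimately show ?thesis by simp
  qed
  have out: "?P V \<longleftrightarrow> 2 \<le> card (V \<inter> A) \<or> Q (V - A)" if "V \<subseteq> A \<union> U" for V
  proof -
    have "v \<notin> V" using insert that by auto
    then have "V - insert v A = V - A" "V \<inter> insert v A = V \<inter> A" by auto
    then show ?thesis by simp
  qed
  have "tor_nz TYPE('a) ?P (insert v A \<union> U) j \<longleftrightarrow>
      tor_nz TYPE('a) (\<lambda>V. ?P (insert v V)) (A \<union> U) j \<or> (\<exists>i. j = Suc i \<and> tor_nz TYPE('a) ?P (A \<union> U) i)"
    unfolding W[symmetric]
  proof (rule tor_nz_split[OF P, where z = z])
    show "z \<in> insert v A \<union> U" "z \<noteq> v" "v \<in> insert v A \<union> U" using z insert by auto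
    fix V assume V: "V \<subseteq> insert v A \<union> U - {v}" and n: "\<not> ?P (insert v V)"
    then have VA: "V \<inter> A = {}" "\<not> Q (V - A)" using ins W by auto
    have "insert z V \<inter> A = {z}" "insert z V - A = V - A" using VA z by auto
    moreover have "insert z V \<subseteq> A \<union> U" using V z W by auto
    ultimately have "\<not> ?P (insert z V)" using out[of "insert z V"] VA by simp
    then show "z \<notin> V \<and> \<not> ?P (insert z V)" using VA z by auto
  qed
  also have "tor_nz TYPE('a) (\<lambda>V. ?P (insert v V)) (A \<union> U) j \<longleftrightarrow> (\<exists>i. j = i + card A \<and> tor_nz TYPE('a) Q U i)"
  proof -
    have "tor_nz TYPE('a) (\<lambda>V. ?P (insert v V)) (A \<union> U) j =
        tor_nz TYPE('a) (\<lambda>V. V \<inter> A \<noteq> {} \<or> Q (V - A)) (A \<union> U) j"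
      by (rule tor_nz_cong) (rule ins)
    then show ?thesis using tor_nz_variables[OF Q, of A U j] insert by blast
  qed
  also have "(\<exists>i. j = Suc i \<and> tor_nz TYPE('a) ?P (A \<union> U) i) \<longleftrightarrow>
      (\<exists>i. j = Suc i \<and> 2 \<le> card A \<and> (\<exists>k. Suc i = k + card A \<and> tor_nz TYPE('a) Q U k))"
  proof -
    have "tor_nz TYPE('a) ?P (A \<union> U) i =
        tor_nz TYPE('a) (\<lambda>V. 2 \<le> card (V \<inter> A) \<or> Q (V - A)) (A \<union> U) i" for i
      by (rule tor_nz_cong) (rule out)
    then show ?thesis using insert by auto
  qed
  finally have "tor_nz TYPE('a) ?P (insert v A \<union> U) j \<longleftrightarrow> (\<exists>i. j = i + card A \<and> tor_nz TYPE('a) Q U i)"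
    by auto
  moreover have "card A \<ge> 1" using insert by (simp add: Suc_leI card_gt_0_iff)
  ultimately show ?case using insert by auto
qed

section \<open>A vertex whose neighbours are leaves and one further vertex\<close>

definition has_3path :: "'v graph \<Rightarrow> 'v set \<Rightarrow> bool" where
  "has_3path G U \<longleftrightarrow> (\<exists>x y z. is_3path G x y z \<and> {x, y, z} \<subseteq> U)"

lemma mono_has_3path: "mono (has_3path G)"
  by (rule monoI) (auto simp: has_3path_def le_bool_def)

lemma has_3path_delete_verts:
  assumes "verts G = UNIV"
  shows "has_3path (delete_verts G X) U \<longleftrightarrow> has_3path G (U - X)"
  using assms by (auto simp: has_3path_def is_3path_def delete_verts_def induced_def)

lemma not_has_3path_empty [simp]: "\<not> has_3path G {}"
  by (auto simp: has_3path_def)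

definition tor_support :: "'a::comm_ring_1 itself \<Rightarrow> 'v::finite graph \<Rightarrow> nat set" where
  "tor_support T G = {j. \<exists>W. tor_nz T (has_3path G) W j}"

lemma tor_support_bounded: "j \<in> tor_support TYPE('a::comm_ring_1) (G :: 'v::finite graph) \<Longrightarrow> j \<le> card (UNIV :: 'v set)"
  unfolding tor_support_def by (auto dest!: tor_nz_le_card intro: order_trans[OF _ card_mono])

lemma finite_tor_support: "finite (tor_support TYPE('a::comm_ring_1) (G :: 'v::finite graph))"
  using tor_support_bounded finite_nat_set_iff_bounded_le by blast

lemma zero_in_tor_support: "0 \<in> tor_support TYPE('a::comm_ring_1) G"
  using tor_nz_empty[of "has_3path G" 0] by (auto simp: tor_support_def)

text \<open>Deleted vertices remain variables of the ring, but no generator uses them, so a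
  multidegree that contains one contributes nothing.\<close>

lemma tor_support_delete_verts:
  assumes "verts (G :: 'v::finite graph) = UNIV"
  shows "j \<in> tor_support TYPE('a::comm_ring_1) (delete_verts G X) \<longleftrightarrow>
    (\<exists>W. W \<inter> X = {} \<and> tor_nz TYPE('a) (has_3path G) W j)"
proof -
  have "tor_nz TYPE('a) (has_3path (delete_verts G X)) W j \<longleftrightarrow> W \<inter> X = {} \<and> tor_nz TYPE('a) (has_3path G) W j" for W
  proof (cases "W \<inter> X = {}")
    case True
    have "tor_nz TYPE('a) (has_3path (delete_verts G X)) W j = tor_nz TYPE('a) (has_3path G) W j"
    proof (rule tor_nz_cong)
      fix U assume "U \<subseteq> W"
      then have "U - X = U" using True by auto
      then show "has_3path (delete_verts G X) U = has_3path G U"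
        by (simp add: has_3path_delete_verts[OF assms])
    qed
    then show ?thesis using True by simp
  next
    case False
    then obtain v where v: "v \<in> W" "v \<in> X" by blast
    have "\<not> tor_nz TYPE('a) (has_3path (delete_verts G X)) W j"
      by (rule tor_nz_isolated[OF v(1)]) (use v in \<open>simp add: has_3path_delete_verts[OF assms]\<close>)
    then show ?thesis using False by simp
  qed
  then show ?thesis by (simp add: tor_support_def)
qed

text \<open>By \<open>verts G = UNIV\<close> the vertices are exactly the variables of the ring. The
  set \<open>Z\<close> stands for the leaves at \<open>y0\<close>, s + 1 in number.\<close>

locale leaf_star =
  fixes G :: "'v::finite graph" and Z :: "'v set" and x0 y0 :: 'v
  assumes simple: "simple_graph G" and verts: "verts G = UNIV"
    and nbrs_Z: "\<And>w. w \<in> Z \<Longrightarrow> nbrs G w = {y0}"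
    and nbrs_y0: "nbrs G y0 = Z \<union> {x0}"
    and x0_notin: "x0 \<notin> Z" and Z_nonempty: "Z \<noteq> {}"
begin

text \<open>Together with the leaves these become variables after division by \<open>x0\<close> and
  \<open>y0\<close>. As \<open>y0\<close> is left out, their number is |N(x0)| - 1.\<close>

definition B where "B = nbrs G x0 - {y0}"

lemma edge_nbrs: "{x, y} \<in> edges G \<longleftrightarrow> y \<in> nbrs G x"
  by (simp add: nbrs_def)

lemma nbrs_sym: "y \<in> nbrs G x \<longleftrightarrow> x \<in> nbrs G y"
  by (simp add: nbrs_def insert_commute)

lemma nbrs_irrefl: "x \<notin> nbrs G x"
  using simple by (auto simp: nbrs_def simple_graph_def)

lemma x0_y0: "x0 \<noteq> y0" "y0 \<notin> Z" "y0 \<in> nbrs G x0"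
  using nbrs_irrefl nbrs_y0 nbrs_sym[of y0 x0] by blast+

lemma B_Z: "B \<inter> Z = {}" "x0 \<notin> B" "y0 \<notin> B"
  using nbrs_Z nbrs_sym nbrs_irrefl x0_y0 by (auto simp: B_def)

lemma card_B: "card (nbrs G x0) = Suc (card B)"
  unfolding B_def by (rule card_Suc_Diff1[symmetric]) (use x0_y0 in auto)

lemma has_3path_iff: "has_3path G U \<longleftrightarrow>
    (\<exists>y\<in>U. \<exists>x\<in>U \<inter> nbrs G y. \<exists>z\<in>U \<inter> nbrs G y. x \<noteq> z)"
proof
  assume "has_3path G U"
  then obtain x y z where "distinct [x, y, z]" "{x, y} \<in> edges G" "{y, z} \<in> edges G" "{x, y, z} \<subseteq> U"
    unfolding has_3path_def is_3path_def by blast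
  then have "y \<in> U" "x \<in> U \<inter> nbrs G y" "z \<in> U \<inter> nbrs G y" "x \<noteq> z"
    using nbrs_sym[of x y] by (auto simp: edge_nbrs)
  then show "\<exists>y\<in>U. \<exists>x\<in>U \<inter> nbrs G y. \<exists>z\<in>U \<inter> nbrs G y. x \<noteq> z" by blast
next
  assume "\<exists>y\<in>U. \<exists>x\<in>U \<inter> nbrs G y. \<exists>z\<in>U \<inter> nbrs G y. x \<noteq> z"
  then obtain x y z where *: "y \<in> U" "x \<in> U" "x \<in> nbrs G y" "z \<in> U" "z \<in> nbrs G y" "x \<noteq> z" by blast
  then have "is_3path G x y z"
    using nbrs_sym nbrs_irrefl unfolding is_3path_def edge_nbrs by auto
  then show "has_3path G U" using * unfolding has_3path_def by blast
qed

lemma has_3pathI: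
  assumes "y \<in> U" "x \<in> U" "x \<in> nbrs G y" "z \<in> U" "z \<in> nbrs G y" "x \<noteq> z"
  shows "has_3path G U"
  unfolding has_3path_iff using assms by blast

text \<open>Every 3-path through a leaf at \<open>y0\<close> passes through
  \<open>y0\<close>.\<close>

lemma has_3path_insert_leaf:
  assumes "w \<in> Z" "y0 \<notin> U"
  shows "has_3path G (insert w U) \<longleftrightarrow> has_3path G U"
proof -
  have 1: "w \<notin> nbrs G y" if "y \<in> insert w U" for y
    using nbrs_Z[OF assms(1)] nbrs_sym[of w y] that assms x0_y0 by auto
  have 2: "nbrs G w \<inter> insert w U = {}" using nbrs_Z[OF assms(1)] assms x0_y0 by auto
  show ?thesis unfolding has_3path_iff using 1 2 by auto
qed

text \<open>With \<open>x0\<close> absent, a 3-path through \<open>y0\<close> has \<open>y0\<close>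
  in the middle, because a leaf has no second neighbour; its ends are then two leaves. A 3-path
  without \<open>y0\<close> meets no leaf.\<close>

lemma has_3path_insert_y0:
  assumes "x0 \<notin> U" "y0 \<notin> U"
  shows "has_3path G (insert y0 U) \<longleftrightarrow> 2 \<le> card (U \<inter> Z) \<or> has_3path G (U - Z)"
proof
  assume "has_3path G (insert y0 U)"
  then obtain x y z where *: "y \<in> insert y0 U" "x \<in> insert y0 U" "x \<in> nbrs G y"
    "z \<in> insert y0 U" "z \<in> nbrs G y" "x \<noteq> z" unfolding has_3path_iff by blast
  show "2 \<le> card (U \<inter> Z) \<or> has_3path G (U - Z)"
  proof (cases "y = y0")
    case True
    then have "{x, z} \<subseteq> U \<inter> Z" using * nbrs_y0 nbrs_irrefl assms by auto
    then have "card {x, z} \<le> card (U \<inter> Z)" by (intro card_mono) auto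
    then show ?thesis using * by simp
  next
    case False
    have yZ: "y \<notin> Z" using * nbrs_Z[of y] by auto
    have nb: "v \<noteq> y0 \<and> v \<notin> Z" if "v \<in> nbrs G y" for v
      using that nbrs_sym[of v y] nbrs_Z[of v] nbrs_y0 yZ False assms * by auto
    have "x \<in> U - Z" "z \<in> U - Z" "y \<in> U - Z" using * nb yZ False by auto
    then show ?thesis using * unfolding has_3path_iff by blast
  qed
next
  assume "2 \<le> card (U \<inter> Z) \<or> has_3path G (U - Z)"
  then show "has_3path G (insert y0 U)"
  proof
    assume "2 \<le> card (U \<inter> Z)"
    then obtain x z where "x \<in> U \<inter> Z" "z \<in> U \<inter> Z" "x \<noteq> z"
      by (metis card_2_iff' card_le_Suc0_iff_eq finite not_less_eq_eq numeral_2_eq_2)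
    then show ?thesis using nbrs_y0 by (intro has_3pathI[of y0 _ x z]) auto
  next
    assume "has_3path G (U - Z)"
    then show ?thesis unfolding has_3path_iff by blast
  qed
qed

text \<open>A leaf \<open>w\<close> gives the 3-path \<open>x0\<close>, \<open>y0\<close>,
  \<open>w\<close>, and an element \<open>b\<close> of \<open>B\<close> gives \<open>y0\<close>,
  \<open>x0\<close>, \<open>b\<close>. Once these vertices are excluded, \<open>x0\<close> and
  \<open>y0\<close> have no neighbours but each other and lie on no 3-path.\<close>

lemma has_3path_insert_x0_y0:
  assumes "x0 \<notin> U" "y0 \<notin> U"
  shows "has_3path G (insert y0 (insert x0 U)) \<longleftrightarrow> U \<inter> (Z \<union> B) \<noteq> {} \<or> has_3path G (U - (Z \<union> B))"
proof
  assume "has_3path G (insert y0 (insert x0 U))"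
  then obtain x y z where *: "y \<in> insert y0 (insert x0 U)" "x \<in> insert y0 (insert x0 U)" "x \<in> nbrs G y"
    "z \<in> insert y0 (insert x0 U)" "z \<in> nbrs G y" "x \<noteq> z" unfolding has_3path_iff by blast
  show "U \<inter> (Z \<union> B) \<noteq> {} \<or> has_3path G (U - (Z \<union> B))"
  proof (cases "U \<inter> (Z \<union> B) = {}")
    case True
    have "y \<noteq> y0"
    proof
      assume "y = y0"
      then have "x \<in> Z \<or> z \<in> Z" using * nbrs_y0 by auto
      then show False using True * x0_y0 x0_notin by auto
    qed
    moreover have "y \<noteq> x0"
    proof
      assume "y = x0"
      then have "x \<in> B \<or> z \<in> B" using * by (auto simp: B_def)
      then show False using True * B_Z by auto
    qed
    ultimately have y: "y \<in> U" using * by auto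
    then have "y \<notin> Z" "y \<notin> B" using True by auto
    then have "v \<noteq> y0 \<and> v \<noteq> x0" if "v \<in> nbrs G y" for v
      using that nbrs_sym[of v y] nbrs_y0 \<open>y \<noteq> x0\<close> \<open>y \<noteq> y0\<close> by (auto simp: B_def)
    then have "x \<in> U" "z \<in> U" using * by auto
    moreover have "U - (Z \<union> B) = U" using True by auto
    ultimately show ?thesis using y * unfolding has_3path_iff by auto
  qed simp
next
  assume "U \<inter> (Z \<union> B) \<noteq> {} \<or> has_3path G (U - (Z \<union> B))"
  then show "has_3path G (insert y0 (insert x0 U))"
  proof
    assume "U \<inter> (Z \<union> B) \<noteq> {}"
    then consider w where "w \<in> U" "w \<in> Z" | w where "w \<in> U" "w \<in> B" by blast
    then show ?thesis
    proof cases
      case 1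
      then show ?thesis using nbrs_y0 x0_notin by (intro has_3pathI[of y0 _ x0 w]) auto
    next
      case 2
      then show ?thesis using x0_y0 by (intro has_3pathI[of x0 _ y0 w]) (auto simp: B_def)
    qed
  next
    assume "has_3path G (U - (Z \<union> B))"
    then show ?thesis unfolding has_3path_iff by blast
  qed
qed

context
  fixes W assumes W: "y0 \<in> W" "W \<inter> Z \<noteq> {}"
begin

text \<open>Without \<open>y0\<close> the leaf in \<open>W\<close> is isolated, so the restricted
  part is acyclic.\<close>

lemma tor_nz_remove_y0:
  "tor_nz TYPE('a::comm_ring_1) (has_3path G) W j \<longleftrightarrow>
    tor_nz TYPE('a) (\<lambda>U. has_3path G (insert y0 U)) (W - {y0}) j"
proof (rule tor_nz_link_acyclic[OF mono_has_3path W(1)])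
  obtain w where w: "w \<in> W" "w \<in> Z" using W by blast
  show "\<not> tor_nz TYPE('a) (has_3path G) (W - {y0}) i" for i
    by (rule tor_nz_isolated[of w]) (use w x0_y0 in \<open>auto intro!: has_3path_insert_leaf\<close>)
qed

lemma tor_nz_pair_part:
  "tor_nz TYPE('a::comm_ring_1) (\<lambda>U. has_3path G (insert y0 U)) (W - {y0, x0}) j \<longleftrightarrow>
    2 \<le> card (W \<inter> Z) \<and>
    (\<exists>i. Suc j = i + card (W \<inter> Z) \<and> tor_nz TYPE('a) (has_3path G) (W - ({y0, x0} \<union> Z)) i)"
proof -
  let ?A = "W \<inter> Z" and ?U = "W - ({y0, x0} \<union> Z)"
  have eq: "W - {y0, x0} = ?A \<union> ?U" using x0_y0 x0_notin by auto
  have "tor_nz TYPE('a) (\<lambda>U. has_3path G (insert y0 U)) (?A \<union> ?U) j \<longleftrightarrow>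
    tor_nz TYPE('a) (\<lambda>V. 2 \<le> card (V \<inter> ?A) \<or> has_3path G (V - ?A)) (?A \<union> ?U) j"
  proof (rule tor_nz_cong)
    fix V assume V: "V \<subseteq> ?A \<union> ?U"
    then have "V \<inter> ?A = V \<inter> Z" "V - ?A = V - Z" by auto
    then show "has_3path G (insert y0 V) \<longleftrightarrow> 2 \<le> card (V \<inter> ?A) \<or> has_3path G (V - ?A)"
      using has_3path_insert_y0[of V] V x0_y0 x0_notin by auto
  qed
  also have "\<dots> \<longleftrightarrow> 2 \<le> card ?A \<and> (\<exists>i. Suc j = i + card ?A \<and> tor_nz TYPE('a) (has_3path G) ?U i)"
    using W by (intro tor_nz_pairs[OF mono_has_3path]) auto
  finally show ?thesis unfolding eq .
qed

lemma tor_nz_x0_notin: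
  assumes "x0 \<notin> W"
  shows "tor_nz TYPE('a::comm_ring_1) (has_3path G) W j \<longleftrightarrow> 2 \<le> card (W \<inter> Z) \<and>
    (\<exists>i. Suc j = i + card (W \<inter> Z) \<and> tor_nz TYPE('a) (has_3path G) (W - ({y0, x0} \<union> Z)) i)"
proof -
  have "W - {y0} = W - {y0, x0}" using assms by auto
  then show ?thesis unfolding tor_nz_remove_y0 by (simp only: tor_nz_pair_part)
qed

text \<open>The long exact sequence at \<open>x0\<close> for the colon ideal by \<open>y0\<close>.
  Dividing by \<open>x0\<close> makes variables of the leaves and of \<open>B\<close>. The part
  without \<open>x0\<close> has the products of two leaves instead, whose degree n - 1 the shift
  turns into n. A leaf kills the connecting map: it is a variable on one side, and alone it forms no
  pair on the other.\<close>

lemma tor_nz_x0_in: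
  assumes "x0 \<in> W"
  shows "tor_nz TYPE('a::comm_ring_1) (has_3path G) W j \<longleftrightarrow>
    (\<exists>i. j = i + card (W \<inter> (Z \<union> B)) \<and> tor_nz TYPE('a) (has_3path G) (W - ({y0, x0} \<union> Z \<union> B)) i) \<or>
    2 \<le> card (W \<inter> Z) \<and>
    (\<exists>i. j = i + card (W \<inter> Z) \<and> tor_nz TYPE('a) (has_3path G) (W - ({y0, x0} \<union> Z)) i)"
proof -
  let ?A = "W \<inter> (Z \<union> B)" and ?R = "W - ({y0, x0} \<union> Z \<union> B)" and ?W = "W - {y0, x0}"
  let ?P = "\<lambda>U. has_3path G (insert y0 U)"
  note P = mono_insert[where v = y0, OF mono_has_3path]
  have eq: "?W = ?A \<union> ?R" using x0_y0 x0_notin B_Z by auto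
  have diff: "W - {y0} - {x0} = ?W" by auto
  obtain w where w: "w \<in> W" "w \<in> Z" using W by blast
  have "tor_nz TYPE('a) ?P (W - {y0}) j \<longleftrightarrow>
    tor_nz TYPE('a) (\<lambda>U. ?P (insert x0 U)) ?W j \<or> (\<exists>i. j = Suc i \<and> tor_nz TYPE('a) ?P ?W i)"
    unfolding diff[symmetric]
  proof (rule tor_nz_split[OF P, where z = w])
    show "x0 \<in> W - {y0}" "w \<in> W - {y0}" "w \<noteq> x0" using assms w x0_y0 x0_notin by auto
    fix U assume "U \<subseteq> W - {y0} - {x0}" and n: "\<not> ?P (insert x0 U)"
    then have U: "x0 \<notin> U" "y0 \<notin> U" by auto
    then have UZ: "U \<inter> (Z \<union> B) = {}" "\<not> has_3path G U"
      using n has_3path_insert_x0_y0[OF U] by (auto simp: Diff_triv)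
    have "insert w U \<inter> Z = {w}" "insert w U - Z = U" using UZ w by auto
    moreover have "x0 \<notin> insert w U" "y0 \<notin> insert w U" using U w x0_notin x0_y0 by auto
    ultimately have "\<not> ?P (insert w U)"
      using UZ(2) has_3path_insert_y0[of "insert w U"] by simp
    then show "w \<notin> U \<and> \<not> ?P (insert w U)" using UZ w by auto
  qed
  also have "tor_nz TYPE('a) (\<lambda>U. ?P (insert x0 U)) ?W j \<longleftrightarrow>
      tor_nz TYPE('a) (\<lambda>V. V \<inter> ?A \<noteq> {} \<or> has_3path G (V - ?A)) (?A \<union> ?R) j"
    unfolding eq
  proof (rule tor_nz_cong)
    fix V assume V: "V \<subseteq> ?A \<union> ?R"
    then have "V \<inter> ?A = V \<inter> (Z \<union> B)" "V - ?A = V - (Z \<union> B)" by auto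
    then show "?P (insert x0 V) \<longleftrightarrow> V \<inter> ?A \<noteq> {} \<or> has_3path G (V - ?A)"
      using has_3path_insert_x0_y0[of V] V x0_y0 x0_notin B_Z by auto
  qed
  also have "\<dots> \<longleftrightarrow> (\<exists>i. j = i + card ?A \<and> tor_nz TYPE('a) (has_3path G) ?R i)"
    by (rule tor_nz_variables[OF mono_has_3path]) auto
  also have "(\<exists>i. j = Suc i \<and> tor_nz TYPE('a) ?P ?W i) \<longleftrightarrow> 2 \<le> card (W \<inter> Z) \<and>
      (\<exists>i. j = i + card (W \<inter> Z) \<and> tor_nz TYPE('a) (has_3path G) (W - ({y0, x0} \<union> Z)) i)"
    unfolding tor_nz_pair_part by (cases j) auto
  finally show ?thesis unfolding tor_nz_remove_y0 .
qed

end

section \<open>The largest homological degree\<close>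

abbreviation max_tor :: "'a::comm_ring_1 itself \<Rightarrow> 'v set \<Rightarrow> nat" where
  "max_tor T X \<equiv> Max (tor_support T (delete_verts G X))"

lemma max_tor_attained:
  obtains W where "W \<inter> X = {}" "tor_nz TYPE('a::comm_ring_1) (has_3path G) W (max_tor TYPE('a) X)"
proof -
  have "max_tor TYPE('a) X \<in> tor_support TYPE('a) (delete_verts G X)"
    using zero_in_tor_support by (intro Max_in finite_tor_support) blast
  then show ?thesis using that tor_support_delete_verts[OF verts] by blast
qed

lemma max_tor_ge:
  assumes "tor_nz TYPE('a::comm_ring_1) (has_3path G) W j" "W \<inter> X = {}"
  shows "j \<le> max_tor TYPE('a) X"
  using assms tor_support_delete_verts[OF verts] by (intro Max_ge finite_tor_support) blast

lemma closed_nbrs_y0: "closed_nbrs G {y0} = {y0, x0} \<union> Z"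
  using nbrs_y0 by (auto simp: closed_nbrs_def)

lemma closed_nbrs_y0_x0: "closed_nbrs G {y0, x0} = {y0, x0} \<union> Z \<union> B"
  using nbrs_y0 by (auto simp: closed_nbrs_def B_def)

text \<open>The case distinction on \<open>W\<close> bounds every degree. Conversely the bounds are
  attained by adding \<open>y0\<close>, \<open>x0\<close>, all of \<open>Z\<close>, and for the last
  term all of \<open>B\<close>, to an optimal multidegree of the smaller graph. This works because
  the parts of the long exact sequences combine by disjunction, without cancellation.\<close>

theorem Max_tor_support:
  fixes s :: nat and q1 q2 q3 :: nat
  assumes s: "card Z = Suc s"
    and q1: "q1 = max_tor TYPE('a::comm_ring_1) Z"
    and q2: "q2 = max_tor TYPE('a) (closed_nbrs G {y0})"
    and q3: "q3 = max_tor TYPE('a) (closed_nbrs G {y0, x0})"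
  shows "Max (tor_support TYPE('a) G) =
    (if s > 0 then Max {q1, q2 + s + 1, q3 + card (nbrs G x0) + s}
     else Max {q1, q3 + card (nbrs G x0)})" (is "_ = ?M")
proof (rule Max_eqI[OF finite_tor_support])
  note q2' = q2[unfolded closed_nbrs_y0] and q3' = q3[unfolded closed_nbrs_y0_x0]
  have M1: "q1 \<le> ?M" and M2: "s > 0 \<Longrightarrow> q2 + s + 1 \<le> ?M" and M3: "q3 + card (nbrs G x0) + s \<le> ?M"
    by auto
  fix j assume "j \<in> tor_support TYPE('a) G"
  then obtain W where W: "tor_nz TYPE('a) (has_3path G) W j" unfolding tor_support_def by blast
  show "j \<le> ?M"
  proof (cases "W \<inter> Z = {}")
    case True
    have "j \<le> q1" unfolding q1 by (rule max_tor_ge[OF W True])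
    then show ?thesis using M1 by (rule order_trans)
  next
    case False
    then obtain w where w: "w \<in> W" "w \<in> Z" by blast
    have y0: "y0 \<in> W"
    proof (rule ccontr)
      assume "y0 \<notin> W"
      then have "\<not> tor_nz TYPE('a) (has_3path G) W j"
        by (intro tor_nz_isolated[OF w(1)] has_3path_insert_leaf[OF w(2)]) auto
      then show False using W by contradiction
    qed
    have cA: "card (W \<inter> Z) \<le> Suc s" using card_mono[of Z "W \<inter> Z"] s by auto
    have "card (W \<inter> (Z \<union> B)) \<le> card (Z \<union> B)" by (intro card_mono) auto
    also have "\<dots> \<le> Suc s + card B" using card_Un_le[of Z B] s by simp
    finally have cB: "card (W \<inter> (Z \<union> B)) \<le> card (nbrs G x0) + s" using card_B by simp
    have le2: "i \<le> q2" if "tor_nz TYPE('a) (has_3path G) (W - ({y0, x0} \<union> Z)) i" for i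
      unfolding q2' by (rule max_tor_ge[OF that]) auto
    have le3: "i \<le> q3" if "tor_nz TYPE('a) (has_3path G) (W - ({y0, x0} \<union> Z \<union> B)) i" for i
      unfolding q3' by (rule max_tor_ge[OF that]) auto
    show ?thesis
    proof (cases "x0 \<in> W")
      case True
      show ?thesis using W[unfolded tor_nz_x0_in[OF y0 False True]]
      proof (elim disjE exE conjE)
        fix i assume "j = i + card (W \<inter> (Z \<union> B))"
          "tor_nz TYPE('a) (has_3path G) (W - ({y0, x0} \<union> Z \<union> B)) i"
        then have "j \<le> q3 + card (nbrs G x0) + s" using cB le3[of i] by simp
        then show ?thesis using M3 by linarith
      next
        fix i assume "2 \<le> card (W \<inter> Z)" "j = i + card (W \<inter> Z)"
          "tor_nz TYPE('a) (has_3path G) (W - ({y0, x0} \<union> Z)) i"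
        \<comment> \<open>Two leaves in \<open>W\<close> require that there are at least two at all;
          hence the middle term occurs only for s > 0.\<close>
        then have "s > 0" "j \<le> q2 + s + 1" using cA le2[of i] by simp_all
        then show ?thesis using M2 by linarith
      qed
    next
      case x0: False
      obtain i where "2 \<le> card (W \<inter> Z)" "Suc j = i + card (W \<inter> Z)"
        "tor_nz TYPE('a) (has_3path G) (W - ({y0, x0} \<union> Z)) i"
        using W[unfolded tor_nz_x0_notin[OF y0 False x0]] by blast
      \<comment> \<open>Without \<open>x0\<close> the degree is in fact at most
        \<open>q2 + s\<close>, one less than the bound.\<close>
      then have "s > 0" "j \<le> q2 + s + 1" using cA le2[of i] by simp_all
      then show ?thesis using M2 by linarith
    qed
  qed
next
  note q2' = q2[unfolded closed_nbrs_y0] and q3' = q3[unfolded closed_nbrs_y0_x0]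
  have mem: "j \<in> tor_support TYPE('a) G" if "tor_nz TYPE('a) (has_3path G) W j" for W j
    using that unfolding tor_support_def by blast
  have 1: "q1 \<in> tor_support TYPE('a) G"
  proof -
    obtain U where "U \<inter> Z = {}" "tor_nz TYPE('a) (has_3path G) U q1"
      unfolding q1 by (rule max_tor_attained)
    then show ?thesis by (intro mem)
  qed
  have 2: "q2 + s + 1 \<in> tor_support TYPE('a) G" if "s > 0"
  proof -
    obtain U where U: "U \<inter> ({y0, x0} \<union> Z) = {}" "tor_nz TYPE('a) (has_3path G) U q2"
      unfolding q2' by (rule max_tor_attained)
    \<comment> \<open>All leaves are taken, and \<open>x0\<close> as well, since it raises the
      degree by one.\<close>
    let ?W = "U \<union> ({y0, x0} \<union> Z)"
    have eq: "?W \<inter> Z = Z" "?W - ({y0, x0} \<union> Z) = U" using U(1) by auto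
    have W: "y0 \<in> ?W" "x0 \<in> ?W" "?W \<inter> Z \<noteq> {}" using Z_nonempty by auto
    have "tor_nz TYPE('a) (has_3path G) ?W (q2 + s + 1)"
      unfolding tor_nz_x0_in[OF W(1,3,2)] eq
      by (intro disjI2 conjI exI[of _ q2]) (use U(2) s that in auto)
    then show ?thesis by (rule mem)
  qed
  have 3: "q3 + card (nbrs G x0) + s \<in> tor_support TYPE('a) G"
  proof -
    obtain U where U: "U \<inter> ({y0, x0} \<union> Z \<union> B) = {}" "tor_nz TYPE('a) (has_3path G) U q3"
      unfolding q3' by (rule max_tor_attained)
    let ?W = "U \<union> ({y0, x0} \<union> Z \<union> B)"
    have eq: "?W \<inter> (Z \<union> B) = Z \<union> B" "?W - ({y0, x0} \<union> Z \<union> B) = U" using U(1) by auto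
    have W: "y0 \<in> ?W" "x0 \<in> ?W" "?W \<inter> Z \<noteq> {}" using Z_nonempty by auto
    have "card (Z \<union> B) = Suc s + card B" using card_Un_disjoint[of Z B] B_Z s by auto
    then have "tor_nz TYPE('a) (has_3path G) ?W (q3 + card (nbrs G x0) + s)"
      unfolding tor_nz_x0_in[OF W(1,3,2)] eq
      by (intro disjI1 exI[of _ q3]) (use U(2) card_B in auto)
    then show ?thesis by (rule mem)
  qed
  show "?M \<in> tor_support TYPE('a) G"
  proof (cases "s > 0")
    case True
    have "Max {q1, q2 + s + 1, q3 + card (nbrs G x0) + s} \<in> {q1, q2 + s + 1, q3 + card (nbrs G x0) + s}"
      by (rule Max_in) simp_all
    moreover have "{q1, q2 + s + 1, q3 + card (nbrs G x0) + s} \<subseteq> tor_support TYPE('a) G"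
      by (intro insert_subsetI empty_subsetI 1 2[OF True] 3)
    ultimately show ?thesis unfolding if_P[OF True] by (rule subsetD[rotated])
  next
    case False
    then have s0: "q3 + card (nbrs G x0) \<in> tor_support TYPE('a) G" using 3 by simp
    have "Max {q1, q3 + card (nbrs G x0)} \<in> {q1, q3 + card (nbrs G x0)}"
      by (rule Max_in) simp_all
    moreover have "{q1, q3 + card (nbrs G x0)} \<subseteq> tor_support TYPE('a) G"
      by (intro insert_subsetI empty_subsetI 1 s0)
    ultimately show ?thesis unfolding if_not_P[OF False] by (rule subsetD[rotated])
  qed
qed

end

section \<open>Koszul complexes of monomial ideals\<close>

abbreviation lookup :: "('b \<Rightarrow>\<^sub>0 'c::zero) \<Rightarrow> 'b \<Rightarrow> 'c" where
  "lookup \<equiv> Poly_Mapping.lookup"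

abbreviation keys :: "('b \<Rightarrow>\<^sub>0 'c::zero) \<Rightarrow> 'b set" where
  "keys \<equiv> Poly_Mapping.keys"

definition expo :: "'v::finite set \<Rightarrow> 'v \<Rightarrow>\<^sub>0 nat" where
  "expo \<tau> = Abs_poly_mapping (\<lambda>x. if x \<in> \<tau> then 1 else 0)"

lemma lookup_expo [simp]: "lookup (expo \<tau>) x = (if x \<in> \<tau> then 1 else 0)"
  by (simp add: expo_def)

lemma keys_expo [simp]: "keys (expo \<tau>) = \<tau>"
  by (auto simp: in_keys_iff split: if_splits)

lemma expo_empty [simp]: "expo {} = 0"
  by (rule poly_mapping_eqI) simp

lemma expo_insert: "v \<notin> \<tau> \<Longrightarrow> expo (insert v \<tau>) = expo \<tau> + Poly_Mapping.single v 1"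
  by (rule poly_mapping_eqI) (auto simp: lookup_add lookup_single when_def)

definition ple :: "('v \<Rightarrow>\<^sub>0 nat) \<Rightarrow> ('v \<Rightarrow>\<^sub>0 nat) \<Rightarrow> bool" where
  "ple m n \<longleftrightarrow> (\<forall>x. lookup m x \<le> lookup n x)"

lemma ple_add_diff: "ple m n \<Longrightarrow> (n - m) + m = n"
  by (rule poly_mapping_eqI) (simp add: ple_def lookup_add lookup_minus)

lemma ple_add [simp]: "ple m (n + m)" "ple m (m + n)"
  by (simp_all add: ple_def lookup_add)

lemma ple_expo: "ple (expo \<tau>) a \<longleftrightarrow> \<tau> \<subseteq> keys a"
  by (auto simp: ple_def in_keys_iff Suc_le_eq)

lemma lookup_single_mult:
  fixes p :: "('v \<Rightarrow>\<^sub>0 nat) \<Rightarrow>\<^sub>0 'k::comm_ring_1"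
  shows "lookup (Poly_Mapping.single d c * p) m = (if ple d m then c * lookup p (m - d) else 0)"
proof -
  have "lookup (Poly_Mapping.single d c * p) m =
      (\<Sum>l. ((c * (\<Sum>q. (lookup p q when m = l + q))) when l = d))"
    unfolding lookup_mult
    by (rule Sum_any.cong) (auto simp: lookup_single when_def)
  also have "\<dots> = c * (\<Sum>q. (lookup p q when m = d + q))" by (simp only: Sum_any_when_equal)
  also have "(\<Sum>q. (lookup p q when m = d + q)) = (if ple d m then lookup p (m - d) else 0)"
  proof (cases "ple d m")
    case True
    then have "m = d + q \<longleftrightarrow> q = m - d" for q using ple_add_diff[OF True] by (auto simp: add.commute)
    then show ?thesis using True by simp
  next
    case False
    then have "m \<noteq> d + q" for q by auto
    then show ?thesis using False by simp
  qed
  finally show ?thesis by simp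
qed

lemma lookup_ksgn_mult:
  fixes p :: "('v \<Rightarrow>\<^sub>0 nat) \<Rightarrow>\<^sub>0 'k::comm_ring_1"
  shows "lookup (ksgn v \<tau> * p) m = ksgn v \<tau> * lookup p m"
  by (cases "even (card {u \<in> \<tau>. vidx u < vidx v})") (simp_all add: ksgn_def)

definition kos :: "('v::finite set \<Rightarrow> ('v, 'k::field) mpoly) \<Rightarrow> 'v set \<Rightarrow> ('v, 'k) mpoly" where
  "kos c \<tau> = (\<Sum>v\<in>- \<tau>. ksgn v \<tau> * (indet v * c (insert v \<tau>)))"

text \<open>The basis element of \<open>\<tau>\<close> has multidegree \<open>expo \<tau>\<close>,
  so the part of degree \<open>a\<close> is the coefficient at \<open>a - expo \<tau>\<close>. The
  test with \<open>ple\<close> guards against the truncated subtraction of exponents.\<close>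

definition mdeg :: "('v::finite \<Rightarrow>\<^sub>0 nat) \<Rightarrow> ('v set \<Rightarrow> ('v, 'k::field) mpoly) \<Rightarrow> 'v set \<Rightarrow> 'k" where
  "mdeg a c \<tau> = (if ple (expo \<tau>) a then lookup (c \<tau>) (a - expo \<tau>) else 0)"

lemma mdeg_shift [simp]: "mdeg (m + expo \<tau>) c \<tau> = lookup (c \<tau>) m"
  by (simp add: mdeg_def)

lemma mdeg_eqI: 
  assumes "\<And>a \<tau>. mdeg a c \<tau> = mdeg a c' \<tau>"
  shows "c \<tau> = c' \<tau>"
  by (rule poly_mapping_eqI) (metis assms mdeg_shift)

text \<open>The Koszul differential preserves the multidegree: multiplication by \<open>v\<close>
  compensates for the smaller exponent of \<open>\<tau>\<close> compared with
  \<open>insert v \<tau>\<close>. Thus all sign computations reduce to those for scalar functions on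
  sets.\<close>

lemma mdeg_kos: "mdeg a (kos c) \<tau> = bd (mdeg a c) \<tau>"
proof (cases "ple (expo \<tau>) a")
  case True
  have "mdeg a (kos c) \<tau> = (\<Sum>v\<in>- \<tau>. ksgn v \<tau> * lookup (indet v * c (insert v \<tau>)) (a - expo \<tau>))"
    using True by (simp add: mdeg_def kos_def lookup_sum lookup_ksgn_mult)
  also have "\<dots> = bd (mdeg a c) \<tau>"
    unfolding bd_def
  proof (rule sum.cong)
    fix v assume "v \<in> - \<tau>"
    then have v: "v \<notin> \<tau>" by simp
    have "ple (Poly_Mapping.single v 1) (a - expo \<tau>) \<longleftrightarrow> v \<in> keys a"
      using v by (auto simp: ple_def lookup_single lookup_minus when_def in_keys_iff Suc_le_eq)
    also have "\<dots> \<longleftrightarrow> ple (expo (insert v \<tau>)) a" using True by (simp add: ple_expo)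
    finally show "ksgn v \<tau> * lookup (indet v * c (insert v \<tau>)) (a - expo \<tau>) = ksgn v \<tau> * mdeg a c (insert v \<tau>)"
      using v by (simp add: mdeg_def indet_def lookup_single_mult expo_insert diff_diff_add)
  qed simp
  finally show ?thesis .
next
  case False
  then have "mdeg a c (insert v \<tau>) = 0" for v by (simp add: mdeg_def ple_expo)
  then show ?thesis using False by (simp add: mdeg_def bd_def)
qed

lemma kos_kos [simp]: "kos (kos c) \<tau> = 0"
proof -
  have "mdeg a (kos (kos c)) \<tau> = mdeg a (\<lambda>_. 0) \<tau>" for a \<tau>
  proof -
    have "mdeg a (kos (kos c)) \<tau> = bd (bd (mdeg a c)) \<tau>"
    proof -
      have "mdeg a (kos c) = bd (mdeg a c)" by (rule ext) (rule mdeg_kos)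
      then show ?thesis by (simp add: mdeg_kos)
    qed
    then show ?thesis by (simp add: mdeg_def)
  qed
  then show ?thesis by (rule mdeg_eqI)
qed

text \<open>Graded pieces can be put together only if finitely many degrees occur, as the
  coefficients are polynomials.\<close>

lemma mdeg_assemble:
  fixes g :: "('v::finite \<Rightarrow>\<^sub>0 nat) \<Rightarrow> 'v set \<Rightarrow> 'k::field"
  assumes fin: "finite {a. \<exists>\<tau>. g a \<tau> \<noteq> 0}" and le: "\<And>a \<tau>. g a \<tau> \<noteq> 0 \<Longrightarrow> ple (expo \<tau>) a"
  obtains c where "\<And>a \<tau>. mdeg a c \<tau> = g a \<tau>"
proof -
  define c where "c \<tau> = Abs_poly_mapping (\<lambda>m. g (m + expo \<tau>) \<tau>)" for \<tau>
  have "finite {m. g (m + expo \<tau>) \<tau> \<noteq> 0}" for \<tau>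
  proof (rule finite_imageD)
    show "finite ((\<lambda>m. m + expo \<tau>) ` {m. g (m + expo \<tau>) \<tau> \<noteq> 0})"
      by (rule finite_subset[OF _ fin]) auto
  qed (simp add: inj_on_def)
  then have lc: "lookup (c \<tau>) m = g (m + expo \<tau>) \<tau>" for \<tau> m by (simp add: c_def)
  have "mdeg a c \<tau> = g a \<tau>" for a \<tau>
    using le[of a \<tau>] by (auto simp: mdeg_def lc ple_add_diff)
  then show ?thesis by (rule that)
qed

text \<open>For \<open>I\<close> closed under adding exponents this is the vanishing of the i-th
  Koszul homology of the monomial ideal with exponents \<open>I\<close>.\<close>

definition kos_exact :: "'k::field itself \<Rightarrow> ('v::finite \<Rightarrow>\<^sub>0 nat) set \<Rightarrow> nat \<Rightarrow> bool" where
  "kos_exact (_ :: 'k itself) I i \<longleftrightarrow>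
    (\<forall>c :: 'v set \<Rightarrow> ('v, 'k) mpoly.
      (\<forall>\<tau>. keys (c \<tau>) \<subseteq> I) \<and> (\<forall>\<tau>. c \<tau> \<noteq> 0 \<longrightarrow> card \<tau> = i) \<and> (\<forall>\<tau>. kos c \<tau> = 0) \<longrightarrow>
      (\<exists>e. (\<forall>\<tau>. keys (e \<tau>) \<subseteq> I) \<and> (\<forall>\<tau>. e \<tau> \<noteq> 0 \<longrightarrow> card \<tau> = Suc i) \<and> (\<forall>\<tau>. c \<tau> = kos e \<tau>)))"

text \<open>For an ideal this is its upper Koszul simplicial complex in degree
  \<open>a\<close>.\<close>

definition dfam :: "('v::finite \<Rightarrow>\<^sub>0 nat) set \<Rightarrow> ('v \<Rightarrow>\<^sub>0 nat) \<Rightarrow> 'v set set" where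
  "dfam I a = {\<tau>. ple (expo \<tau>) a \<and> a - expo \<tau> \<in> I}"

lemma chain_on_mdeg:
  assumes "\<And>\<tau>. keys (c \<tau>) \<subseteq> I" "\<And>\<tau>. c \<tau> \<noteq> 0 \<Longrightarrow> card \<tau> = i"
  shows "chain_on (dfam I a) i (mdeg a c)"
  unfolding chain_on_def
proof (intro allI impI)
  fix \<tau> assume nz: "mdeg a c \<tau> \<noteq> 0"
  then have *: "ple (expo \<tau>) a" "lookup (c \<tau>) (a - expo \<tau>) \<noteq> 0" by (auto simp: mdeg_def split: if_splits)
  then have "a - expo \<tau> \<in> I" "c \<tau> \<noteq> 0" using assms(1)[of \<tau>] by (auto simp: in_keys_iff)
  then show "\<tau> \<in> dfam I a \<and> card \<tau> = i" using * assms(2) by (simp add: dfam_def)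
qed

lemma chain_on_mdeg_keys:
  assumes "\<And>a. chain_on (dfam I a) i (mdeg a c)"
  shows "keys (c \<tau>) \<subseteq> I" "c \<tau> \<noteq> 0 \<Longrightarrow> card \<tau> = i"
proof -
  have *: "m \<in> I \<and> card \<tau> = i" if "m \<in> keys (c \<tau>)" for m
    using chain_onD[OF assms, of "m + expo \<tau>" \<tau>] that by (simp add: in_keys_iff dfam_def)
  then show "keys (c \<tau>) \<subseteq> I" by blast
  assume "c \<tau> \<noteq> 0"
  then have "keys (c \<tau>) \<noteq> {}" by (metis keys_eq_empty)
  then show "card \<tau> = i" using * by blast
qed

text \<open>The Koszul complex is the direct sum of its multidegree parts, and each part is the
  chain complex of a simplicial complex.\<close>

lemma kos_exact_iff:
  fixes I :: "('v::finite \<Rightarrow>\<^sub>0 nat) set"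
  assumes up: "\<And>m n. m \<in> I \<Longrightarrow> n + m \<in> I"
  shows "kos_exact TYPE('k::field) I i \<longleftrightarrow> (\<forall>a. \<not> hnz TYPE('k) (dfam I a) i)"
proof -
  have down: "\<tau> \<in> dfam I a" if "insert v \<tau> \<in> dfam I a" for v \<tau> a
  proof (cases "v \<in> \<tau>")
    case True
    then show ?thesis using that by (simp add: insert_absorb)
  next
    case False
    have *: "ple (expo (insert v \<tau>)) a" "a - expo (insert v \<tau>) \<in> I" using that by (auto simp: dfam_def)
    have "a - expo \<tau> = Poly_Mapping.single v 1 + (a - expo (insert v \<tau>))"
      using * False by (intro poly_mapping_eqI) (auto simp: lookup_add lookup_minus lookup_single when_def ple_def)
    then have "a - expo \<tau> \<in> I" using up[OF *(2)] by metis
    then show ?thesis using * by (simp add: dfam_def ple_expo)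
  qed
  have out: "bd f \<tau> = 0" if f: "chain_on (dfam I a) j f" and \<tau>: "\<tau> \<notin> dfam I a" for f :: "'v set \<Rightarrow> 'k" and a j \<tau>
    by (rule bd_outside[OF f _ \<tau>]) (rule down)
  show ?thesis
  proof
    assume ex: "kos_exact TYPE('k) I i"
    show "\<forall>a. \<not> hnz TYPE('k) (dfam I a) i"
    proof (intro allI notI)
      fix a assume "hnz TYPE('k) (dfam I a) i"
      then obtain f :: "'v set \<Rightarrow> 'k" where f: "cycle_on (dfam I a) i f" and nb: "\<not> boundary_on (dfam I a) i f"
        unfolding hnz_def by blast
      have ch: "chain_on (dfam I a) i f" using f by (simp add: cycle_on_def)
      have b0: "bd f \<tau> = 0" for \<tau> using f out[OF ch] by (cases "\<tau> \<in> dfam I a") (auto simp: cycle_on_def)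
      define g where "g b = (if b = a then f else (\<lambda>_. 0))" for b
      have gch: "chain_on (dfam I b) i (g b)" for b using ch by (simp add: g_def chain_on_def)
      have "finite {b. \<exists>\<tau>. g b \<tau> \<noteq> 0}" by (rule finite_subset[of _ "{a}"]) (auto simp: g_def)
      then obtain c where c: "\<And>b \<tau>. mdeg b c \<tau> = g b \<tau>"
        using mdeg_assemble[of g] chain_onD[OF gch] unfolding dfam_def by blast
      have c': "mdeg b c = g b" for b using c by blast
      have keys: "keys (c \<tau>) \<subseteq> I" "c \<tau> \<noteq> 0 \<Longrightarrow> card \<tau> = i" for \<tau>
        using chain_on_mdeg_keys[of I i c] gch by (simp_all add: c')
      have "mdeg b (kos c) \<tau> = mdeg b (\<lambda>_. 0) \<tau>" for b \<tau>
        unfolding mdeg_kos c' using b0 by (simp add: g_def mdeg_def)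
      then have "kos c \<tau> = 0" for \<tau> by (rule mdeg_eqI)
      then obtain e where e: "\<And>\<tau>. keys (e \<tau>) \<subseteq> I" "\<And>\<tau>. e \<tau> \<noteq> 0 \<Longrightarrow> card \<tau> = Suc i" "\<And>\<tau>. c \<tau> = kos e \<tau>"
        using ex keys unfolding kos_exact_def by blast
      have "f \<tau> = bd (mdeg a e) \<tau>" for \<tau>
      proof -
        have "f \<tau> = mdeg a c \<tau>" by (simp add: c' g_def)
        also have "\<dots> = mdeg a (kos e) \<tau>" using e(3) by (simp add: mdeg_def)
        finally show ?thesis by (simp add: mdeg_kos)
      qed
      then show False using nb chain_on_mdeg[of e I "Suc i", OF e(1,2)] unfolding boundary_on_def by blast
    qed
  next
    assume nz: "\<forall>a. \<not> hnz TYPE('k) (dfam I a) i"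
    show "kos_exact TYPE('k) I i"
      unfolding kos_exact_def
    proof (intro allI impI, elim conjE)
      fix c :: "'v set \<Rightarrow> ('v, 'k) mpoly"
      assume c: "\<forall>\<tau>. keys (c \<tau>) \<subseteq> I" "\<forall>\<tau>. c \<tau> \<noteq> 0 \<longrightarrow> card \<tau> = i" "\<forall>\<tau>. kos c \<tau> = 0"
      have ch: "chain_on (dfam I a) i (mdeg a c)" for a using c by (intro chain_on_mdeg) auto
      \<comment> \<open>The last clause makes the filling zero in degrees where \<open>c\<close>
        vanishes, so that only finitely many degrees are used.\<close>
      have "\<exists>g. chain_on (dfam I a) (Suc i) g \<and> (\<forall>\<tau>\<in>dfam I a. mdeg a c \<tau> = bd g \<tau>) \<and>
          ((\<forall>\<tau>. mdeg a c \<tau> = 0) \<longrightarrow> (\<forall>\<tau>. g \<tau> = 0))" for a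
      proof (cases "\<forall>\<tau>. mdeg a c \<tau> = 0")
        case True
        then show ?thesis by (intro exI[of _ "\<lambda>_. 0"]) (simp add: chain_on_def)
      next
        case False
        have "bd (mdeg a c) \<tau> = 0" for \<tau> unfolding mdeg_kos[symmetric] using c(3) by (simp add: mdeg_def)
        then have "cycle_on (dfam I a) i (mdeg a c)" using ch by (simp add: cycle_on_def)
        then have "boundary_on (dfam I a) i (mdeg a c)" using nz unfolding hnz_def by blast
        then show ?thesis using False unfolding boundary_on_def by blast
      qed
      then obtain g where g: "\<And>a. chain_on (dfam I a) (Suc i) (g a)"
        "\<And>a \<tau>. \<tau> \<in> dfam I a \<Longrightarrow> mdeg a c \<tau> = bd (g a) \<tau>"
        "\<And>a \<tau>. \<forall>\<tau>. mdeg a c \<tau> = 0 \<Longrightarrow> g a \<tau> = 0" by metis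
      have "finite {a. \<exists>\<tau>. g a \<tau> \<noteq> 0}"
      proof (rule finite_subset)
        show "{a. \<exists>\<tau>. g a \<tau> \<noteq> 0} \<subseteq> (\<Union>\<tau>. (\<lambda>m. m + expo \<tau>) ` keys (c \<tau>))"
        proof
          fix a assume "a \<in> {a. \<exists>\<tau>. g a \<tau> \<noteq> 0}"
          then obtain \<tau> where "mdeg a c \<tau> \<noteq> 0" using g(3) by blast
          then have "ple (expo \<tau>) a" "a - expo \<tau> \<in> keys (c \<tau>)"
            by (auto simp: mdeg_def in_keys_iff split: if_splits)
          then have "a \<in> (\<lambda>m. m + expo \<tau>) ` keys (c \<tau>)" using ple_add_diff by (metis image_eqI)
          then show "a \<in> (\<Union>\<tau>. (\<lambda>m. m + expo \<tau>) ` keys (c \<tau>))" by blast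
        qed
      qed auto
      then obtain e where e: "\<And>a \<tau>. mdeg a e \<tau> = g a \<tau>"
        using mdeg_assemble[of g] chain_onD[OF g(1)] unfolding dfam_def by blast
      have e': "mdeg a e = g a" for a using e by blast
      have "keys (e \<tau>) \<subseteq> I" "e \<tau> \<noteq> 0 \<longrightarrow> card \<tau> = Suc i" for \<tau>
        using chain_on_mdeg_keys[of I "Suc i" e] g(1) by (simp_all add: e')
      moreover have "mdeg a c \<tau> = mdeg a (kos e) \<tau>" for a \<tau>
        using g(2)[of \<tau> a] out[OF g(1), of \<tau> a] chain_onD[OF ch[of a], of \<tau>]
        by (cases "\<tau> \<in> dfam I a") (auto simp: mdeg_kos e')
      then have "c \<tau> = kos e \<tau>" for \<tau> by (rule mdeg_eqI)
      ultimately show "\<exists>e. (\<forall>\<tau>. keys (e \<tau>) \<subseteq> I) \<and> (\<forall>\<tau>. e \<tau> \<noteq> 0 \<longrightarrow> card \<tau> = Suc i) \<and> (\<forall>\<tau>. c \<tau> = kos e \<tau>)"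
        by blast
    qed
  qed
qed

text \<open>In a nonzero degree any variable of its support is a cone point. In degree zero only the
  empty set is left, whose class is the residue field; the index \<open>Suc i\<close> excludes
  it.\<close>

lemma kos_exact_UNIV: "kos_exact TYPE('k::field) (UNIV :: ('v::finite \<Rightarrow>\<^sub>0 nat) set) (Suc i)"
proof -
  have "\<not> hnz TYPE('k) (dfam UNIV a) (Suc i)" for a :: "'v \<Rightarrow>\<^sub>0 nat"
  proof (cases "a = 0")
    case True
    then show ?thesis by (intro not_hnz_zero_chain) (auto simp: dfam_def ple_expo)
  next
    case False
    then obtain v where "v \<in> keys a" by (metis all_not_in_conv keys_eq_empty)
    then show ?thesis by (intro not_hnz_cone[of v]) (auto simp: dfam_def ple_expo)
  qed
  then show ?thesis by (subst kos_exact_iff) auto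
qed

text \<open>Passing to the complement in \<open>Pow W\<close> turns Tor of the ideal into Tor of the
  quotient and raises the index by one. This needs a vertex in \<open>W\<close>: in the empty degree
  the quotient has homology that the ideal lacks.\<close>

lemma kos_exact_squarefree:
  fixes P :: "'v::finite set \<Rightarrow> bool"
  assumes P: "mono P" and P0: "\<not> P {}"
  shows "kos_exact TYPE('k::field) {m. P (keys m)} i \<longleftrightarrow> (\<forall>W. W \<noteq> {} \<longrightarrow> \<not> tor_nz TYPE('k) P W (Suc i))"
proof -
  let ?I = "{m. P (keys m)}"
  have mon: "P X \<Longrightarrow> X \<subseteq> Y \<Longrightarrow> P Y" for X Y using P by (auto dest: monoD)
  have keys_mono: "keys m \<subseteq> keys (n + m)" for m n :: "'v \<Rightarrow>\<^sub>0 nat" by (auto simp: in_keys_iff lookup_add)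
  have sqf: "hnz TYPE('k) (dfam ?I (expo W)) i \<longleftrightarrow> W \<noteq> {} \<and> tor_nz TYPE('k) P W (Suc i)" for W
  proof -
    have "keys (expo W - expo \<tau>) = W - \<tau>" if "\<tau> \<subseteq> W" for \<tau>
      using that by (auto simp: in_keys_iff lookup_minus split: if_splits)
    then have D: "dfam ?I (expo W) = {\<tau>. \<tau> \<subseteq> W \<and> P (W - \<tau>)}" by (auto simp: dfam_def ple_expo)
    then have N: "Pow W - dfam ?I (expo W) = nfam P W" by (auto simp: nfam_def)
    show ?thesis
    proof (cases "W = {}")
      case True
      then have "dfam ?I (expo W) = {}" using D P0 by auto
      then show ?thesis using True not_hnz_zero_chain[of "{}" i, where ?'a = 'k] by auto
    next
      case False
      then obtain v where v: "v \<in> W" by blast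
      have "hnz TYPE('k) (dfam ?I (expo W)) i \<longleftrightarrow> hnz TYPE('k) (Pow W - dfam ?I (expo W)) (Suc i)"
      proof (rule hnz_complement[OF v])
        show "dfam ?I (expo W) \<subseteq> Pow W" using D by auto
        fix \<sigma> \<tau> assume "\<tau> \<in> dfam ?I (expo W)" "\<sigma> \<subseteq> \<tau>"
        then show "\<sigma> \<in> dfam ?I (expo W)" unfolding D using mon[of "W - \<tau>" "W - \<sigma>"] by auto
      qed
      then show ?thesis using False unfolding N tor_nz_def by simp
    qed
  qed
  \<comment> \<open>If the exponent of \<open>v\<close> is at least two, subtracting one leaves the
    support unchanged, so \<open>v\<close> is a cone point.\<close>
  have nsq: "\<not> hnz TYPE('k) (dfam ?I a) i" if "\<And>W. a \<noteq> expo W" for a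
  proof -
    have "\<exists>v. 2 \<le> lookup a v"
    proof (rule ccontr)
      assume "\<not> ?thesis"
      then have "lookup a v < 2" for v by (simp add: not_le)
      then have "lookup a v = lookup (expo (keys a)) v" for v
        using less_2_cases[of "lookup a v"] by (auto simp: in_keys_iff)
      then show False using that[of "keys a"] poly_mapping_eqI by blast
    qed
    then obtain v where v: "2 \<le> lookup a v" by blast
    show ?thesis
    proof (rule not_hnz_cone[of v])
      fix \<tau> assume \<tau>: "v \<notin> \<tau>"
      have "keys (a - expo (insert v \<tau>)) = keys (a - expo \<tau>)"
        using v \<tau> by (auto simp: in_keys_iff lookup_minus split: if_splits)
      moreover have "v \<in> keys a" using v by (simp add: in_keys_iff)
      ultimately show "\<tau> \<in> dfam ?I a \<longleftrightarrow> insert v \<tau> \<in> dfam ?I a" by (simp add: dfam_def ple_expo)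
    qed
  qed
  have "kos_exact TYPE('k) ?I i \<longleftrightarrow> (\<forall>a. \<not> hnz TYPE('k) (dfam ?I a) i)"
    by (rule kos_exact_iff) (use mon keys_mono in blast)
  also have "\<dots> \<longleftrightarrow> (\<forall>W. \<not> hnz TYPE('k) (dfam ?I (expo W)) i)" using nsq by metis
  finally show ?thesis using sqf by blast
qed

lemma kos_diff: "kos (\<lambda>\<tau>. c \<tau> - d \<tau>) \<tau> = kos c \<tau> - kos d \<tau>"
  by (simp add: kos_def right_diff_distrib sum_subtractf)

lemma kos_mult: "kos (\<lambda>\<tau>. p * c \<tau>) \<tau> = p * kos c \<tau>"
  by (simp add: kos_def sum_distrib_left mult.left_commute)

lemma kos_sum: "kos (\<lambda>\<tau>. \<Sum>j\<in>J. c j \<tau>) \<tau> = (\<Sum>j\<in>J. kos (c j) \<tau>)"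
  by (simp add: kos_def sum_distrib_left) (rule sum.swap)

lemma kos_nonzeroE:
  assumes "kos c \<tau> \<noteq> 0"
  obtains v where "v \<notin> \<tau>" "c (insert v \<tau>) \<noteq> 0"
proof -
  have "\<exists>v\<in>- \<tau>. c (insert v \<tau>) \<noteq> 0"
  proof (rule ccontr)
    assume "\<not> ?thesis"
    then have "kos c \<tau> = 0" unfolding kos_def by (intro sum.neutral) simp
    then show False using assms by contradiction
  qed
  then show ?thesis using that by blast
qed

section \<open>Betti numbers through Koszul homology\<close>

lemma mat_imageI: "A \<in> carrier_mat n b \<Longrightarrow> v \<in> carrier_vec b \<Longrightarrow> A *\<^sub>v v \<in> mat_image A"
  by (auto simp: mat_image_def)

lemma mat_imageE:
  assumes "w \<in> mat_image A" "A \<in> carrier_mat n b"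
  obtains v where "v \<in> carrier_vec b" "w = A *\<^sub>v v"
  using assms by (auto simp: mat_image_def)

lemma mat_image_eq_span:
  fixes B :: "'k::field mat"
  assumes B: "B \<in> carrier_mat n c"
  shows "mat_image B = LinearCombinations.module.span class_ring (module_vec TYPE('k) n) (set (cols B))"
proof -
  interpret vec_space "TYPE('k)" n .
  have "span (set (cols B)) = mat_image B"
    using col_space_eq[OF B] B by (auto simp: col_space_def mat_image_def)
  then show ?thesis by simp
qed

text \<open>The columns are a finite basis of the kernel. This is the scalar input to the
  construction of resolutions.\<close>

lemma kernel_eq_image:
  fixes A :: "'k::field mat"
  assumes A: "A \<in> carrier_mat n b"
  obtains B c where "B \<in> carrier_mat b c" "mat_kernel A = mat_image B"
proof -
  interpret kernel n b A by unfold_locales (rule A)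
  obtain S where S: "finite S" "basis S" using kernel_basis_exists[OF A] by blast
  have sub: "S \<subseteq> mat_kernel A" and gen: "span S = mat_kernel A"
    using S(2) by (auto simp: Ker.basis_def)
  obtain xs where xs: "set xs = S" using finite_list[OF S(1)] by blast
  have c: "set xs \<subseteq> carrier_vec b" using sub xs mat_kernel_carrier[OF A] by auto
  let ?B = "mat_of_cols b xs"
  have B: "?B \<in> carrier_mat b (length xs)" by simp
  have "mat_image ?B = NC.span S" using mat_image_eq_span[OF B] c xs by (simp add: cols_mat_of_cols)
  also have "\<dots> = mat_kernel A" using span_same[OF sub] gen by simp
  finally show ?thesis using that[OF B] by simp
qed

text \<open>As the subtraction is truncated, a strict inequality is needed: a kernel vector outside
  the image enlarges a maximal independent set of columns within the kernel.\<close>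

lemma kernel_dim_minus_rank:
  fixes A B :: "'k::field mat"
  assumes A: "A \<in> carrier_mat n b" and B: "B \<in> carrier_mat b c" and sub: "mat_image B \<subseteq> mat_kernel A"
  shows "kernel_dim A - mat_rank B \<noteq> 0 \<longleftrightarrow> mat_kernel A \<noteq> mat_image B"
proof -
  interpret kernel n b A by unfold_locales (rule A)
  have kd: "kernel_dim A = dim" using A by (simp add: kernel_dim_def)
  have mr: "mat_rank B = NC.rank B" using B by (simp add: mat_rank_def)
  have im: "mat_image B = NC.span (set (cols B))" by (rule mat_image_eq_span[OF B])
  have cB: "set (cols B) \<subseteq> carrier_vec b" using B cols_dim by blast
  show ?thesis
  proof
    assume "kernel_dim A - mat_rank B \<noteq> 0"
    moreover have "mat_kernel A = mat_image B \<Longrightarrow> kernel_dim A = mat_rank B"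
      unfolding kd mr im NC.rank_def by simp
    ultimately show "mat_kernel A \<noteq> mat_image B" by auto
  next
    assume "mat_kernel A \<noteq> mat_image B"
    then obtain u where u: "u \<in> mat_kernel A" "u \<notin> NC.span (set (cols B))" using sub im by auto
    have uc: "u \<in> carrier_vec b" using u mat_kernel_carrier[OF A] by auto
    obtain S where S: "finite S" "maximal S (\<lambda>T. T \<subseteq> set (cols B) \<and> NC.lin_indpt T)"
    proof -
      have "{} \<subseteq> set (cols B) \<and> NC.lin_indpt {}" by (auto simp: NC.lin_dep_def)
      then show ?thesis
        using maximal_exists_superset[of "set (cols B)" "\<lambda>T. T \<subseteq> set (cols B) \<and> NC.lin_indpt T" "{}"] that
        by auto
    qed
    have rk: "NC.rank B = card S" by (rule NC.rank_card_indpt[OF B S(2)])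
    have SB: "S \<subseteq> set (cols B)" "NC.lin_indpt S" using S(2) by (auto simp: maximal_def)
    have SV: "S \<subseteq> carrier_vec b" using SB cB by auto
    have uS: "u \<notin> NC.span S" using u(2) NC.span_is_monotone[OF SB(1)] by auto
    have uS': "u \<notin> S" using uS NC.span_mem[of S u] SV by auto
    have ind: "NC.lin_indpt (S \<union> {u})"
      using NC.lin_dep_iff_in_span[of S u] SV SB(2) uc uS uS' by auto
    have "set (cols B) \<subseteq> mat_kernel A" using sub im NC.in_own_span[of "set (cols B)"] cB by auto
    then have K: "S \<union> {u} \<subseteq> mat_kernel A" using SB u by auto
    obtain T where T: "finite T" "basis T" using kernel_basis_exists[OF A] by blast
    then have fd: "Ker.fin_dim" unfolding Ker.fin_dim_def Ker.basis_def by blast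
    have "card (S \<union> {u}) \<le> dim"
      by (rule Ker.li_le_dim(2)[OF fd K]) (use ind lindep_same[OF K] in simp)
    then show "kernel_dim A - mat_rank B \<noteq> 0" using S(1) uS' kd mr rk by simp
  qed
qed

subsection \<open>Reduction modulo the variables\<close>

lemma const_coeff_diff: "const_coeff (p - q) = const_coeff p - const_coeff q"
  by (simp add: const_coeff_def lookup_minus)

lemma const_coeff_sum: "const_coeff (sum f A) = (\<Sum>x\<in>A. const_coeff (f x))"
  by (simp add: const_coeff_def lookup_sum)

lemma const_coeff_mult:
  fixes p q :: "('v, 'k::field) mpoly"
  shows "const_coeff (p * q) = const_coeff p * const_coeff q"
proof -
  have z: "0 = l + m \<longleftrightarrow> l = 0 \<and> m = 0" for l m :: "'v \<Rightarrow>\<^sub>0 nat"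
    by (auto simp: poly_mapping_eq_iff lookup_add fun_eq_iff)
  have "const_coeff (p * q) = (\<Sum>l. lookup p l * (\<Sum>m. (lookup q m when 0 = l + m)))"
    by (simp add: const_coeff_def lookup_mult)
  also have "\<dots> = (\<Sum>l. ((lookup p l * lookup q 0) when l = 0))"
  proof (rule Sum_any.cong)
    fix l
    have "(\<Sum>m. (lookup q m when 0 = l + m)) = (\<Sum>m. ((lookup q m when l = 0) when m = 0))"
      by (rule Sum_any.cong) (auto simp: when_def z)
    also have "\<dots> = (lookup q 0 when l = 0)" by (simp only: Sum_any_when_equal)
    finally show "lookup p l * (\<Sum>m. (lookup q m when 0 = l + m)) = ((lookup p l * lookup q 0) when l = 0)"
      by (simp add: when_def)
  qed
  finally show ?thesis by (simp add: const_coeff_def)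
qed

abbreviation cvec :: "('v, 'k::field) mpoly vec \<Rightarrow> 'k vec" where
  "cvec v \<equiv> map_vec const_coeff v"

abbreviation cmat :: "('v, 'k::field) mpoly mat \<Rightarrow> 'k mat" where
  "cmat A \<equiv> map_mat const_coeff A"

text \<open>Constant polynomials split the reduction modulo the variables.\<close>

definition lift_vec :: "'k::field vec \<Rightarrow> ('v, 'k) mpoly vec" where
  "lift_vec u = map_vec (Poly_Mapping.single 0) u"

lemma lift_vec_carrier [simp]: "u \<in> carrier_vec n \<Longrightarrow> lift_vec u \<in> carrier_vec n"
  by (simp add: lift_vec_def)

lemma cvec_lift [simp]: "cvec (lift_vec u) = u"
  by (rule eq_vecI) (simp_all add: lift_vec_def const_coeff_def)

lemma cvec_mult:
  assumes "A \<in> carrier_mat n b" "v \<in> carrier_vec b"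
  shows "cvec (A *\<^sub>v v) = cmat A *\<^sub>v cvec v"
  using assms by (intro eq_vecI) (auto simp: scalar_prod_def const_coeff_sum const_coeff_mult)

lemma cvec_diff:
  assumes "v \<in> carrier_vec b" "w \<in> carrier_vec b"
  shows "cvec (v - w) = cvec v - cvec w"
  using assms by (intro eq_vecI) (auto simp: const_coeff_diff)

text \<open>Both homology in degree \<open>0\<close> and in positive degrees are instances, through the choice of \<open>\<Phi>\<close>.\<close>

lemma residue_exact_iff:
  fixes A B :: "('v, 'k::field) mpoly mat"
  assumes A: "A \<in> carrier_mat n b" and B: "B \<in> carrier_mat b c" and ker: "mat_kernel A = mat_image B"
  shows "(\<forall>v\<in>carrier_vec b. \<Phi> (cvec v) \<longrightarrow> (\<exists>t\<in>carrier_vec b. cvec t = 0\<^sub>v b \<and> A *\<^sub>v v = A *\<^sub>v t)) \<longleftrightarrow>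
    (\<forall>u\<in>carrier_vec b. \<Phi> u \<longrightarrow> u \<in> mat_image (cmat B))"
proof (intro iffI ballI impI)
  have cB: "cmat B \<in> carrier_mat b c" using B by simp
  fix u :: "'k vec"
  assume l: "\<forall>v\<in>carrier_vec b. \<Phi> (cvec v) \<longrightarrow> (\<exists>t\<in>carrier_vec b. cvec t = 0\<^sub>v b \<and> A *\<^sub>v v = A *\<^sub>v t)"
    and u: "u \<in> carrier_vec b" "\<Phi> u"
  have lu: "(lift_vec u :: ('v, 'k) mpoly vec) \<in> carrier_vec b" using u by simp
  obtain t where t: "t \<in> carrier_vec b" "cvec t = 0\<^sub>v b" "A *\<^sub>v lift_vec u = A *\<^sub>v t"
    using l lu u by force
  have "A *\<^sub>v (lift_vec u - t) = 0\<^sub>v n"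
    using A lu t by (simp add: mult_minus_distrib_mat_vec)
  then have "lift_vec u - t \<in> mat_kernel A" using A lu t by (intro mat_kernelI) auto
  then obtain y where y: "y \<in> carrier_vec c" "lift_vec u - t = B *\<^sub>v y"
    unfolding ker by (rule mat_imageE[OF _ B])
  have "u = cvec (lift_vec u - t)"
    using cvec_diff[OF lu t(1)] t(2) u(1) by simp
  also have "\<dots> = cmat B *\<^sub>v cvec y" unfolding y(2) by (rule cvec_mult[OF B y(1)])
  finally show "u \<in> mat_image (cmat B)" using mat_imageI[OF cB] y(1) by simp
next
  have cB: "cmat B \<in> carrier_mat b c" using B by simp
  fix v :: "('v, 'k) mpoly vec" assume r: "\<forall>u\<in>carrier_vec b. \<Phi> u \<longrightarrow> u \<in> mat_image (cmat B)"
    and v: "v \<in> carrier_vec b" "\<Phi> (cvec v)"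
  have "cvec v \<in> mat_image (cmat B)" using r v by simp
  then obtain y where y: "y \<in> carrier_vec c" "cvec v = cmat B *\<^sub>v y" by (rule mat_imageE[OF _ cB])
  \<comment> \<open>The subtracted vector lies in the kernel of \<open>A\<close> and has the same
    constant terms as \<open>v\<close>, so the difference has no constant terms and the same
    image.\<close>
  let ?t = "v - B *\<^sub>v lift_vec y"
  have ly: "(lift_vec y :: ('v, 'k) mpoly vec) \<in> carrier_vec c" using y by simp
  have By: "B *\<^sub>v lift_vec y \<in> carrier_vec b" using B ly by simp
  have "cvec ?t = cvec v - cvec (B *\<^sub>v lift_vec y)" by (rule cvec_diff[OF v(1) By])
  also have "\<dots> = 0\<^sub>v b" unfolding cvec_mult[OF B ly] y(2) using cB y by simp
  finally have 1: "cvec ?t = 0\<^sub>v b" .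
  have "B *\<^sub>v lift_vec y \<in> mat_kernel A" unfolding ker by (rule mat_imageI[OF B ly])
  then have "A *\<^sub>v (B *\<^sub>v lift_vec y) = 0\<^sub>v n" by (rule mat_kernelD[OF A])
  then have "A *\<^sub>v ?t = A *\<^sub>v v" using A v By by (simp add: mult_minus_distrib_mat_vec)
  then show "\<exists>t\<in>carrier_vec b. cvec t = 0\<^sub>v b \<and> A *\<^sub>v v = A *\<^sub>v t"
    using 1 v By by (intro bexI[of _ ?t]) auto
qed

subsection \<open>Vector-valued Koszul chains\<close>

definition vkos :: "nat \<Rightarrow> ('v::finite set \<Rightarrow> ('v, 'k::field) mpoly vec) \<Rightarrow> 'v set \<Rightarrow> ('v, 'k) mpoly vec" where
  "vkos n C \<tau> = vec n (\<lambda>j. kos (\<lambda>\<sigma>. C \<sigma> $ j) \<tau>)"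

definition vchain :: "nat \<Rightarrow> ('v, 'k::field) mpoly vec set \<Rightarrow> nat \<Rightarrow> ('v::finite set \<Rightarrow> ('v, 'k) mpoly vec) \<Rightarrow> bool" where
  "vchain n N i C \<longleftrightarrow> (\<forall>\<tau>. C \<tau> \<in> N) \<and> (\<forall>\<tau>. C \<tau> \<noteq> 0\<^sub>v n \<longrightarrow> card \<tau> = i)"

text \<open>The vanishing of Tor_i(k, N) for a submodule \<open>N\<close> of the free module of rank
  n, computed by the Koszul complex with coefficients in \<open>N\<close>.\<close>

definition kex :: "nat \<Rightarrow> ('v::finite, 'k::field) mpoly vec set \<Rightarrow> nat \<Rightarrow> bool" where
  "kex n N i \<longleftrightarrow> (\<forall>C. vchain n N i C \<and> (\<forall>\<tau>. vkos n C \<tau> = 0\<^sub>v n) \<longrightarrow>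
     (\<exists>E. vchain n N (Suc i) E \<and> (\<forall>\<tau>. C \<tau> = vkos n E \<tau>)))"

text \<open>Every chain of degree \<open>0\<close> is a cycle. The dimension shift along a resolution only sees the cycles
  that bound in the ambient free module, which makes a difference in degree \<open>0\<close>.\<close>

definition bex :: "nat \<Rightarrow> ('v::finite, 'k::field) mpoly vec set \<Rightarrow> nat \<Rightarrow> bool" where
  "bex n N i \<longleftrightarrow> (\<forall>C E'. vchain n N i C \<and> vchain n (carrier_vec n) (Suc i) E' \<and> (\<forall>\<tau>. C \<tau> = vkos n E' \<tau>) \<longrightarrow>
     (\<exists>E. vchain n N (Suc i) E \<and> (\<forall>\<tau>. C \<tau> = vkos n E \<tau>)))"

lemma vkos_carrier [simp]: "vkos n C \<tau> \<in> carrier_vec n"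
  by (simp add: vkos_def)

lemma vkos_vkos [simp]: "vkos n (vkos n C) \<tau> = 0\<^sub>v n"
proof (rule eq_vecI)
  fix j assume j: "j < dim_vec (0\<^sub>v n :: ('a, 'b) mpoly vec)"
  then have "(\<lambda>\<sigma>. vkos n C \<sigma> $ j) = kos (\<lambda>\<sigma>. C \<sigma> $ j)" by (intro ext) (simp add: vkos_def)
  then show "vkos n (vkos n C) \<tau> $ j = 0\<^sub>v n $ j" using j by (simp add: vkos_def[of n "vkos n C"])
qed (simp add: vkos_def)

lemma vkos_nonzeroE:
  assumes "vkos n E \<tau> \<noteq> 0\<^sub>v n" "\<And>\<sigma>. E \<sigma> \<in> carrier_vec n"
  obtains v where "v \<notin> \<tau>" "E (insert v \<tau>) \<noteq> 0\<^sub>v n"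
proof -
  have "\<exists>j<n. kos (\<lambda>\<sigma>. E \<sigma> $ j) \<tau> \<noteq> 0"
  proof (rule ccontr)
    assume "\<not> ?thesis"
    then have "vkos n E \<tau> = 0\<^sub>v n" by (intro eq_vecI) (auto simp: vkos_def)
    then show False using assms(1) by contradiction
  qed
  then obtain j where j: "j < n" "kos (\<lambda>\<sigma>. E \<sigma> $ j) \<tau> \<noteq> 0" by blast
  obtain v where "v \<notin> \<tau>" "E (insert v \<tau>) $ j \<noteq> 0" by (rule kos_nonzeroE[OF j(2)])
  moreover from this j have "E (insert v \<tau>) \<noteq> 0\<^sub>v n" by auto
  ultimately show ?thesis using that by blast
qed

lemma card_vkos:
  assumes "vchain n (carrier_vec n) (Suc i) E" "vkos n E \<tau> \<noteq> 0\<^sub>v n"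
  shows "card \<tau> = i"
proof -
  obtain v where "v \<notin> \<tau>" "E (insert v \<tau>) \<noteq> 0\<^sub>v n"
    by (rule vkos_nonzeroE[OF assms(2)]) (use assms(1) in \<open>auto simp: vchain_def\<close>)
  then show ?thesis using assms(1) by (fastforce simp: vchain_def)
qed

lemma vkos_mult:
  assumes A: "A \<in> carrier_mat n b" and C: "\<And>\<sigma>. C \<sigma> \<in> carrier_vec b"
  shows "vkos n (\<lambda>\<sigma>. A *\<^sub>v C \<sigma>) \<tau> = A *\<^sub>v vkos b C \<tau>"
proof (rule eq_vecI)
  fix i assume "i < dim_vec (A *\<^sub>v vkos b C \<tau>)"
  then have i: "i < n" using A by simp
  have "(A *\<^sub>v C \<sigma>) $ i = (\<Sum>j\<in>{0..<b}. A $$ (i, j) * C \<sigma> $ j)" for \<sigma>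
    using A C[of \<sigma>] i by (auto simp: scalar_prod_def)
  then have "vkos n (\<lambda>\<sigma>. A *\<^sub>v C \<sigma>) \<tau> $ i = (\<Sum>j\<in>{0..<b}. A $$ (i, j) * kos (\<lambda>\<sigma>. C \<sigma> $ j) \<tau>)"
    using i by (simp add: vkos_def kos_sum kos_mult)
  also have "\<dots> = (A *\<^sub>v vkos b C \<tau>) $ i" using A i by (auto simp: scalar_prod_def vkos_def)
  finally show "vkos n (\<lambda>\<sigma>. A *\<^sub>v C \<sigma>) \<tau> $ i = (A *\<^sub>v vkos b C \<tau>) $ i" .
qed (use A in \<open>simp add: vkos_def\<close>)

lemma vkos_diff:
  assumes "\<And>\<sigma>. C \<sigma> \<in> carrier_vec n" "\<And>\<sigma>. D \<sigma> \<in> carrier_vec n"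
  shows "vkos n (\<lambda>\<sigma>. C \<sigma> - D \<sigma>) \<tau> = vkos n C \<tau> - vkos n D \<tau>"
proof (rule eq_vecI)
  fix i assume i: "i < dim_vec (vkos n C \<tau> - vkos n D \<tau>)"
  have "(C \<sigma> - D \<sigma>) $ i = C \<sigma> $ i - D \<sigma> $ i" for \<sigma>
    using i assms(2)[of \<sigma>] by (simp add: vkos_def)
  then show "vkos n (\<lambda>\<sigma>. C \<sigma> - D \<sigma>) \<tau> $ i = (vkos n C \<tau> - vkos n D \<tau>) $ i"
    using i by (simp add: vkos_def kos_diff)
qed (simp add: vkos_def)

text \<open>The set \<open>S\<close> is everything when a cycle of positive degree is filled, and
  only \<open>{{}}\<close> when a single vector is written as a boundary in degree zero.\<close>

lemma vkos_assemble:
  fixes C :: "'v::finite set \<Rightarrow> ('v, 'k::field) mpoly vec"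
  assumes C: "\<And>\<tau>. C \<tau> \<in> carrier_vec n"
    and ex: "\<And>j. j < n \<Longrightarrow> \<exists>e. (\<forall>\<tau>. e \<tau> \<noteq> 0 \<longrightarrow> card \<tau> = i) \<and> (\<forall>\<tau>\<in>S. C \<tau> $ j = kos e \<tau>)"
  obtains E where "vchain n (carrier_vec n) i E" "\<And>\<tau>. \<tau> \<in> S \<Longrightarrow> C \<tau> = vkos n E \<tau>"
proof -
  obtain e :: "nat \<Rightarrow> 'v set \<Rightarrow> ('v, 'k) mpoly" where
    e: "\<And>j \<tau>. j < n \<Longrightarrow> e j \<tau> \<noteq> 0 \<Longrightarrow> card \<tau> = i" "\<And>j \<tau>. j < n \<Longrightarrow> \<tau> \<in> S \<Longrightarrow> C \<tau> $ j = kos (e j) \<tau>"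
    using ex by metis
  define E where "E \<tau> = vec n (\<lambda>j. e j \<tau>)" for \<tau>
  have "vchain n (carrier_vec n) i E"
    unfolding vchain_def
  proof (intro conjI allI impI)
    fix \<tau> assume "E \<tau> \<noteq> 0\<^sub>v n"
    then have "\<exists>j<n. e j \<tau> \<noteq> 0" by (auto simp: E_def)
    then show "card \<tau> = i" using e(1) by blast
  qed (simp add: E_def)
  moreover have "C \<tau> = vkos n E \<tau>" if "\<tau> \<in> S" for \<tau>
  proof (rule eq_vecI)
    fix j assume "j < dim_vec (vkos n E \<tau>)"
    then have j: "j < n" by (simp add: vkos_def)
    then have "(\<lambda>\<sigma>. E \<sigma> $ j) = e j" by (intro ext) (simp add: E_def)
    then show "C \<tau> $ j = vkos n E \<tau> $ j" using j e(2) that by (simp add: vkos_def)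
  qed (use C[of \<tau>] in \<open>simp add: vkos_def\<close>)
  ultimately show ?thesis by (rule that)
qed

lemma vkos_exact_free:
  fixes C :: "'v::finite set \<Rightarrow> ('v, 'k::field) mpoly vec"
  assumes C: "vchain n (carrier_vec n) (Suc i) C" and cyc: "\<And>\<tau>. vkos n C \<tau> = 0\<^sub>v n"
  obtains E where "vchain n (carrier_vec n) (Suc (Suc i)) E" "\<And>\<tau>. C \<tau> = vkos n E \<tau>"
proof -
  have Cc: "C \<tau> \<in> carrier_vec n" for \<tau> using C by (simp add: vchain_def)
  have ex: "\<exists>e :: 'v set \<Rightarrow> ('v, 'k) mpoly. (\<forall>\<tau>. e \<tau> \<noteq> 0 \<longrightarrow> card \<tau> = Suc (Suc i)) \<and>
      (\<forall>\<tau>\<in>UNIV. C \<tau> $ j = kos e \<tau>)" if j: "j < n" for j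
  proof -
    have "C \<tau> $ j \<noteq> 0 \<longrightarrow> card \<tau> = Suc i" for \<tau>
    proof
      assume "C \<tau> $ j \<noteq> 0"
      then have "C \<tau> \<noteq> 0\<^sub>v n" using j by auto
      then show "card \<tau> = Suc i" using C by (simp add: vchain_def)
    qed
    moreover have "kos (\<lambda>\<sigma>. C \<sigma> $ j) \<tau> = 0" for \<tau>
      using arg_cong[OF cyc[of \<tau>], of "\<lambda>w. w $ j"] j by (simp add: vkos_def)
    ultimately show ?thesis
      using kos_exact_UNIV[where ?'k = 'k and ?'v = 'v, of i] unfolding kos_exact_def by auto
  qed
  show ?thesis
  proof (rule vkos_assemble[OF Cc ex])
    fix E assume "vchain n (carrier_vec n) (Suc (Suc i)) E" "\<And>\<tau>. \<tau> \<in> UNIV \<Longrightarrow> C \<tau> = vkos n E \<tau>"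
    then show thesis by (intro that[of E]) simp_all
  qed
qed

text \<open>In positive degrees every cycle bounds in the free module, so both notions test the same
  chains.\<close>

lemma bex_eq_kex:
  assumes N: "N \<subseteq> carrier_vec n"
  shows "bex n N (Suc i) \<longleftrightarrow> kex n N (Suc i)"
proof
  assume b: "bex n N (Suc i)"
  show "kex n N (Suc i)" unfolding kex_def
  proof (intro allI impI, elim conjE)
    fix C assume C: "vchain n N (Suc i) C" "\<forall>\<tau>. vkos n C \<tau> = 0\<^sub>v n"
    have "vchain n (carrier_vec n) (Suc i) C" using C(1) N by (auto simp: vchain_def)
    then obtain E where "vchain n (carrier_vec n) (Suc (Suc i)) E" "\<And>\<tau>. C \<tau> = vkos n E \<tau>"
      by (rule vkos_exact_free) (use C in auto)
    then show "\<exists>E. vchain n N (Suc (Suc i)) E \<and> (\<forall>\<tau>. C \<tau> = vkos n E \<tau>)"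
      using b C(1) unfolding bex_def by blast
  qed
next
  assume k: "kex n N (Suc i)"
  show "bex n N (Suc i)" unfolding bex_def
  proof (intro allI impI, elim conjE)
    fix C E' assume C: "vchain n N (Suc i) C" "\<forall>\<tau>. C \<tau> = vkos n E' \<tau>"
    then have "C = vkos n E'" by blast
    then have "vkos n C \<tau> = 0\<^sub>v n" for \<tau> by simp
    then show "\<exists>E. vchain n N (Suc (Suc i)) E \<and> (\<forall>\<tau>. C \<tau> = vkos n E \<tau>)"
      using k C(1) unfolding kex_def by blast
  qed
qed

lemma lift_chain:
  assumes A: "A \<in> carrier_mat n b" and C: "vchain n (mat_image A) i C"
  obtains L where "vchain b (carrier_vec b) i L" "\<And>\<tau>. C \<tau> = A *\<^sub>v L \<tau>"
proof -
  \<comment> \<open>Zero is lifted to zero, so that the lift is supported in the same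
    cardinality.\<close>
  have "\<exists>v. v \<in> carrier_vec b \<and> C \<tau> = A *\<^sub>v v \<and> (C \<tau> = 0\<^sub>v n \<longrightarrow> v = 0\<^sub>v b)" for \<tau>
  proof (cases "C \<tau> = 0\<^sub>v n")
    case True
    then show ?thesis using A by (intro exI[of _ "0\<^sub>v b"]) auto
  next
    case False
    have "C \<tau> \<in> mat_image A" using C by (simp add: vchain_def)
    then obtain v where "v \<in> carrier_vec b" "C \<tau> = A *\<^sub>v v" by (rule mat_imageE[OF _ A])
    then show ?thesis using False by blast
  qed
  then obtain L where L: "\<And>\<tau>. L \<tau> \<in> carrier_vec b" "\<And>\<tau>. C \<tau> = A *\<^sub>v L \<tau>" "\<And>\<tau>. C \<tau> = 0\<^sub>v n \<Longrightarrow> L \<tau> = 0\<^sub>v b"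
    by metis
  have "vchain b (carrier_vec b) i L"
    unfolding vchain_def
  proof (intro conjI allI impI)
    fix \<tau> assume "L \<tau> \<noteq> 0\<^sub>v b"
    then have "C \<tau> \<noteq> 0\<^sub>v n" using L(3) by blast
    then show "card \<tau> = i" using C by (simp add: vchain_def)
  qed (rule L(1))
  then show ?thesis using L(2) by (rule that)
qed

lemma vchain_mult:
  assumes A: "A \<in> carrier_mat n b" and H: "vchain b (carrier_vec b) i H"
  shows "vchain n (mat_image A) i (\<lambda>\<sigma>. A *\<^sub>v H \<sigma>)"
  unfolding vchain_def
proof (intro conjI allI impI)
  fix \<tau> show "A *\<^sub>v H \<tau> \<in> mat_image A" using H by (intro mat_imageI[OF A]) (simp add: vchain_def)
  assume "A *\<^sub>v H \<tau> \<noteq> 0\<^sub>v n"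
  then have "H \<tau> \<noteq> 0\<^sub>v b" using A by auto
  then show "card \<tau> = i" using H by (simp add: vchain_def)
qed

text \<open>The long exact sequence of 0 -> ker A -> S^b -> im A -> 0: the free module in the middle
  is Koszul-exact in positive degrees, and the class of a cycle in the image is sent to the boundary
  of a lift.\<close>

lemma dimension_shift:
  assumes A: "A \<in> carrier_mat n b"
  shows "kex n (mat_image A) (Suc i) \<longleftrightarrow> bex b (mat_kernel A) i"
proof
  assume b: "bex b (mat_kernel A) i"
  show "kex n (mat_image A) (Suc i)"
    unfolding kex_def
  proof (intro allI impI, elim conjE)
    fix C assume C: "vchain n (mat_image A) (Suc i) C" and cyc: "\<forall>\<tau>. vkos n C \<tau> = 0\<^sub>v n"
    obtain L where L: "vchain b (carrier_vec b) (Suc i) L" "\<And>\<tau>. C \<tau> = A *\<^sub>v L \<tau>"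
      using lift_chain[OF A C] by blast
    have Lc: "L \<tau> \<in> carrier_vec b" for \<tau> using L by (simp add: vchain_def)
    have "C = (\<lambda>\<sigma>. A *\<^sub>v L \<sigma>)" using L(2) by blast
    then have "A *\<^sub>v vkos b L \<tau> = 0\<^sub>v n" for \<tau> using vkos_mult[where \<tau> = \<tau> and C = L, OF A Lc] cyc by simp
    then have "vkos b L \<tau> \<in> mat_kernel A" for \<tau> using A by (intro mat_kernelI) auto
    then have "vchain b (mat_kernel A) i (vkos b L)" using card_vkos[OF L(1)] by (auto simp: vchain_def)
    \<comment> \<open>Subtracting \<open>E\<close>, which \<open>A\<close> kills, makes the lift
      \<open>L\<close> a cycle without changing its image.\<close>
    then obtain E where E: "vchain b (mat_kernel A) (Suc i) E" "\<And>\<tau>. vkos b L \<tau> = vkos b E \<tau>"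
      using b L(1) unfolding bex_def by blast
    have EK: "E \<tau> \<in> mat_kernel A" for \<tau> using E by (simp add: vchain_def)
    have Ec: "E \<tau> \<in> carrier_vec b" for \<tau> using mat_kernelD(1)[OF A EK] .
    let ?D = "\<lambda>\<tau>. L \<tau> - E \<tau>"
    have "vchain b (carrier_vec b) (Suc i) ?D"
      unfolding vchain_def
    proof (intro conjI allI impI)
      fix \<tau> show "?D \<tau> \<in> carrier_vec b" using Lc Ec by simp
      assume "?D \<tau> \<noteq> 0\<^sub>v b"
      then have "L \<tau> \<noteq> 0\<^sub>v b \<or> E \<tau> \<noteq> 0\<^sub>v b" using Ec by auto
      then show "card \<tau> = Suc i" using L(1) E(1) by (auto simp: vchain_def)
    qed
    moreover have "vkos b ?D \<tau> = 0\<^sub>v b" for \<tau> using vkos_diff[OF Lc Ec] E(2) by simp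
    ultimately obtain H where H: "vchain b (carrier_vec b) (Suc (Suc i)) H" "\<And>\<tau>. ?D \<tau> = vkos b H \<tau>"
      using vkos_exact_free[of b i ?D] by blast
    have Hc: "H \<tau> \<in> carrier_vec b" for \<tau> using H by (simp add: vchain_def)
    have "C \<tau> = vkos n (\<lambda>\<sigma>. A *\<^sub>v H \<sigma>) \<tau>" for \<tau>
    proof -
      have "vkos n (\<lambda>\<sigma>. A *\<^sub>v H \<sigma>) \<tau> = A *\<^sub>v ?D \<tau>" using vkos_mult[OF A Hc] H(2) by simp
      also have "\<dots> = A *\<^sub>v L \<tau> - A *\<^sub>v E \<tau>" by (rule mult_minus_distrib_mat_vec[OF A Lc Ec])
      also have "A *\<^sub>v E \<tau> = 0\<^sub>v n" by (rule mat_kernelD(2)[OF A EK])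
      finally show ?thesis using L(2) A Lc[of \<tau>] by simp
    qed
    moreover have "vchain n (mat_image A) (Suc (Suc i)) (\<lambda>\<sigma>. A *\<^sub>v H \<sigma>)" by (rule vchain_mult[OF A H(1)])
    ultimately show "\<exists>E. vchain n (mat_image A) (Suc (Suc i)) E \<and> (\<forall>\<tau>. C \<tau> = vkos n E \<tau>)" by blast
  qed
next
  assume k: "kex n (mat_image A) (Suc i)"
  show "bex b (mat_kernel A) i"
    unfolding bex_def
  proof (intro allI impI, elim conjE)
    fix U W assume U: "vchain b (mat_kernel A) i U" and W: "vchain b (carrier_vec b) (Suc i) W"
      and UW: "\<forall>\<tau>. U \<tau> = vkos b W \<tau>"
    have Wc: "W \<tau> \<in> carrier_vec b" for \<tau> using W by (simp add: vchain_def)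
    have "vchain n (mat_image A) (Suc i) (\<lambda>\<sigma>. A *\<^sub>v W \<sigma>)" by (rule vchain_mult[OF A W])
    moreover have "vkos n (\<lambda>\<sigma>. A *\<^sub>v W \<sigma>) \<tau> = 0\<^sub>v n" for \<tau>
    proof -
      have "U \<tau> \<in> mat_kernel A" using U by (simp add: vchain_def)
      then have "A *\<^sub>v U \<tau> = 0\<^sub>v n" by (rule mat_kernelD(2)[OF A])
      then show ?thesis using vkos_mult[where C = W, OF A Wc] UW by simp
    qed
    ultimately obtain N where N: "vchain n (mat_image A) (Suc (Suc i)) N" "\<And>\<tau>. A *\<^sub>v W \<tau> = vkos n N \<tau>"
      using k unfolding kex_def by blast
    obtain L where L: "vchain b (carrier_vec b) (Suc (Suc i)) L" "\<And>\<tau>. N \<tau> = A *\<^sub>v L \<tau>"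
      using lift_chain[OF A N(1)] by blast
    have Lc: "L \<tau> \<in> carrier_vec b" for \<tau> using L by (simp add: vchain_def)
    have "N = (\<lambda>\<sigma>. A *\<^sub>v L \<sigma>)" using L(2) by blast
    then have AW: "A *\<^sub>v W \<tau> = A *\<^sub>v vkos b L \<tau>" for \<tau> using N(2) vkos_mult[OF A Lc] by simp
    \<comment> \<open>Correcting \<open>W\<close> by a boundary keeps its own boundary
      \<open>U\<close> and moves it into the kernel.\<close>
    let ?E = "\<lambda>\<tau>. W \<tau> - vkos b L \<tau>"
    have "vchain b (mat_kernel A) (Suc i) ?E"
      unfolding vchain_def
    proof (intro conjI allI impI)
      fix \<tau>
      have "A *\<^sub>v ?E \<tau> = A *\<^sub>v W \<tau> - A *\<^sub>v vkos b L \<tau>" by (rule mult_minus_distrib_mat_vec[OF A Wc]) simp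
      then have "A *\<^sub>v ?E \<tau> = 0\<^sub>v n" using AW[of \<tau>] A by simp
      then show "?E \<tau> \<in> mat_kernel A" using A Wc by (intro mat_kernelI) auto
      assume "?E \<tau> \<noteq> 0\<^sub>v b"
      then have "W \<tau> \<noteq> 0\<^sub>v b \<or> vkos b L \<tau> \<noteq> 0\<^sub>v b" by auto
      then show "card \<tau> = Suc i" using W card_vkos[OF L(1)] by (auto simp: vchain_def)
    qed
    moreover have "U \<tau> = vkos b ?E \<tau>" for \<tau>
    proof -
      have "vkos b ?E \<tau> = vkos b W \<tau> - vkos b (vkos b L) \<tau>" by (rule vkos_diff[OF Wc]) simp
      then show ?thesis using UW by simp
    qed
    ultimately show "\<exists>E. vchain b (mat_kernel A) (Suc i) E \<and> (\<forall>\<tau>. U \<tau> = vkos b E \<tau>)" by blast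
  qed
qed

section \<open>Koszul homology in degree zero and constant terms\<close>

lemma const_coeff_kos:
  fixes c :: "'v::finite set \<Rightarrow> ('v, 'k::field) mpoly"
  shows "const_coeff (kos c \<tau>) = 0"
proof -
  have "const_coeff (indet v :: ('v, 'k) mpoly) = 0" for v :: 'v
  proof -
    have "Poly_Mapping.single v (1::nat) \<noteq> 0" by (metis lookup_single_eq lookup_zero zero_neq_one)
    then show ?thesis by (simp add: const_coeff_def indet_def lookup_single)
  qed
  then show ?thesis by (simp add: kos_def const_coeff_sum const_coeff_mult)
qed

text \<open>A polynomial without constant term lies in the ideal of all variables, the image of the
  first Koszul differential. Each monomial is divided by one chosen variable of its support, which
  is the homotopy \<open>hop\<close> in that degree.\<close>

lemma const_coeff_zero_kos:
  fixes p :: "('v::finite, 'k::field) mpoly"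
  assumes "const_coeff p = 0"
  obtains e where "\<And>\<tau>. e \<tau> \<noteq> 0 \<Longrightarrow> card \<tau> = 1" "p = kos e {}"
proof -
  define c :: "'v set \<Rightarrow> ('v, 'k) mpoly" where "c \<sigma> = (if \<sigma> = {} then p else 0)" for \<sigma>
  define g where "g a = (if a = 0 then (\<lambda>_. 0) else hop (SOME v. v \<in> keys a) (mdeg a c))" for a
  have mc: "mdeg a c \<sigma> = (if \<sigma> = {} then lookup p a else 0)" for a \<sigma>
    by (auto simp: mdeg_def c_def ple_expo)
  have some: "(SOME v. v \<in> keys a) \<in> keys a" if "a \<noteq> 0" for a :: "'v \<Rightarrow>\<^sub>0 nat"
  proof -
    have "keys a \<noteq> {}" using that by simp
    then show ?thesis by (simp add: some_in_eq)
  qed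
  have g: "a \<in> keys p \<and> card \<tau> = 1 \<and> ple (expo \<tau>) a" if nz: "g a \<tau> \<noteq> 0" for a \<tau>
  proof -
    have a: "a \<noteq> 0" using nz by (auto simp: g_def)
    define v where "v = (SOME v. v \<in> keys a)"
    have h: "hop v (mdeg a c) \<tau> \<noteq> 0" using nz a by (simp add: g_def v_def)
    then have "v \<in> \<tau>" "mdeg a c (\<tau> - {v}) \<noteq> 0" using hop_nonzeroD by blast+
    then have "\<tau> = {v}" "lookup p a \<noteq> 0" by (auto simp: mc split: if_splits)
    then show ?thesis using some[OF a] by (auto simp: v_def ple_expo in_keys_iff)
  qed
  have "finite {a. \<exists>\<tau>. g a \<tau> \<noteq> 0}" by (rule finite_subset[of _ "keys p"]) (use g in auto)
  then obtain e where e: "\<And>a \<tau>. mdeg a e \<tau> = g a \<tau>" using mdeg_assemble[of g] g by blast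
  have "e \<tau> \<noteq> 0 \<Longrightarrow> card \<tau> = 1" for \<tau>
  proof -
    assume "e \<tau> \<noteq> 0"
    then obtain m where "lookup (e \<tau>) m \<noteq> 0" by (metis lookup_zero poly_mapping_eqI)
    then have "g (m + expo \<tau>) \<tau> \<noteq> 0" using e[of "m + expo \<tau>" \<tau>] by simp
    then show "card \<tau> = 1" using g by blast
  qed
  moreover have "p = kos e {}"
  proof (rule poly_mapping_eqI)
    fix m
    have me: "mdeg m e = g m" using e by blast
    have "lookup (kos e {}) m = mdeg m (kos e) {}" using mdeg_shift[of m "{}" "kos e"] by simp
    also have "\<dots> = bd (g m) {}" by (simp add: mdeg_kos me)
    also have "\<dots> = lookup p m"
    proof (cases "m = 0")
      case True
      then show ?thesis using assms by (simp add: g_def const_coeff_def)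
    next
      case False
      have "bd (g m) {} + hop (SOME v. v \<in> keys m) (bd (mdeg m c)) {} = mdeg m c {}"
        using False by (simp add: g_def bd_hop)
      then show ?thesis by (simp add: hop_def mc)
    qed
    finally show "lookup p m = lookup (kos e {}) m" by simp
  qed
  ultimately show ?thesis by (rule that)
qed

lemma cvec_zero_vkos:
  fixes w :: "('v::finite, 'k::field) mpoly vec"
  assumes w: "w \<in> carrier_vec n" and z: "cvec w = 0\<^sub>v n"
  obtains E where "vchain n (carrier_vec n) (Suc 0) E" "w = vkos n E {}"
proof -
  have ex: "\<exists>e :: 'v set \<Rightarrow> ('v, 'k) mpoly. (\<forall>\<tau>. e \<tau> \<noteq> 0 \<longrightarrow> card \<tau> = Suc 0) \<and> (\<forall>\<tau>\<in>{{}}. w $ j = kos e \<tau>)"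
    if j: "j < n" for j
  proof -
    have "const_coeff (w $ j) = cvec w $ j" using w j by simp
    then have "const_coeff (w $ j) = 0" using z j by simp
    then obtain e where "\<And>\<tau>. e \<tau> \<noteq> 0 \<Longrightarrow> card \<tau> = 1" "w $ j = kos e {}"
      by (rule const_coeff_zero_kos) blast
    then show ?thesis by (intro exI[of _ e]) simp
  qed
  show ?thesis
  proof (rule vkos_assemble[OF w ex])
    fix E assume "vchain n (carrier_vec n) (Suc 0) E" "\<And>\<tau>. \<tau> \<in> {{}} \<Longrightarrow> w = vkos n E \<tau>"
    then show thesis by (intro that[of E]) simp_all
  qed
qed

lemma cvec_vkos: "cvec (vkos n E \<tau>) = 0\<^sub>v n"
  by (rule eq_vecI) (simp_all add: vkos_def const_coeff_kos)

definition at_empty :: "nat \<Rightarrow> ('v, 'k::field) mpoly vec \<Rightarrow> 'v set \<Rightarrow> ('v, 'k) mpoly vec" where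
  "at_empty n w \<tau> = (if \<tau> = {} then w else 0\<^sub>v n)"

lemma degree_zero_chain:
  assumes "vchain n N 0 C"
  shows "C = at_empty n (C {})"
proof
  fix \<tau> :: "'a::finite set"
  show "C \<tau> = at_empty n (C {}) \<tau>" using assms by (auto simp: vchain_def at_empty_def)
qed

text \<open>In degree zero the boundaries are the sums of variables times elements of the image,
  i.e. the values of \<open>A\<close> on vectors without constant terms.\<close>

lemma mat_image_boundary_iff:
  fixes A :: "('v::finite, 'k::field) mpoly mat"
  assumes A: "A \<in> carrier_mat n b" and w: "w \<in> carrier_vec n"
  shows "(\<exists>E. vchain n (mat_image A) (Suc 0) E \<and> (\<forall>\<tau>. at_empty n w \<tau> = vkos n E \<tau>)) \<longleftrightarrow>
    (\<exists>t\<in>carrier_vec b. cvec t = 0\<^sub>v b \<and> w = A *\<^sub>v t)"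
proof
  assume "\<exists>E. vchain n (mat_image A) (Suc 0) E \<and> (\<forall>\<tau>. at_empty n w \<tau> = vkos n E \<tau>)"
  then obtain E where E: "vchain n (mat_image A) (Suc 0) E" "\<And>\<tau>. at_empty n w \<tau> = vkos n E \<tau>" by blast
  obtain L where L: "vchain b (carrier_vec b) (Suc 0) L" "\<And>\<tau>. E \<tau> = A *\<^sub>v L \<tau>"
    using lift_chain[OF A E(1)] by blast
  have Lc: "L \<tau> \<in> carrier_vec b" for \<tau> using L by (simp add: vchain_def)
  have EL: "E = (\<lambda>\<sigma>. A *\<^sub>v L \<sigma>)" using L(2) by blast
  have "w = vkos n E {}" using E(2)[of "{}"] by (simp add: at_empty_def)
  also have "\<dots> = A *\<^sub>v vkos b L {}" unfolding EL by (rule vkos_mult[OF A Lc])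
  finally show "\<exists>t\<in>carrier_vec b. cvec t = 0\<^sub>v b \<and> w = A *\<^sub>v t"
    by (intro bexI[of _ "vkos b L {}"] conjI cvec_vkos vkos_carrier)
next
  assume "\<exists>t\<in>carrier_vec b. cvec t = 0\<^sub>v b \<and> w = A *\<^sub>v t"
  then obtain t where t: "t \<in> carrier_vec b" "cvec t = 0\<^sub>v b" "w = A *\<^sub>v t" by blast
  obtain L where L: "vchain b (carrier_vec b) (Suc 0) L" "t = vkos b L {}"
    using cvec_zero_vkos[OF t(1,2)] by blast
  have Lc: "L \<tau> \<in> carrier_vec b" for \<tau> using L by (simp add: vchain_def)
  let ?E = "\<lambda>\<sigma>. A *\<^sub>v L \<sigma>"
  have E: "vchain n (mat_image A) (Suc 0) ?E" by (rule vchain_mult[OF A L(1)])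
  then have E': "vchain n (carrier_vec n) (Suc 0) ?E" using A Lc by (auto simp: vchain_def)
  have "at_empty n w \<tau> = vkos n ?E \<tau>" for \<tau>
  proof (cases "\<tau> = {}")
    case True
    then show ?thesis using vkos_mult[OF A Lc] t(3) L(2) by (simp add: at_empty_def)
  next
    case False
    then have "vkos n ?E \<tau> = 0\<^sub>v n" using card_vkos[OF E', of \<tau>] by auto
    then show ?thesis using False by (simp add: at_empty_def)
  qed
  then show "\<exists>E. vchain n (mat_image A) (Suc 0) E \<and> (\<forall>\<tau>. at_empty n w \<tau> = vkos n E \<tau>)" using E by blast
qed

lemma vchain_at_empty:
  assumes "w \<in> N" "0\<^sub>v n \<in> N"
  shows "vchain n N 0 (at_empty n w)"
  using assms by (auto simp: vchain_def at_empty_def)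

lemma vkos_degree_zero:
  assumes "vchain n (carrier_vec n) 0 C"
  shows "vkos n C \<tau> = 0\<^sub>v n"
proof (rule ccontr)
  assume "vkos n C \<tau> \<noteq> 0\<^sub>v n"
  then obtain v where "v \<notin> \<tau>" "C (insert v \<tau>) \<noteq> 0\<^sub>v n"
    by (rule vkos_nonzeroE) (use assms in \<open>auto simp: vchain_def\<close>)
  then show False using assms by (auto simp: vchain_def)
qed

lemma mat_image_carrier: "A \<in> carrier_mat n b \<Longrightarrow> mat_image A \<subseteq> carrier_vec n"
  by (auto simp: mat_image_def)

lemma zero_in_mat_image:
  assumes A: "A \<in> carrier_mat n b"
  shows "0\<^sub>v n \<in> mat_image A"
proof -
  have "A *\<^sub>v 0\<^sub>v b = 0\<^sub>v n" using A by (intro eq_vecI) auto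
  then show ?thesis using mat_imageI[OF A zero_carrier_vec] by simp
qed

text \<open>The predicate \<open>Q\<close> selects the cycles to be filled: all of them for
  \<open>kex\<close>, and for \<open>bex\<close> those that bound in the free module, i.e. have no
  constant terms.\<close>

lemma degree_zero_exact_iff:
  fixes A :: "('v::finite, 'k::field) mpoly mat"
  assumes A: "A \<in> carrier_mat n b"
  shows "(\<forall>C. vchain n (mat_image A) 0 C \<and> Q (C {}) \<longrightarrow>
      (\<exists>E. vchain n (mat_image A) (Suc 0) E \<and> (\<forall>\<tau>. C \<tau> = vkos n E \<tau>))) \<longleftrightarrow>
    (\<forall>v\<in>carrier_vec b. Q (A *\<^sub>v v) \<longrightarrow> (\<exists>t\<in>carrier_vec b. cvec t = 0\<^sub>v b \<and> A *\<^sub>v v = A *\<^sub>v t))"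
    (is "?l \<longleftrightarrow> ?r")
proof
  assume l: ?l
  show ?r
  proof (intro ballI impI)
    fix v :: "('v, 'k) mpoly vec" assume v: "v \<in> carrier_vec b" and Q: "Q (A *\<^sub>v v)"
    have w: "A *\<^sub>v v \<in> mat_image A" by (rule mat_imageI[OF A v])
    have "vchain n (mat_image A) 0 (at_empty n (A *\<^sub>v v))" by (rule vchain_at_empty[OF w zero_in_mat_image[OF A]])
    moreover have "Q (at_empty n (A *\<^sub>v v) {})" using Q by (simp add: at_empty_def)
    ultimately have "\<exists>E. vchain n (mat_image A) (Suc 0) E \<and> (\<forall>\<tau>. at_empty n (A *\<^sub>v v) \<tau> = vkos n E \<tau>)"
      using l by blast
    then show "\<exists>t\<in>carrier_vec b. cvec t = 0\<^sub>v b \<and> A *\<^sub>v v = A *\<^sub>v t"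
      using mat_image_boundary_iff[OF A] w mat_image_carrier[OF A] by blast
  qed
next
  assume r: ?r
  show ?l
  proof (intro allI impI, elim conjE)
    fix C assume C: "vchain n (mat_image A) 0 C" and Q: "Q (C {})"
    have w: "C {} \<in> mat_image A" using C by (simp add: vchain_def)
    then obtain v where v: "v \<in> carrier_vec b" "C {} = A *\<^sub>v v" by (rule mat_imageE[OF _ A])
    then have "\<exists>t\<in>carrier_vec b. cvec t = 0\<^sub>v b \<and> C {} = A *\<^sub>v t" using r Q by simp
    then have "\<exists>E. vchain n (mat_image A) (Suc 0) E \<and> (\<forall>\<tau>. at_empty n (C {}) \<tau> = vkos n E \<tau>)"
      using mat_image_boundary_iff[OF A] w mat_image_carrier[OF A] by blast
    then show "\<exists>E. vchain n (mat_image A) (Suc 0) E \<and> (\<forall>\<tau>. C \<tau> = vkos n E \<tau>)"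
      unfolding degree_zero_chain[OF C, symmetric] .
  qed
qed

lemma vchain_mat_image_carrier:
  "A \<in> carrier_mat n b \<Longrightarrow> vchain n (mat_image A) i C \<Longrightarrow> vchain n (carrier_vec n) i C"
  using mat_image_carrier unfolding vchain_def by blast

lemma kex_zero_iff:
  fixes A :: "('v::finite, 'k::field) mpoly mat"
  assumes A: "A \<in> carrier_mat n b"
  shows "kex n (mat_image A) 0 \<longleftrightarrow>
    (\<forall>v\<in>carrier_vec b. True \<longrightarrow> (\<exists>t\<in>carrier_vec b. cvec t = 0\<^sub>v b \<and> A *\<^sub>v v = A *\<^sub>v t))"
proof -
  have "vchain n (mat_image A) 0 C \<and> (\<forall>\<tau>. vkos n C \<tau> = 0\<^sub>v n) \<longleftrightarrow> vchain n (mat_image A) 0 C \<and> True"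
    for C :: "'v set \<Rightarrow> ('v, 'k) mpoly vec"
    using vkos_degree_zero[OF vchain_mat_image_carrier[OF A]] by blast
  then show ?thesis
    unfolding kex_def by (simp only: degree_zero_exact_iff[OF A, where Q = "\<lambda>_. True"])
qed

lemma bex_zero_iff:
  fixes A :: "('v::finite, 'k::field) mpoly mat"
  assumes A: "A \<in> carrier_mat n b"
  shows "bex n (mat_image A) 0 \<longleftrightarrow>
    (\<forall>v\<in>carrier_vec b. cmat A *\<^sub>v cvec v = 0\<^sub>v n \<longrightarrow> (\<exists>t\<in>carrier_vec b. cvec t = 0\<^sub>v b \<and> A *\<^sub>v v = A *\<^sub>v t))"
proof -
  have bd_iff: "(\<exists>E'. vchain n (carrier_vec n) (Suc 0) E' \<and> (\<forall>\<tau>. C \<tau> = vkos n E' \<tau>)) \<longleftrightarrow> cvec (C {}) = 0\<^sub>v n"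
    if "vchain n (mat_image A) 0 C" for C :: "'v set \<Rightarrow> ('v, 'k) mpoly vec"
  proof
    assume "\<exists>E'. vchain n (carrier_vec n) (Suc 0) E' \<and> (\<forall>\<tau>. C \<tau> = vkos n E' \<tau>)"
    then obtain E' where "C {} = vkos n E' {}" by blast
    then show "cvec (C {}) = 0\<^sub>v n" by (simp only: cvec_vkos)
  next
    have C: "vchain n (carrier_vec n) 0 C" by (rule vchain_mat_image_carrier[OF A that])
    then have "C {} \<in> carrier_vec n" by (simp add: vchain_def)
    moreover assume "cvec (C {}) = 0\<^sub>v n"
    ultimately obtain E where E: "vchain n (carrier_vec n) (Suc 0) E" "C {} = vkos n E {}"
      using cvec_zero_vkos by blast
    have "C \<tau> = vkos n E \<tau>" for \<tau>
    proof (cases "\<tau> = {}")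
      case False
      then have "C \<tau> = 0\<^sub>v n" "vkos n E \<tau> = 0\<^sub>v n" using C card_vkos[OF E(1), of \<tau>] by (auto simp: vchain_def)
      then show ?thesis by simp
    qed (simp add: E(2))
    then show "\<exists>E'. vchain n (carrier_vec n) (Suc 0) E' \<and> (\<forall>\<tau>. C \<tau> = vkos n E' \<tau>)"
      using E(1) by blast
  qed
  have "bex n (mat_image A) 0 \<longleftrightarrow> (\<forall>C. vchain n (mat_image A) 0 C \<and> cvec (C {}) = 0\<^sub>v n \<longrightarrow>
      (\<exists>E. vchain n (mat_image A) (Suc 0) E \<and> (\<forall>\<tau>. C \<tau> = vkos n E \<tau>)))"
    unfolding bex_def using bd_iff by blast
  also have "\<dots> \<longleftrightarrow> (\<forall>v\<in>carrier_vec b. cvec (A *\<^sub>v v) = 0\<^sub>v n \<longrightarrow>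
      (\<exists>t\<in>carrier_vec b. cvec t = 0\<^sub>v b \<and> A *\<^sub>v v = A *\<^sub>v t))"
    by (rule degree_zero_exact_iff[OF A])
  finally show ?thesis using cvec_mult[OF A] by simp
qed

text \<open>Dimension shifting moves degree i of the ideal to degree 0 of the image of
  \<open>D i\<close>, where Koszul homology is read off from constant terms. This holds for any
  resolution, minimal or not.\<close>

lemma resolution_homology_iff:
  fixes D :: "nat \<Rightarrow> ('v::finite, 'k::field) mpoly mat"
  assumes D: "free_resolution D I"
  shows "kernel_dim (residue_differential D i) - mat_rank (residue_differential D (Suc i)) \<noteq> 0 \<longleftrightarrow>
    \<not> kex 1 (mat_image (D 0)) i"
proof -
  let ?n = "\<lambda>i. dim_row (D i)" and ?b = "\<lambda>i. dim_col (D i)"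
  have n0: "?n 0 = 1" and nS: "\<And>i. ?n (Suc i) = ?b i" and ker: "\<And>i. mat_kernel (D i) = mat_image (D (Suc i))"
    using D by (auto simp: free_resolution_def)
  have Dc: "D i \<in> carrier_mat (?n i) (?b i)" for i by simp
  have DS: "D (Suc i) \<in> carrier_mat (?b i) (?b (Suc i))" for i using nS by auto
  \<comment> \<open>The chain of shifts ends in \<open>bex\<close>, because in degree zero a cycle
    need not bound in the free module.\<close>
  have shift: "kex (?n j) (mat_image (D j)) (Suc k) \<longleftrightarrow> bex (?n (Suc (j + k))) (mat_image (D (Suc (j + k)))) 0" for j k
  proof (induction k arbitrary: j)
    case 0
    show ?case using dimension_shift[OF Dc, of j 0] by (simp add: ker nS)
  next
    case (Suc k)
    have "kex (?n j) (mat_image (D j)) (Suc (Suc k)) \<longleftrightarrow> bex (?b j) (mat_kernel (D j)) (Suc k)"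
      by (rule dimension_shift[OF Dc])
    also have "\<dots> \<longleftrightarrow> kex (?b j) (mat_kernel (D j)) (Suc k)"
      by (rule bex_eq_kex[OF mat_kernel_carrier[OF Dc]])
    also have "\<dots> \<longleftrightarrow> kex (?n (Suc j)) (mat_image (D (Suc j))) (Suc k)" by (simp add: ker nS)
    also have "\<dots> \<longleftrightarrow> bex (?n (Suc (Suc j + k))) (mat_image (D (Suc (Suc j + k)))) 0" by (rule Suc.IH)
    finally show ?case by simp
  qed
  define R where "R = residue_differential D i"
  \<comment> \<open>The augmentation is dropped, so in degree zero every vector is a cycle.\<close>
  define \<Phi> where "\<Phi> u = (if i = 0 then True else cmat (D i) *\<^sub>v u = 0\<^sub>v (?n i))" for u
  have Rc: "R \<in> carrier_mat (dim_row R) (?b i)" by (auto simp: R_def residue_differential_def)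
  have RS: "residue_differential D (Suc i) = cmat (D (Suc i))" by (simp add: residue_differential_def)
  have cS: "cmat (D (Suc i)) \<in> carrier_mat (?b i) (?b (Suc i))" using DS by simp
  have kerR: "mat_kernel R = {u \<in> carrier_vec (?b i). \<Phi> u}"
  proof (cases i)
    case 0
    then show ?thesis by (auto simp: R_def residue_differential_def \<Phi>_def mat_kernel_def)
  next
    case (Suc k)
    then show ?thesis by (auto simp: R_def residue_differential_def \<Phi>_def mat_kernel_def)
  qed
  have sub: "mat_image (cmat (D (Suc i))) \<subseteq> mat_kernel R"
  proof
    fix u assume "u \<in> mat_image (cmat (D (Suc i)))"
    then obtain y where y: "y \<in> carrier_vec (?b (Suc i))" "u = cmat (D (Suc i)) *\<^sub>v y"
      by (rule mat_imageE[OF _ cS])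
    have ly: "lift_vec y \<in> carrier_vec (?b (Suc i))" using y by simp
    let ?w = "D (Suc i) *\<^sub>v lift_vec y"
    have "?w \<in> mat_kernel (D i)" unfolding ker by (rule mat_imageI[OF DS ly])
    then have w: "?w \<in> carrier_vec (?b i)" "D i *\<^sub>v ?w = 0\<^sub>v (?n i)" using mat_kernelD[OF Dc] by blast+
    have u: "u = cvec ?w" using cvec_mult[OF DS ly] y by simp
    have "cmat (D i) *\<^sub>v u = cvec (D i *\<^sub>v ?w)" unfolding u by (rule cvec_mult[OF Dc w(1), symmetric])
    also have "\<dots> = 0\<^sub>v (?n i)" unfolding w(2) by (rule eq_vecI) (simp_all add: const_coeff_def)
    finally show "u \<in> mat_kernel R" unfolding kerR using w(1) u by (simp add: \<Phi>_def)
  qed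
  have "kernel_dim R - mat_rank (cmat (D (Suc i))) \<noteq> 0 \<longleftrightarrow> mat_kernel R \<noteq> mat_image (cmat (D (Suc i)))"
    by (rule kernel_dim_minus_rank[OF Rc cS sub])
  also have "\<dots> \<longleftrightarrow> \<not> (\<forall>u\<in>carrier_vec (?b i). \<Phi> u \<longrightarrow> u \<in> mat_image (cmat (D (Suc i))))"
    using sub unfolding kerR by blast
  also have "\<dots> \<longleftrightarrow> \<not> (\<forall>v\<in>carrier_vec (?b i). \<Phi> (cvec v) \<longrightarrow>
      (\<exists>t\<in>carrier_vec (?b i). cvec t = 0\<^sub>v (?b i) \<and> D i *\<^sub>v v = D i *\<^sub>v t))"
    by (subst residue_exact_iff[OF Dc DS ker]) (rule refl)
  also have "\<dots> \<longleftrightarrow> \<not> kex 1 (mat_image (D 0)) i"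
  proof (cases i)
    case 0
    then show ?thesis using kex_zero_iff[OF Dc, of 0] n0 by (simp add: \<Phi>_def)
  next
    case (Suc k)
    then show ?thesis using shift[of 0 k] bex_zero_iff[OF Dc, of i] n0 by (simp add: \<Phi>_def)
  qed
  finally show ?thesis by (simp add: R_def RS)
qed

lemma kex_ideal_iff:
  fixes N :: "('v::finite, 'k::field) mpoly vec set"
  assumes N: "N \<subseteq> carrier_vec 1" and I: "(\<lambda>w. w $ 0) ` N = {p. keys p \<subseteq> M}"
  shows "kex 1 N i \<longleftrightarrow> kos_exact TYPE('k) M i"
proof -
  have NM: "w \<in> N \<longleftrightarrow> keys (w $ 0) \<subseteq> M" if w: "w \<in> carrier_vec 1" for w
  proof
    assume "keys (w $ 0) \<subseteq> M"
    then have "w $ 0 \<in> (\<lambda>w. w $ 0) ` N" unfolding I by simp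
    then obtain w' where "w' \<in> N" "w $ 0 = w' $ 0" by blast
    moreover from this have "w = w'" using w N by (intro eq_vecI) auto
    ultimately show "w \<in> N" by simp
  qed (use I in blast)
  have vc: "vchain 1 N j (\<lambda>\<tau>. vec 1 (\<lambda>_. c \<tau>)) \<longleftrightarrow>
      (\<forall>\<tau>. keys (c \<tau>) \<subseteq> M) \<and> (\<forall>\<tau>. c \<tau> \<noteq> 0 \<longrightarrow> card \<tau> = j)" for c :: "'v set \<Rightarrow> ('v, 'k) mpoly" and j
  proof -
    have "vec 1 (\<lambda>_. c \<tau>) = 0\<^sub>v 1 \<longleftrightarrow> c \<tau> = 0" for \<tau> by (auto simp: vec_eq_iff)
    then show ?thesis by (simp add: vchain_def NM)
  qed
  have vk: "vkos 1 (\<lambda>\<tau>. vec 1 (\<lambda>_. c \<tau>)) \<tau> = vec 1 (\<lambda>_. kos c \<tau>)" for c :: "'v set \<Rightarrow> ('v, 'k) mpoly" and \<tau>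
    by (rule eq_vecI) (simp_all add: vkos_def)
  have eq: "vec 1 (\<lambda>_. p) = vec 1 (\<lambda>_. q) \<longleftrightarrow> p = q" for p q :: "('v, 'k) mpoly" by (auto simp: vec_eq_iff)
  have rep: "C = (\<lambda>\<tau>. vec 1 (\<lambda>_. C \<tau> $ 0))" if "vchain 1 N j C" for C j
  proof (rule ext)
    fix \<tau>
    have "C \<tau> \<in> carrier_vec 1" using that N by (auto simp: vchain_def)
    then show "C \<tau> = vec 1 (\<lambda>_. C \<tau> $ 0)" by (intro eq_vecI) auto
  qed
  show ?thesis
  proof
    assume k: "kex 1 N i"
    show "kos_exact TYPE('k) M i" unfolding kos_exact_def
    proof (intro allI impI, elim conjE)
      fix c :: "'v set \<Rightarrow> ('v, 'k) mpoly"
      assume c: "\<forall>\<tau>. keys (c \<tau>) \<subseteq> M" "\<forall>\<tau>. c \<tau> \<noteq> 0 \<longrightarrow> card \<tau> = i" "\<forall>\<tau>. kos c \<tau> = 0"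
      let ?C = "\<lambda>\<tau>. vec 1 (\<lambda>_. c \<tau>)"
      have "vkos 1 ?C \<tau> = 0\<^sub>v 1" for \<tau> unfolding vk using c(3) by (auto simp: vec_eq_iff)
      then obtain E where E: "vchain 1 N (Suc i) E" "\<And>\<tau>. ?C \<tau> = vkos 1 E \<tau>"
        using k vc[of i c] c unfolding kex_def by blast
      define e where "e \<tau> = E \<tau> $ 0" for \<tau>
      have Ee: "E = (\<lambda>\<tau>. vec 1 (\<lambda>_. e \<tau>))" using rep[OF E(1)] by (simp add: e_def)
      show "\<exists>e. (\<forall>\<tau>. keys (e \<tau>) \<subseteq> M) \<and> (\<forall>\<tau>. e \<tau> \<noteq> 0 \<longrightarrow> card \<tau> = Suc i) \<and> (\<forall>\<tau>. c \<tau> = kos e \<tau>)"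
        using E unfolding Ee vc vk eq by blast
    qed
  next
    assume k: "kos_exact TYPE('k) M i"
    show "kex 1 N i" unfolding kex_def
    proof (intro allI impI, elim conjE)
      fix C assume C: "vchain 1 N i C" "\<forall>\<tau>. vkos 1 C \<tau> = 0\<^sub>v 1"
      define c where "c \<tau> = C \<tau> $ 0" for \<tau>
      have Cc: "C = (\<lambda>\<tau>. vec 1 (\<lambda>_. c \<tau>))" using rep[OF C(1)] by (simp add: c_def)
      have "kos c \<tau> = 0" for \<tau>
        using C(2) unfolding Cc vk by (auto simp: vec_eq_iff)
      then obtain e where e: "\<forall>\<tau>. keys (e \<tau>) \<subseteq> M" "\<forall>\<tau>. e \<tau> \<noteq> 0 \<longrightarrow> card \<tau> = Suc i" "\<forall>\<tau>. c \<tau> = kos e \<tau>"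
        using k C(1) unfolding kos_exact_def Cc vc by blast
      show "\<exists>E. vchain 1 N (Suc i) E \<and> (\<forall>\<tau>. C \<tau> = vkos 1 E \<tau>)"
        unfolding Cc using e vc[of "Suc i" e] vk[of e] by (intro exI[of _ "\<lambda>\<tau>. vec 1 (\<lambda>_. e \<tau>)"]) auto
    qed
  qed
qed

text \<open>The choice in \<open>betti\<close> is meaningful only if a resolution exists, hence
  \<open>res\<close>; the criterion obtained no longer refers to it.\<close>

theorem betti_nonzero_iff:
  fixes I :: "('v::finite, 'k::field) mpoly set"
  assumes res: "\<exists>D. free_resolution D I" and I: "I = {p. keys p \<subseteq> M}"
  shows "betti I i \<noteq> 0 \<longleftrightarrow> \<not> kos_exact TYPE('k) M i"
proof -
  define D where "D = (SOME D. free_resolution D I)"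
  have D: "free_resolution D I" unfolding D_def by (rule someI_ex[OF res])
  have "D 0 \<in> carrier_mat 1 (dim_col (D 0))" using D by (intro carrier_matI) (auto simp: free_resolution_def)
  then have N: "mat_image (D 0) \<subseteq> carrier_vec 1" by (rule mat_image_carrier)
  have N': "(\<lambda>w. w $ 0) ` mat_image (D 0) = {p. keys p \<subseteq> M}"
    using D I by (simp add: free_resolution_def)
  have "betti I i = kernel_dim (residue_differential D i) - mat_rank (residue_differential D (Suc i))"
    by (simp add: betti_def D_def Let_def)
  then show ?thesis using resolution_homology_iff[OF D, of i] kex_ideal_iff[OF N N', of i] by simp
qed

section \<open>Free resolutions of monomial ideals\<close>

text \<open>A matrix is homogeneous for multidegrees \<open>r\<close> of the rows and \<open>c\<close> of the columns if the
  entry at \<open>(i, j)\<close> is a scalar multiple of the monomial with exponent \<open>c j - r i\<close>.\<close>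

definition hom_mat :: "(nat \<Rightarrow> 'v \<Rightarrow>\<^sub>0 nat) \<Rightarrow> (nat \<Rightarrow> 'v \<Rightarrow>\<^sub>0 nat) \<Rightarrow> ('v, 'k::field) mpoly mat \<Rightarrow> bool" where
  "hom_mat r c A \<longleftrightarrow> (\<forall>i<dim_row A. \<forall>j<dim_col A. \<forall>d\<in>keys (A $$ (i, j)). c j = d + r i)"

lemma hom_matD:
  assumes "hom_mat r c A" "A \<in> carrier_mat n b" "i < n" "j < b" "d \<in> keys (A $$ (i, j))"
  shows "c j = d + r i"
proof -
  have "i < dim_row A" "j < dim_col A" using assms by auto
  then show ?thesis using assms(1,5) unfolding hom_mat_def by blast
qed

lemma single_if_keys:
  assumes "keys p \<subseteq> {d}"
  shows "p = Poly_Mapping.single d (lookup p d)"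
  using assms by (intro poly_mapping_eqI) (auto simp: lookup_single when_def in_keys_iff)

lemma ple_trans: "ple m n \<Longrightarrow> ple n p \<Longrightarrow> ple m p"
  unfolding ple_def using order_trans by blast

text \<open>The inserted \<open>0\<close> gives the empty set the exponent zero.\<close>

definition lcm_exp :: "(nat \<Rightarrow> 'v::finite \<Rightarrow>\<^sub>0 nat) \<Rightarrow> nat set \<Rightarrow> 'v \<Rightarrow>\<^sub>0 nat" where
  "lcm_exp c \<sigma> = Abs_poly_mapping (\<lambda>x. Max (insert 0 ((\<lambda>j. lookup (c j) x) ` \<sigma>)))"

lemma lookup_lcm_exp: "lookup (lcm_exp c \<sigma>) x = Max (insert 0 ((\<lambda>j. lookup (c j) x) ` \<sigma>))"
  by (simp add: lcm_exp_def)

lemma ple_lcm_exp: "finite \<sigma> \<Longrightarrow> j \<in> \<sigma> \<Longrightarrow> ple (c j) (lcm_exp c \<sigma>)"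
  by (simp add: ple_def lookup_lcm_exp)

lemma lcm_exp_ple: "finite \<sigma> \<Longrightarrow> (\<And>j. j \<in> \<sigma> \<Longrightarrow> ple (c j) a) \<Longrightarrow> ple (lcm_exp c \<sigma>) a"
  by (auto simp: ple_def lookup_lcm_exp)

lemma sum_nth_distinct:
  assumes "distinct gs"
  shows "(\<Sum>k<length gs. f (gs ! k)) = sum f (set gs)"
  using sum.reindex_bij_betw[OF bij_betw_nth[OF assms refl refl], of f] by (simp add: lessThan_atLeast0)

lemma mult_mat_vec_index:
  assumes "A \<in> carrier_mat n b" "v \<in> carrier_vec b" "i < n"
  shows "(A *\<^sub>v v) $ i = (\<Sum>j<b. A $$ (i, j) * v $ j)"
  using assms by (auto simp: scalar_prod_def lessThan_atLeast0)

lemma single_sum: "Poly_Mapping.single d (sum f J) = (\<Sum>j\<in>J. Poly_Mapping.single d (f j))"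
  by (rule poly_mapping_eqI) (simp add: lookup_sum lookup_single when_def)

text \<open>In multidegree \<open>a\<close> the kernel is a scalar kernel on the columns whose
  degree divides \<open>a\<close>. It depends on \<open>a\<close> only through the set
  \<open>\<sigma>\<close> of these columns, so finitely many scalar kernels suffice. Their
  generators are placed in degree \<open>lcm_exp c \<sigma>\<close>, the smallest divisible by all
  these columns. The result is finite but in general not minimal.\<close>

lemma hom_mat_kernel:
  fixes A :: "('v::finite, 'k::field) mpoly mat"
  assumes A: "A \<in> carrier_mat n b" and hom: "hom_mat r c A"
  obtains B b' c' where "B \<in> carrier_mat b b'" "hom_mat c c' B" "mat_kernel A = mat_image B"
proof -
  define l where "l i j = lookup (A $$ (i, j)) (c j - r i)" for i j
  have Aij: "A $$ (i, j) = Poly_Mapping.single (c j - r i) (l i j)" if "i < n" "j < b" for i j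
    unfolding l_def
  proof (rule single_if_keys, rule subsetI)
    fix d assume "d \<in> keys (A $$ (i, j))"
    then have "c j = d + r i" by (rule hom_matD[OF hom A that])
    then show "d \<in> {c j - r i}" by simp
  qed
  have lr: "ple (r i) (c j)" if "i < n" "j < b" "l i j \<noteq> 0" for i j
  proof -
    have "c j - r i \<in> keys (A $$ (i, j))" using that by (simp add: l_def in_keys_iff)
    then have eq: "c j = (c j - r i) + r i" by (rule hom_matD[OF hom A that(1,2)])
    show ?thesis by (subst eq) (rule ple_add(1))
  qed
  \<comment> \<open>The \<open>b\<close> additional rows force the coordinates outside
    \<open>\<sigma>\<close> to vanish, so that one matrix format serves all
    \<open>\<sigma>\<close>.\<close>
  define L where "L \<sigma> = mat (n + b) b (\<lambda>(i, j). if i < n then l i j else if i = n + j \<and> j \<notin> \<sigma> then 1 else 0)" for \<sigma>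
  have Lc: "L \<sigma> \<in> carrier_mat (n + b) b" for \<sigma> by (simp add: L_def)
  have kerL: "u \<in> mat_kernel (L \<sigma>) \<longleftrightarrow> u \<in> carrier_vec b \<and> (\<forall>j<b. j \<notin> \<sigma> \<longrightarrow> u $ j = 0) \<and>
      (\<forall>i<n. (\<Sum>j<b. l i j * u $ j) = 0)" (is "_ \<longleftrightarrow> ?r") for u \<sigma>
  proof -
    have row1: "(L \<sigma> *\<^sub>v u) $ i = (\<Sum>j<b. l i j * u $ j)" if "i < n" "u \<in> carrier_vec b" for i
      using mult_mat_vec_index[OF Lc that(2), of i] that(1) by (simp add: L_def)
    have row2: "(L \<sigma> *\<^sub>v u) $ (n + j) = (if j \<in> \<sigma> then 0 else u $ j)" if "j < b" "u \<in> carrier_vec b" for j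
    proof -
      have "(L \<sigma> *\<^sub>v u) $ (n + j) = (\<Sum>j'<b. L \<sigma> $$ (n + j, j') * u $ j')"
        by (rule mult_mat_vec_index[OF Lc that(2)]) (use that in simp)
      also have "\<dots> = (\<Sum>j'<b. if j' = j then (if j \<in> \<sigma> then 0 else u $ j) else 0)"
        by (rule sum.cong) (use that in \<open>auto simp: L_def\<close>)
      finally show ?thesis using that(1) by simp
    qed
    have "L \<sigma> *\<^sub>v u = 0\<^sub>v (n + b) \<longleftrightarrow> ?r" if u: "u \<in> carrier_vec b"
    proof
      assume z: "L \<sigma> *\<^sub>v u = 0\<^sub>v (n + b)"
      have "(\<Sum>j<b. l i j * u $ j) = 0" if "i < n" for i using row1[OF that u] z that by simp
      moreover have "u $ j = 0" if "j < b" "j \<notin> \<sigma>" for j using row2[OF that(1) u] z that by simp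
      ultimately show ?r using u by blast
    next
      assume r: ?r
      show "L \<sigma> *\<^sub>v u = 0\<^sub>v (n + b)"
      proof (rule eq_vecI)
        fix i assume i: "i < dim_vec (0\<^sub>v (n + b) :: 'k vec)"
        show "(L \<sigma> *\<^sub>v u) $ i = 0\<^sub>v (n + b) $ i"
        proof (cases "i < n")
          case True
          then show ?thesis using row1[OF True u] r by simp
        next
          case False
          then obtain j where "i = n + j" "j < b" using i by (metis add_diff_inverse_nat dim_vec index_zero_vec(2) nat_add_left_cancel_less)
          then show ?thesis using row2[OF _ u, of j] r by simp
        qed
      qed (simp add: L_def)
    qed
    then show ?thesis unfolding mat_kernel[OF Lc] by blast
  qed
  have "\<exists>Bm bm. Bm \<in> carrier_mat b bm \<and> mat_kernel (L \<sigma>) = mat_image Bm" for \<sigma>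
    using kernel_eq_image[OF Lc[of \<sigma>]] by metis
  then obtain Bm bm where Bm: "\<And>\<sigma>. Bm \<sigma> \<in> carrier_mat b (bm \<sigma>)" "\<And>\<sigma>. mat_kernel (L \<sigma>) = mat_image (Bm \<sigma>)"
    by metis
  have colker: "col (Bm \<sigma>) k \<in> mat_kernel (L \<sigma>)" if "k < bm \<sigma>" for \<sigma> k
  proof -
    have "col (Bm \<sigma>) k = Bm \<sigma> *\<^sub>v unit_vec (bm \<sigma>) k" using Bm(1)[of \<sigma>] that by (intro eq_vecI) auto
    then show ?thesis unfolding Bm(2) using mat_imageI[OF Bm(1)] by simp
  qed
  have col0: "Bm \<sigma> $$ (j, k) = 0" if "k < bm \<sigma>" "j < b" "j \<notin> \<sigma>" for \<sigma> j k
    using colker[OF that(1)] that Bm(1)[of \<sigma>] unfolding kerL by auto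
  have colsum: "(\<Sum>j<b. l i j * Bm \<sigma> $$ (j, k)) = 0" if "k < bm \<sigma>" "i < n" for \<sigma> i k
  proof -
    have "(\<Sum>j<b. l i j * col (Bm \<sigma>) k $ j) = 0" using colker[OF that(1)] that unfolding kerL by blast
    moreover have "col (Bm \<sigma>) k $ j = Bm \<sigma> $$ (j, k)" if "j < b" for j
      using that \<open>k < bm \<sigma>\<close> Bm(1)[of \<sigma>] by simp
    ultimately show ?thesis by simp
  qed
  \<comment> \<open>One column of \<open>B\<close> for each set of columns of \<open>A\<close> and
    each generator of its scalar kernel.\<close>
  let ?P = "SIGMA \<sigma>:Pow {..<b}. {..<bm \<sigma>}"
  have "finite ?P" by auto
  then obtain gs where gs: "set gs = ?P" "distinct gs" using finite_distinct_list by blast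
  let ?N = "length gs"
  define e where "e = (\<lambda>j (\<sigma>, k). Poly_Mapping.single (lcm_exp c \<sigma> - c j) (Bm \<sigma> $$ (j, k)))"
  define B where "B = mat b ?N (\<lambda>(j, m). e j (gs ! m))"
  define c' where "c' m = lcm_exp c (fst (gs ! m))" for m
  have Bc: "B \<in> carrier_mat b ?N" by (simp add: B_def)
  have gsP: "fst (gs ! m) \<subseteq> {..<b}" "snd (gs ! m) < bm (fst (gs ! m))" if "m < ?N" for m
    using nth_mem[OF that] unfolding gs(1) by auto
  have homB: "hom_mat c c' B"
    unfolding hom_mat_def
  proof (intro allI impI ballI)
    fix j m d assume j: "j < dim_row B" and m: "m < dim_col B" and d: "d \<in> keys (B $$ (j, m))"
    have jm: "j < b" "m < ?N" using j m Bc by auto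
    obtain \<sigma> k where g: "gs ! m = (\<sigma>, k)" by force
    have \<sigma>: "\<sigma> \<subseteq> {..<b}" "k < bm \<sigma>" using gsP[OF jm(2)] g by auto
    have "d \<in> keys (Poly_Mapping.single (lcm_exp c \<sigma> - c j) (Bm \<sigma> $$ (j, k)))"
      using d jm g by (simp add: B_def e_def)
    then have d: "d = lcm_exp c \<sigma> - c j" "Bm \<sigma> $$ (j, k) \<noteq> 0" by (auto split: if_splits)
    then have "j \<in> \<sigma>" using col0 \<sigma>(2) jm(1) by blast
    then have "ple (c j) (lcm_exp c \<sigma>)" using \<sigma>(1) by (intro ple_lcm_exp) (auto intro: finite_subset)
    then have "d + c j = lcm_exp c \<sigma>" unfolding d(1) by (rule ple_add_diff)
    then show "c' m = d + c j" by (simp add: c'_def g)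
  qed
  have colB: "A *\<^sub>v col B m = 0\<^sub>v n" if m: "m < ?N" for m
  proof (rule eq_vecI)
    fix i assume "i < dim_vec (0\<^sub>v n :: ('v, 'k) mpoly vec)"
    then have i: "i < n" by simp
    obtain \<sigma> k where g: "gs ! m = (\<sigma>, k)" by force
    have \<sigma>: "\<sigma> \<subseteq> {..<b}" "k < bm \<sigma>" using gsP[OF m] g by auto
    have "(A *\<^sub>v col B m) $ i = (\<Sum>j<b. A $$ (i, j) * col B m $ j)"
      using Bc m by (intro mult_mat_vec_index[OF A _ i]) auto
    also have "\<dots> = (\<Sum>j<b. Poly_Mapping.single (lcm_exp c \<sigma> - r i) (l i j * Bm \<sigma> $$ (j, k)))"
    proof (rule sum.cong)
      fix j assume "j \<in> {..<b}"
      then have j: "j < b" by simp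
      have "col B m $ j = Poly_Mapping.single (lcm_exp c \<sigma> - c j) (Bm \<sigma> $$ (j, k))"
        using j m g by (simp add: B_def e_def)
      then have eq: "A $$ (i, j) * col B m $ j =
          Poly_Mapping.single ((c j - r i) + (lcm_exp c \<sigma> - c j)) (l i j * Bm \<sigma> $$ (j, k))"
        using Aij[OF i j] by (simp add: mult_single)
      show "A $$ (i, j) * col B m $ j = Poly_Mapping.single (lcm_exp c \<sigma> - r i) (l i j * Bm \<sigma> $$ (j, k))"
      proof (cases "l i j * Bm \<sigma> $$ (j, k) = 0")
        case False
        then have "j \<in> \<sigma>" using col0[OF \<sigma>(2) j] by fastforce
        then have p2: "ple (c j) (lcm_exp c \<sigma>)" using \<sigma>(1) by (intro ple_lcm_exp) (auto intro: finite_subset)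
        have p1: "ple (r i) (c j)" using lr[OF i j] False by auto
        have "(c j - r i) + (lcm_exp c \<sigma> - c j) = lcm_exp c \<sigma> - r i"
          using p1 p2 by (intro poly_mapping_eqI) (simp add: lookup_add lookup_minus ple_def)
        then show ?thesis unfolding eq by simp
      next
        case True
        show ?thesis unfolding eq True by simp
      qed
    qed simp
    also have "\<dots> = 0" by (simp add: single_sum[symmetric] colsum[OF \<sigma>(2) i])
    finally show "(A *\<^sub>v col B m) $ i = 0\<^sub>v n $ i" using i by simp
  qed (use A in simp)
  have AB: "A * B = 0\<^sub>m n ?N"
  proof (rule eq_matI)
    fix i m assume "i < dim_row (0\<^sub>m n ?N :: ('v, 'k) mpoly mat)" "m < dim_col (0\<^sub>m n ?N :: ('v, 'k) mpoly mat)"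
    then have im: "i < n" "m < ?N" by auto
    have "(A * B) $$ (i, m) = (A *\<^sub>v col B m) $ i" using im A Bc by simp
    then show "(A * B) $$ (i, m) = 0\<^sub>m n ?N $$ (i, m)" using im colB by simp
  qed (use A Bc in auto)
  have "mat_image B \<subseteq> mat_kernel A"
  proof
    fix w assume "w \<in> mat_image B"
    then obtain y where y: "y \<in> carrier_vec ?N" "w = B *\<^sub>v y" by (rule mat_imageE[OF _ Bc])
    have "A *\<^sub>v w = (A * B) *\<^sub>v y" unfolding y(2) by (rule assoc_mult_mat_vec[OF A Bc y(1), symmetric])
    also have "\<dots> = 0\<^sub>v n" unfolding AB using y(1) by (intro eq_vecI) auto
    finally show "w \<in> mat_kernel A" using A Bc y by (intro mat_kernelI) auto
  qed
  moreover have "mat_kernel A \<subseteq> mat_image B"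
  proof
    fix v assume "v \<in> mat_kernel A"
    then have v: "v \<in> carrier_vec b" "A *\<^sub>v v = 0\<^sub>v n" using mat_kernelD[OF A] by auto
    \<comment> \<open>\<open>u a\<close> is the part of \<open>v\<close> of multidegree
      \<open>a\<close>; only the columns in the set \<open>\<sigma> a\<close> below can occur in
      it.\<close>
    define u where "u a = vec b (\<lambda>j. if ple (c j) a then lookup (v $ j) (a - c j) else 0)" for a
    define \<sigma> where "\<sigma> a = {j. j < b \<and> ple (c j) a}" for a
    have \<sigma>b: "\<sigma> a \<subseteq> {..<b}" "finite (\<sigma> a)" for a by (auto simp: \<sigma>_def)
    have uj: "u a $ j = (if ple (c j) a then lookup (v $ j) (a - c j) else 0)" if "j < b" for a j
      using that by (simp add: u_def)
    have uker: "u a \<in> mat_kernel (L (\<sigma> a))" for a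
      unfolding kerL
    proof (intro conjI allI impI)
      show "u a \<in> carrier_vec b" by (simp add: u_def)
      show "u a $ j = 0" if "j < b" "j \<notin> \<sigma> a" for j using that by (simp add: u_def \<sigma>_def)
      fix i assume i: "i < n"
      show "(\<Sum>j<b. l i j * u a $ j) = 0"
      proof (cases "ple (r i) a")
        case False
        have "l i j * u a $ j = 0" if "j < b" for j
          using lr[OF i that] ple_trans[of "r i" "c j" a] False by (auto simp: uj[OF that])
        then show ?thesis by (intro sum.neutral) blast
      next
        case True
        have "0 = lookup ((A *\<^sub>v v) $ i) (a - r i)" using v(2) i by simp
        also have "\<dots> = (\<Sum>j<b. lookup (A $$ (i, j) * v $ j) (a - r i))"
          by (simp add: mult_mat_vec_index[OF A v(1) i] lookup_sum)
        also have "\<dots> = (\<Sum>j<b. l i j * u a $ j)"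
        proof (rule sum.cong)
          fix j assume "j \<in> {..<b}"
          then have j: "j < b" by simp
          show "lookup (A $$ (i, j) * v $ j) (a - r i) = l i j * u a $ j"
          proof (cases "l i j = 0")
            case nz: False
            have p1: "ple (r i) (c j)" by (rule lr[OF i j nz])
            have 1: "ple (c j - r i) (a - r i) \<longleftrightarrow> ple (c j) a"
              using p1 True unfolding ple_def lookup_minus by (metis diff_le_mono le_diff_iff)
            have 2: "a - r i - (c j - r i) = a - c j" if "ple (c j) a"
              using p1 that by (intro poly_mapping_eqI) (simp add: lookup_minus ple_def)
            show ?thesis unfolding Aij[OF i j] lookup_single_mult uj[OF j] using 1 2 by simp
          qed (simp add: Aij[OF i j])
        qed simp
        finally show ?thesis by simp
      qed
    qed
    have "\<exists>y. y \<in> carrier_vec (bm (\<sigma> a)) \<and> u a = Bm (\<sigma> a) *\<^sub>v y" for a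
      using uker[of a] unfolding Bm(2) by (metis mat_imageE Bm(1))
    then obtain y where y: "\<And>a. y a \<in> carrier_vec (bm (\<sigma> a))" "\<And>a. u a = Bm (\<sigma> a) *\<^sub>v y a" by metis
    define F where "F = (\<Union>j<b. (\<lambda>m. m + c j) ` keys (v $ j))"
    have finF: "finite F" by (simp add: F_def)
    \<comment> \<open>The coefficients \<open>y a\<close> belong to generators in degree
      \<open>lcm_exp c (\<sigma> a)\<close>; the monomial moves them up to degree
      \<open>a\<close>.\<close>
    define s where "s a = (\<lambda>(\<rho>, k). if \<rho> = \<sigma> a then Poly_Mapping.single (a - lcm_exp c (\<sigma> a)) (y a $ k) else 0)" for a
    define t where "t = vec ?N (\<lambda>m. \<Sum>a\<in>F. s a (gs ! m))"
    have tc: "t \<in> carrier_vec ?N" by (simp add: t_def)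
    have part: "(\<Sum>m<?N. e j (gs ! m) * s a (gs ! m)) = Poly_Mapping.single (a - c j) (u a $ j)"
      if j: "j < b" for a j
    proof -
      have "(\<Sum>m<?N. e j (gs ! m) * s a (gs ! m)) = (\<Sum>p\<in>?P. e j p * s a p)"
        using sum_nth_distinct[OF gs(2), of "\<lambda>p. e j p * s a p"] gs(1) by simp
      also have "\<dots> = (\<Sum>\<rho>\<in>Pow {..<b}. \<Sum>k<bm \<rho>. e j (\<rho>, k) * s a (\<rho>, k))"
        by (subst sum.Sigma) auto
      also have "\<dots> = (\<Sum>\<rho>\<in>Pow {..<b}. if \<rho> = \<sigma> a then
          (\<Sum>k<bm (\<sigma> a). e j (\<sigma> a, k) * Poly_Mapping.single (a - lcm_exp c (\<sigma> a)) (y a $ k)) else 0)"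
        by (rule sum.cong) (auto simp: s_def)
      also have "\<dots> = (\<Sum>k<bm (\<sigma> a). e j (\<sigma> a, k) * Poly_Mapping.single (a - lcm_exp c (\<sigma> a)) (y a $ k))"
        using \<sigma>b by (simp add: sum.delta)
      also have "\<dots> = (\<Sum>k<bm (\<sigma> a). Poly_Mapping.single (a - c j) (Bm (\<sigma> a) $$ (j, k) * y a $ k))"
      proof (rule sum.cong)
        fix k assume "k \<in> {..<bm (\<sigma> a)}"
        then have k: "k < bm (\<sigma> a)" by simp
        show "e j (\<sigma> a, k) * Poly_Mapping.single (a - lcm_exp c (\<sigma> a)) (y a $ k) =
            Poly_Mapping.single (a - c j) (Bm (\<sigma> a) $$ (j, k) * y a $ k)"
        proof (cases "j \<in> \<sigma> a")
          case True
          have p1: "ple (c j) (lcm_exp c (\<sigma> a))" by (rule ple_lcm_exp[OF \<sigma>b(2) True])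
          have p2: "ple (lcm_exp c (\<sigma> a)) a" by (rule lcm_exp_ple[OF \<sigma>b(2)]) (simp add: \<sigma>_def)
          have "(lcm_exp c (\<sigma> a) - c j) + (a - lcm_exp c (\<sigma> a)) = a - c j"
            using p1 p2 by (intro poly_mapping_eqI) (simp add: lookup_add lookup_minus ple_def)
          then show ?thesis by (simp add: e_def mult_single)
        next
          case False
          then show ?thesis using col0[OF k j False] by (simp add: e_def)
        qed
      qed simp
      also have "\<dots> = Poly_Mapping.single (a - c j) (u a $ j)"
        by (simp add: single_sum[symmetric] y(2) mult_mat_vec_index[OF Bm(1) y(1) j])
      finally show ?thesis .
    qed
    have "v = B *\<^sub>v t"
    proof (rule eq_vecI)
      fix j assume "j < dim_vec (B *\<^sub>v t)"
      then have j: "j < b" using Bc by simp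
      have "(B *\<^sub>v t) $ j = (\<Sum>m<?N. e j (gs ! m) * (\<Sum>a\<in>F. s a (gs ! m)))"
        using j by (simp add: mult_mat_vec_index[OF Bc tc j]) (simp add: B_def t_def)
      also have "\<dots> = (\<Sum>a\<in>F. \<Sum>m<?N. e j (gs ! m) * s a (gs ! m))"
        unfolding sum_distrib_left by (rule sum.swap)
      also have "\<dots> = (\<Sum>a\<in>F. Poly_Mapping.single (a - c j) (u a $ j))" by (simp add: part[OF j])
      also have "\<dots> = v $ j"
      proof (rule poly_mapping_eqI)
        fix m
        have "lookup (\<Sum>a\<in>F. Poly_Mapping.single (a - c j) (u a $ j)) m =
            (\<Sum>a\<in>F. if a = m + c j then lookup (v $ j) m else 0)"
          unfolding lookup_sum
        proof (rule sum.cong)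
          fix a
          show "lookup (Poly_Mapping.single (a - c j) (u a $ j)) m = (if a = m + c j then lookup (v $ j) m else 0)"
          proof (cases "ple (c j) a")
            case True
            then have "a - c j = m \<longleftrightarrow> a = m + c j" using ple_add_diff[OF True] by auto
            then show ?thesis using True by (auto simp: lookup_single when_def uj[OF j])
          next
            case False
            then have "a \<noteq> m + c j" by auto
            then show ?thesis using False by (simp add: uj[OF j])
          qed
        qed simp
        also have "\<dots> = (if m + c j \<in> F then lookup (v $ j) m else 0)" using finF by (simp add: sum.delta)
        also have "\<dots> = lookup (v $ j) m"
        proof (cases "lookup (v $ j) m = 0")
          case False
          then have "m \<in> keys (v $ j)" by (simp add: in_keys_iff)
          then have "m + c j \<in> F" using j unfolding F_def by blast
          then show ?thesis by simp
        qed simp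
        finally show "lookup (\<Sum>a\<in>F. Poly_Mapping.single (a - c j) (u a $ j)) m = lookup (v $ j) m" .
      qed
      finally show "v $ j = (B *\<^sub>v t) $ j" by simp
    qed (use v Bc in simp)
    then show "v \<in> mat_image B" using mat_imageI[OF Bc tc] by simp
  qed
  ultimately show ?thesis using that[OF Bc homB] by blast
qed

section \<open>Monomial ideals and the existence of their resolutions\<close>

definition up_set :: "('v \<Rightarrow>\<^sub>0 nat) set \<Rightarrow> ('v \<Rightarrow>\<^sub>0 nat) set" where
  "up_set G = {m. \<exists>d\<in>G. ple d m}"

lemma poly_mapping_sum_single: "p = (\<Sum>m\<in>keys p. Poly_Mapping.single m (lookup p m))"
  by (rule poly_mapping_eqI) (simp add: lookup_sum lookup_single when_def in_keys_iff)

lemma keys_mult_single_up_set: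
  fixes p :: "('v, 'k::field) mpoly"
  assumes "d \<in> G"
  shows "keys (p * Poly_Mapping.single d 1) \<subseteq> up_set G"
proof
  fix m assume "m \<in> keys (p * Poly_Mapping.single d 1)"
  then have "lookup (Poly_Mapping.single d 1 * p) m \<noteq> 0" by (simp add: in_keys_iff mult.commute)
  then have "ple d m" by (auto simp: lookup_single_mult split: if_splits)
  then show "m \<in> up_set G" using assms by (auto simp: up_set_def)
qed

lemma keys_sum_subset: "(\<And>j. j \<in> J \<Longrightarrow> keys (f j) \<subseteq> M) \<Longrightarrow> keys (sum f J) \<subseteq> M"
proof
  fix m assume a: "\<And>j. j \<in> J \<Longrightarrow> keys (f j) \<subseteq> M" and "m \<in> keys (sum f J)"
  then have "(\<Sum>j\<in>J. lookup (f j) m) \<noteq> 0" by (simp add: in_keys_iff lookup_sum)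
  then obtain j where j: "j \<in> J" "lookup (f j) m \<noteq> 0" by (meson sum.neutral)
  then have "m \<in> keys (f j)" by (simp add: in_keys_iff)
  then show "m \<in> M" using a[OF j(1)] by blast
qed

text \<open>The first matrix lists the generators. Each further one presents the kernel of its
  predecessor and is again homogeneous, so dependent choice applies once the degrees of rows and
  columns are carried along with the matrix.\<close>

lemma free_resolution_exists:
  fixes G :: "('v::finite \<Rightarrow>\<^sub>0 nat) set"
  assumes "finite G"
  shows "\<exists>D. free_resolution D {p :: ('v, 'k::field) mpoly. keys p \<subseteq> up_set G}"
proof -
  obtain gs where gs: "set gs = G" using finite_list[OF assms] by blast
  let ?N = "length gs"
  define D0 :: "('v, 'k) mpoly mat" where "D0 = mat 1 ?N (\<lambda>(_, k). Poly_Mapping.single (gs ! k) 1)"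
  have D0c: "D0 \<in> carrier_mat 1 ?N" by (simp add: D0_def)
  have D0v: "(D0 *\<^sub>v v) $ 0 = (\<Sum>k<?N. v $ k * Poly_Mapping.single (gs ! k) 1)" if "v \<in> carrier_vec ?N" for v
    by (subst mult_mat_vec_index[OF D0c that]) (auto simp: D0_def mult.commute intro!: sum.cong)
  have hom0: "hom_mat (\<lambda>_. 0) (\<lambda>k. gs ! k) D0"
    by (auto simp: hom_mat_def D0_def split: if_splits)
  have im0: "(\<lambda>w. w $ 0) ` mat_image D0 = {p. keys p \<subseteq> up_set G}"
  proof (intro equalityI subsetI)
    fix p assume "p \<in> (\<lambda>w. w $ 0) ` mat_image D0"
    then obtain v where v: "v \<in> carrier_vec ?N" "p = (D0 *\<^sub>v v) $ 0" using D0c by (auto simp: mat_image_def)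
    have "keys p \<subseteq> up_set G"
      unfolding v(2) D0v[OF v(1)] using gs by (intro keys_sum_subset keys_mult_single_up_set) auto
    then show "p \<in> {p. keys p \<subseteq> up_set G}" by simp
  next
    fix p :: "('v, 'k) mpoly" assume "p \<in> {p. keys p \<subseteq> up_set G}"
    then have "\<exists>k<?N. ple (gs ! k) m" if "m \<in> keys p" for m
      using that gs by (fastforce simp: up_set_def in_set_conv_nth)
    \<comment> \<open>Each monomial is assigned to one generator that divides it.\<close>
    then obtain h where h: "\<And>m. m \<in> keys p \<Longrightarrow> h m < ?N \<and> ple (gs ! h m) m" by metis
    define v where "v = vec ?N (\<lambda>k. \<Sum>m\<in>keys p. if h m = k then Poly_Mapping.single (m - gs ! k) (lookup p m) else 0)"
    have vc: "v \<in> carrier_vec ?N" by (simp add: v_def)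
    have "(D0 *\<^sub>v v) $ 0 = (\<Sum>k<?N. (\<Sum>m\<in>keys p. if h m = k then Poly_Mapping.single m (lookup p m) else 0))"
      unfolding D0v[OF vc]
    proof (rule sum.cong)
      fix k assume "k \<in> {..<?N}"
      then show "v $ k * Poly_Mapping.single (gs ! k) 1 =
          (\<Sum>m\<in>keys p. if h m = k then Poly_Mapping.single m (lookup p m) else 0)"
        using h by (auto simp: v_def sum_distrib_right mult_single ple_add_diff intro!: sum.cong)
    qed simp
    also have "\<dots> = (\<Sum>m\<in>keys p. \<Sum>k<?N. if h m = k then Poly_Mapping.single m (lookup p m) else 0)"
      by (rule sum.swap)
    also have "\<dots> = (\<Sum>m\<in>keys p. Poly_Mapping.single m (lookup p m))"
      using h by (intro sum.cong) auto
    finally have "p = (D0 *\<^sub>v v) $ 0" using poly_mapping_sum_single[of p] by simp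
    then show "p \<in> (\<lambda>w. w $ 0) ` mat_image D0" using mat_imageI[OF D0c vc] by blast
  qed
  let ?S = "\<lambda>k (x :: ('v, 'k) mpoly mat \<times> (nat \<Rightarrow> 'v \<Rightarrow>\<^sub>0 nat) \<times> (nat \<Rightarrow> 'v \<Rightarrow>\<^sub>0 nat)).
    hom_mat (fst (snd x)) (snd (snd x)) (fst x) \<and> (k = 0 \<longrightarrow> fst x = D0)"
  let ?T = "\<lambda>(k :: nat) (x :: ('v, 'k) mpoly mat \<times> (nat \<Rightarrow> 'v \<Rightarrow>\<^sub>0 nat) \<times> (nat \<Rightarrow> 'v \<Rightarrow>\<^sub>0 nat)) y.
    dim_row (fst y) = dim_col (fst x) \<and> mat_kernel (fst x) = mat_image (fst y)"
  have "\<exists>f. \<forall>k. ?S k (f k) \<and> ?T k (f k) (f (Suc k))"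
  proof (rule dependent_nat_choice)
    show "\<exists>x. ?S 0 x" using hom0 by (intro exI[of _ "(D0, (\<lambda>_. 0), (\<lambda>k. gs ! k))"]) simp
    fix x and k :: nat
    assume x: "?S k x"
    obtain A r c where xe: "x = (A, r, c)" by (cases x) auto
    have A: "A \<in> carrier_mat (dim_row A) (dim_col A)" by simp
    have hA: "hom_mat r c A" using x xe by simp
    obtain B b' c' where "B \<in> carrier_mat (dim_col A) b'" "hom_mat c c' B" "mat_kernel A = mat_image B"
      using hom_mat_kernel[OF A hA] by blast
    then show "\<exists>y. ?S (Suc k) y \<and> ?T k x y" by (intro exI[of _ "(B, c, c')"]) (auto simp: xe)
  qed
  then obtain f where f: "\<And>k. ?S k (f k)" "\<And>k. ?T k (f k) (f (Suc k))" by blast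
  have "fst (f 0) = D0" using f(1)[of 0] by simp
  then have "free_resolution (\<lambda>k. fst (f k)) {p :: ('v, 'k) mpoly. keys p \<subseteq> up_set G}"
    unfolding free_resolution_def using f(2) im0 D0c by auto
  then show ?thesis by blast
qed

section \<open>Projective dimension of 3-path ideals\<close>

lemma ideal_generated_monomials:
  fixes G :: "('v \<Rightarrow>\<^sub>0 nat) set"
  shows "ideal_generated ((\<lambda>d. Poly_Mapping.single d 1) ` G) = {p :: ('v, 'k::field) mpoly. keys p \<subseteq> up_set G}"
proof -
  interpret module "(*) :: ('v, 'k) mpoly \<Rightarrow> _" by unfold_locales (simp_all add: algebra_simps)
  let ?B = "(\<lambda>d. Poly_Mapping.single d 1 :: ('v, 'k) mpoly) ` G"
  have "span ?B = {p. keys p \<subseteq> up_set G}"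
  proof (intro equalityI subsetI)
    fix p assume "p \<in> span ?B"
    then show "p \<in> {p. keys p \<subseteq> up_set G}"
    proof (induction rule: span_induct_alt)
      case base
      then show ?case by simp
    next
      case (step q x y)
      then obtain d where "d \<in> G" "x = Poly_Mapping.single d 1" by blast
      then have "keys (q * x) \<subseteq> up_set G" using keys_mult_single_up_set by blast
      then show ?case using step keys_add[of "q * x" y] by blast
    qed
  next
    fix p :: "('v, 'k) mpoly" assume p: "p \<in> {p. keys p \<subseteq> up_set G}"
    have "(\<Sum>m\<in>keys p. Poly_Mapping.single m (lookup p m)) \<in> span ?B"
    proof (rule span_sum)
      fix m assume "m \<in> keys p"
      then obtain d where d: "d \<in> G" "ple d m" using p by (auto simp: up_set_def)
      have "Poly_Mapping.single m (lookup p m) = Poly_Mapping.single (m - d) (lookup p m) * Poly_Mapping.single d 1"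
        by (simp add: mult_single ple_add_diff[OF d(2)])
      then show "Poly_Mapping.single m (lookup p m) \<in> span ?B" using d(1) by (auto intro: span_scale span_base)
    qed
    then show "p \<in> span ?B" using poly_mapping_sum_single[of p] by simp
  qed
  then show ?thesis by (simp add: ideal_generated_def)
qed

lemma path_ideal3_eq:
  fixes H :: "'v::finite graph"
  shows "path_ideal3 H = {p :: ('v, 'k::field) mpoly. keys p \<subseteq> up_set (expo ` {{x, y, z} | x y z. is_3path H x y z})}"
proof -
  have gen: "indet x * indet y * indet z = (Poly_Mapping.single (expo {x, y, z}) 1 :: ('v, 'k) mpoly)"
    if "is_3path H x y z" for x y z
  proof -
    have "expo {x, y, z} = Poly_Mapping.single x 1 + Poly_Mapping.single y 1 + Poly_Mapping.single z 1"
      using that by (simp add: is_3path_def expo_insert) (simp add: ac_simps)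
    then show ?thesis by (simp add: indet_def mult_single)
  qed
  have "{indet x * indet y * indet z | x y z. is_3path H x y z} =
      ((\<lambda>d. Poly_Mapping.single d 1 :: ('v, 'k) mpoly) ` expo ` {{x, y, z} | x y z. is_3path H x y z})"
    (is "?L = ?R")
  proof (intro equalityI subsetI)
    fix p assume "p \<in> ?L"
    then obtain x y z where "is_3path H x y z" "p = indet x * indet y * indet z" by blast
    then show "p \<in> ?R" using gen by blast
  next
    fix p assume "p \<in> ?R"
    then obtain x y z where "is_3path H x y z" "p = Poly_Mapping.single (expo {x, y, z}) 1" by blast
    then show "p \<in> ?L" using gen[symmetric] by blast
  qed
  then show ?thesis by (simp add: path_ideal3_def ideal_generated_monomials)
qed

lemma up_set_3paths: "up_set (expo ` {{x, y, z} | x y z. is_3path H x y z}) = {m. has_3path H (keys m)}"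
  by (auto simp: up_set_def has_3path_def ple_expo)

text \<open>The index shift is that from the ideal to the quotient. The empty multidegree drops out
  because it contributes to degree 0 only.\<close>

lemma betti_path_ideal3:
  fixes H :: "'v::finite graph"
  shows "betti (path_ideal3 H :: ('v, 'k::field) mpoly set) i \<noteq> 0 \<longleftrightarrow> Suc i \<in> tor_support TYPE('k) H"
proof -
  have I: "path_ideal3 H = {p :: ('v, 'k) mpoly. keys p \<subseteq> {m. has_3path H (keys m)}}"
    by (simp add: path_ideal3_eq up_set_3paths)
  have "\<exists>D. free_resolution D (path_ideal3 H :: ('v, 'k) mpoly set)"
    unfolding path_ideal3_eq by (rule free_resolution_exists) simp
  then have "betti (path_ideal3 H :: ('v, 'k) mpoly set) i \<noteq> 0 \<longleftrightarrow>
      \<not> kos_exact TYPE('k) {m. has_3path H (keys m)} i"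
    using I by (rule betti_nonzero_iff)
  also have "\<dots> \<longleftrightarrow> (\<exists>W. W \<noteq> {} \<and> tor_nz TYPE('k) (has_3path H) W (Suc i))"
    by (simp add: kos_exact_squarefree[OF mono_has_3path])
  also have "\<dots> \<longleftrightarrow> Suc i \<in> tor_support TYPE('k) H"
    by (auto simp: tor_support_def) (metis nat.distinct(1) tor_nz_empty)
  finally show ?thesis .
qed

lemma path_ideal3_zero:
  fixes H :: "'v::finite graph"
  assumes "path_ideal3 H = ({0} :: ('v, 'k::field) mpoly set)"
  shows "tor_support TYPE('k) H = {0}"
proof -
  have no: "\<not> has_3path H U" for U
  proof
    assume h: "has_3path H U"
    have "Poly_Mapping.single (expo U) (1 :: 'k) \<in> path_ideal3 H"
      unfolding path_ideal3_eq up_set_3paths using h by simp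
    then show False using assms keys_single[of "expo U" "1 :: 'k"] by (metis insert_not_empty keys_zero singletonD zero_neq_one)
  qed
  have "\<not> tor_nz TYPE('k) (has_3path H) W (Suc i)" for W i
  proof (cases "W = {}")
    case False
    then obtain v where "v \<in> W" by blast
    then show ?thesis by (rule tor_nz_isolated) (simp add: no)
  qed (simp add: tor_nz_empty)
  then show ?thesis using zero_in_tor_support[of H, where ?'a = 'k]
    by (auto simp: tor_support_def) (metis not0_implies_Suc)
qed

text \<open>No proper subset of the vertices \<open>W\<close> of one 3-path contains a 3-path, so
  the complement of its family in \<open>Pow W\<close> is \<open>{{}}\<close>. The class found is
  that of a minimal generator; it guarantees a positive degree for every nonzero ideal.\<close>

lemma one_in_tor_support:
  fixes H :: "'v::finite graph"
  assumes "has_3path H U"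
  shows "Suc 0 \<in> tor_support TYPE('k::field) H"
proof -
  obtain x y z where xyz: "is_3path H x y z" using assms by (auto simp: has_3path_def)
  define W where "W = {x, y, z}"
  have W: "card W = 3" "x \<in> W" "has_3path H W"
    using xyz by (auto simp: W_def is_3path_def has_3path_def)
  have small: "\<not> has_3path H V" if "card V < 3" for V
  proof
    assume "has_3path H V"
    then obtain a b c where abc: "distinct [a, b, c]" "{a, b, c} \<subseteq> V"
      by (auto simp: has_3path_def is_3path_def)
    have "card {a, b, c} \<le> card V" by (rule card_mono) (use abc in auto)
    then show False using abc that by simp
  qed
  have fam: "nfam (has_3path H) W = Pow W - {{}}"
  proof -
    have "\<not> has_3path H (W - \<tau>)" if "\<tau> \<subseteq> W" "\<tau> \<noteq> {}" for \<tau>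
    proof (rule small)
      have "W - \<tau> \<subset> W" using that by blast
      then have "card (W - \<tau>) < card W" by (intro psubset_card_mono) auto
      then show "card (W - \<tau>) < 3" using W(1) by simp
    qed
    then show ?thesis using W(3) by (auto simp: nfam_def)
  qed
  have "nfam (\<lambda>_. False) {} = {{} :: 'v set}" by (auto simp: nfam_def)
  then have "hnz TYPE('k) {{} :: 'v set} 0"
    using tor_nz_empty[of "\<lambda>_ :: 'v set. False" 0, where ?'a = 'k] by (simp add: tor_nz_def)
  then have "hnz TYPE('k) (Pow W - {{}}) (Suc 0)"
    using hnz_complement[OF W(2), of "{{}}" 0, where ?'a = 'k] by auto
  then have "tor_nz TYPE('k) (has_3path H) W (Suc 0)" by (simp add: tor_nz_def fam)
  then show ?thesis by (auto simp: tor_support_def)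
qed

text \<open>For the zero ideal the maximum is 0, which matches the convention -1. Otherwise a
  positive degree occurs, and lowering the index by one commutes with the maximum.\<close>

lemma pd_path_ideal3:
  fixes H :: "'v::finite graph"
  shows "pd (path_ideal3 H :: ('v, 'k::field) mpoly set) = int (Max (tor_support TYPE('k) H)) - 1"
proof (cases "path_ideal3 H = ({0} :: ('v, 'k) mpoly set)")
  case True
  then show ?thesis using path_ideal3_zero[OF True] by (simp add: pd_def)
next
  case False
  let ?T = "tor_support TYPE('k) H" and ?I = "path_ideal3 H :: ('v, 'k) mpoly set"
  have ne: "?I \<noteq> {}" "?T \<noteq> {}" using zero_in_tor_support[of H, where ?'a = 'k] by (auto simp: path_ideal3_eq intro: exI[of _ 0])
  obtain p where p: "p \<in> ?I" "p \<noteq> 0" using False ne(1) by blast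
  then obtain m where "m \<in> keys p" "has_3path H (keys m)"
    unfolding path_ideal3_eq up_set_3paths using keys_eq_empty[of p] by blast
  then have "\<exists>i. Suc i \<in> ?T" using one_in_tor_support by metis
  then obtain i where i: "Suc i \<in> ?T" by blast
  have fin: "finite ?T" by (rule finite_tor_support)
  have "Suc i \<le> Max ?T" by (rule Max_ge[OF fin i])
  then obtain m where m: "Max ?T = Suc m" by (cases "Max ?T") auto
  have "{i. betti ?I i \<noteq> 0} = {i. Suc i \<in> ?T}" by (simp only: betti_path_ideal3)
  moreover have "Sup {i. Suc i \<in> ?T} = m"
  proof -
    have "Suc m \<in> ?T" using Max_in[OF fin ne(2)] m by simp
    moreover have "j \<le> m" if "Suc j \<in> ?T" for j using Max_ge[OF fin that] m by simp
    ultimately show ?thesis by (intro cSup_eq_maximum) auto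
  qed
  ultimately show ?thesis using False m by (simp add: pd_def)
qed

section \<open>Levels, connectedness and the final formula\<close>

lemma level_root:
  assumes "r \<in> verts T"
  shows "level T r r = 0"
proof -
  have "(THE p. is_path_between T r p r) = [r]"
  proof (rule the_equality)
    show "is_path_between T r [r] r" using assms by (simp add: is_path_between_def is_path_def)
    fix p assume "is_path_between T r p r"
    then have p: "p \<noteq> []" "distinct p" "hd p = r" "last p = r"
      by (auto simp: is_path_between_def is_path_def)
    then obtain q where q: "p = r # q" by (metis list.exhaust_sel)
    then have "q = []" using p last_in_set[of q] by (auto split: if_splits)
    then show "p = [r]" using q by simp
  qed
  then show ?thesis by (simp add: level_def)
qed

lemma connected_closed_set:
  assumes "connected_graph G" "x \<in> S" "x \<in> verts G"
    and closed: "\<And>u v. u \<in> S \<Longrightarrow> v \<in> nbrs G u \<Longrightarrow> v \<in> S"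
  shows "verts G \<subseteq> S"
proof
  fix y assume "y \<in> verts G"
  then obtain p where p: "is_path_between G x p y"
    using assms(1,3) unfolding connected_graph_def by blast
  have "successively (\<lambda>x y. {x, y} \<in> edges G) p \<Longrightarrow> p \<noteq> [] \<Longrightarrow> hd p \<in> S \<Longrightarrow> last p \<in> S" for p
  proof (induction p)
    case (Cons u q)
    then show ?case using closed[of u] by (cases q) (auto simp: nbrs_def)
  qed simp
  then show "y \<in> S" using p assms(2) by (auto simp: is_path_between_def is_path_def)
qed

theorem theorem4p3:
  fixes G G1 G2 G3 T :: "'v::finite graph" and vs :: "'v list" and r x0 y0 :: 'v
    and z :: "nat \<Rightarrow> 'v" and s :: nat and p1 p2 p3 :: int
  assumes "simple_graph G" and "verts G = UNIV"
    and "connected_graph G" and "at_most_one_cycle G"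
    and "is_root_list G vs" and "r \<in> set vs" and "T = attached_tree G vs r"
    and "z 0 \<in> verts T" and "is_leaf G (z 0)"
    and "\<And>w. w \<in> verts T \<Longrightarrow> is_leaf G w \<Longrightarrow> level T r w \<le> level T r (z 0)"
    and "level T r (z 0) \<ge> 2"
    and "nbrs G (z 0) = {y0}"
    and "nbrs G y0 = z ` {0..s} \<union> {x0}" and "inj_on z {0..s}"
    and "\<And>j. j \<le> s \<Longrightarrow> is_leaf G (z j) \<and> level T r (z j) = level T r (z 0)"
    and "level T r x0 < level T r y0"
    and "G1 = delete_verts G (z ` {0..s})"
    and "G2 = delete_verts G (closed_nbrs G {y0})"
    and "G3 = delete_verts G (closed_nbrs G {y0, x0})"
    and "p1 = pd (path_ideal3 G1 :: ('v, 'k::field) mpoly set)"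
    and "p2 = pd (path_ideal3 G2 :: ('v, 'k) mpoly set)"
    and "p3 = pd (path_ideal3 G3 :: ('v, 'k) mpoly set)"
  shows "pd (path_ideal3 G :: ('v, 'k) mpoly set) =
    (if s > 0
     then Max {p1, p2 + int s + 1, p3 + int (card (nbrs G x0)) + int s}
     else Max {p1, p3 + int (card (nbrs G x0))})"
proof -
  note simple = assms(1) and verts = assms(2) and leaf = assms(15) and nbrs_y0 = assms(13)
  let ?Z = "z ` {0..s}"
  have nbrs_sym: "v \<in> nbrs G u \<longleftrightarrow> u \<in> nbrs G v" for u v by (simp add: nbrs_def insert_commute)
  have nbrs_Z: "nbrs G w = {y0}" if "w \<in> ?Z" for w
  proof -
    have "card (nbrs G w) = 1" using leaf that by (auto simp: is_leaf_def)
    then obtain u where u: "nbrs G w = {u}" by (rule card_1_singletonE)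
    moreover have "y0 \<in> nbrs G w" using that nbrs_y0 nbrs_sym[of y0 w] by blast
    ultimately show ?thesis by simp
  qed
  have rT: "r \<in> verts T"
    using assms(2,7) by (auto simp: attached_tree_def component_of_def induced_def is_path_between_def
        is_path_def delete_edges_def intro!: exI[of _ "[r]"])
  \<comment> \<open>The equation for the neighbours of \<open>y0\<close> does not by itself exclude
    that \<open>x0\<close> is one of the leaves. If it were, connectedness would make the graph a
    star with centre \<open>y0\<close>, and the root would be \<open>y0\<close> or one of the
    leaves. Then \<open>y0\<close> or \<open>z 0\<close> would have level 0, as all these leaves
    have the level of \<open>z 0\<close>.\<close>
  have x0: "x0 \<notin> ?Z"
  proof
    assume "x0 \<in> ?Z"
    then have nb: "nbrs G y0 = ?Z" using nbrs_y0 by blast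
    have "verts G \<subseteq> insert y0 ?Z"
      by (rule connected_closed_set[OF assms(3), of y0]) (use nb nbrs_Z verts in auto)
    then have "r = y0 \<or> r \<in> ?Z" using verts by blast
    then have "level T r y0 = 0 \<or> level T r (z 0) = 0"
    proof
      assume "r \<in> ?Z"
      then obtain j where j: "j \<le> s" "r = z j" by auto
      then have "level T r (z 0) = level T r r" using leaf[OF j(1)] by metis
      then show ?thesis using level_root[OF rT] by simp
    qed (use level_root[OF rT] in simp)
    then show False using assms(11,16) by linarith
  qed
  interpret leaf_star G ?Z x0 y0
    by unfold_locales (use simple verts nbrs_Z nbrs_y0 x0 in auto)
  have card: "card ?Z = Suc s" using assms(14) by (simp add: card_image)
  let ?q = "\<lambda>X. max_tor TYPE('k) X"
  \<comment> \<open>All four projective dimensions are maximal degrees lowered by one, so the shift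
    cancels.\<close>
  have p: "p1 = int (?q ?Z) - 1" "p2 = int (?q (closed_nbrs G {y0})) - 1"
    "p3 = int (?q (closed_nbrs G {y0, x0})) - 1"
    using assms(17-22) by (simp_all add: pd_path_ideal3)
  show ?thesis
    unfolding pd_path_ideal3 Max_tor_support[OF card refl refl refl] p
    by (auto simp: max_def)
qed

end
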